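(* Let $\hat X$ be a nonnegative diffusion, the unique weak solution of $d\hat X_t=\hat\sigma(\hat X_t)dB_t+\hat\mu(\hat X_t)dt$, $\hat X_0=x\ge0$, whose coefficients do not depend on time and satisfy, for all $t\ge0$, $$\mathbb E\int_0^t\hat\sigma^2(\hat X_u)\,du<\infty,\qquad\mathbb E\int_0^t|\hat\mu(\hat X_u)|\,du<\infty ,$$ and assume $\hat\sigma\in\mathcal C^1$ with $|\hat\sigma|>0$. Let $$f(y)=e^{\int_a^y(\hat\sigma(z))^{-1}dz}$$ be well defined for an arbitrarily chosen point $a$. If for every $y\ge0$ $$\hat\mu(y)=\frac{\hat\sigma(y)}{2}\big(1+\hat\sigma'(y)\big),$$ and $f$ satisfies hypothesis H for $\hat X$, then the process $(f(\hat X_t),t\ge0)$ is associated to the process $(f(x)e^{B_t+t/2},t\ge0)$.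
   Context: $B$ is a standard Brownian motion. A process $Y$ is associated to a process $Z$ if $Y_t$ and $Z_t$ have the same distribution for every $t$. Hypothesis H: for a given diffusion $\hat X$ with (time-independent) coefficients $(\hat\sigma,\hat\mu)$, $f\in\mathcal C^2$ satisfies hypothesis H if for all $t\ge0$, $\lambda\ge0$: (i) $\mathbb E e^{-\lambda f(\hat X_t)}<\infty$; (ii) $\mathbb E\int_0^te^{-2\lambda f(\hat X_u)}(f'(\hat X_u))^2\hat\sigma^2(\hat X_u)du<\infty$; (iii) $\mathbb E\int_0^te^{-\lambda f(\hat X_u)}\big|\frac12f''(\hat X_u)\hat\sigma^2(\hat X_u)+f'(\hat X_u)\hat\mu(\hat X_u)\big|du<\infty$; (iv) $\frac{\partial^i}{\partial\lambda^i}\mathbb E e^{-\lambda f(\hat X_t)}=(-1)^i\mathbb E f^i(\hat X_t)e^{-\lambda f(\hat X_t)}<\infty$ for $i=1,2$. *)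

theory Defs
  imports "HOL-Probability.Probability"
begin

definition filtered_prob_space :: "'a measure \<Rightarrow> (real \<Rightarrow> 'a measure) \<Rightarrow> bool" where
  "filtered_prob_space M F \<longleftrightarrow>
     prob_space M \<and> filtration (space M) F \<and> (\<forall>t. sets (F t) \<subseteq> sets M)"

text \<open>Processes are indexed by real numbers; only times \<open>t \<ge> 0\<close> are ever inspected.\<close>

definition adapted :: "(real \<Rightarrow> 'a measure) \<Rightarrow> (real \<Rightarrow> 'a \<Rightarrow> real) \<Rightarrow> bool" where
  "adapted F X \<longleftrightarrow> (\<forall>t\<ge>0. X t \<in> borel_measurable (F t))"

definition continuous_paths :: "'a measure \<Rightarrow> (real \<Rightarrow> 'a \<Rightarrow> real) \<Rightarrow> bool" where
  "continuous_paths M X \<longleftrightarrow> (\<forall>\<omega>\<in>space M. continuous_on {0..} (\<lambda>t. X t \<omega>))"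

definition brownian_motion ::
  "'a measure \<Rightarrow> (real \<Rightarrow> 'a measure) \<Rightarrow> (real \<Rightarrow> 'a \<Rightarrow> real) \<Rightarrow> bool" where
  "brownian_motion M F B \<longleftrightarrow>
     filtered_prob_space M F \<and> adapted F B \<and> continuous_paths M B \<and>
     (AE \<omega> in M. B 0 \<omega> = 0) \<and>
     (\<forall>s t. 0 \<le> s \<and> s < t \<longrightarrow>
        distributed M lborel (\<lambda>\<omega>. B t \<omega> - B s \<omega>)
          (\<lambda>y. ennreal (normal_density 0 (sqrt (t - s)) y)) \<and>
        prob_space.indep_set M (sets (F s))
          (sets (vimage_algebra (space M) (\<lambda>\<omega>. B t \<omega> - B s \<omega>) borel)))"

text \<open>\<open>S\<close> is an elementary predictable integrand on \<open>[0,t]\<close>, and \<open>J\<close> is its stochastic integral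
  \<open>\<integral>\<^sub>0\<^sup>t S dB\<close>.\<close>

definition elementary_integral ::
  "'a measure \<Rightarrow> (real \<Rightarrow> 'a measure) \<Rightarrow> (real \<Rightarrow> 'a \<Rightarrow> real) \<Rightarrow> real \<Rightarrow>
   (real \<Rightarrow> 'a \<Rightarrow> real) \<Rightarrow> ('a \<Rightarrow> real) \<Rightarrow> bool" where
  "elementary_integral M F B t S J \<longleftrightarrow>
     (\<exists>(n::nat) (ts::nat \<Rightarrow> real) (\<xi>::nat \<Rightarrow> 'a \<Rightarrow> real).
        0 \<le> ts 0 \<and> (\<forall>i<n. ts i \<le> ts (Suc i)) \<and> ts n \<le> t \<and>
        (\<forall>i<n. \<xi> i \<in> borel_measurable (F (ts i)) \<and> (\<exists>C. \<forall>\<omega>\<in>space M. \<bar>\<xi> i \<omega>\<bar> \<le> C)) \<and>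
        S = (\<lambda>u \<omega>. \<Sum>i<n. \<xi> i \<omega> * indicator {ts i<..ts (Suc i)} u) \<and>
        J = (\<lambda>\<omega>. \<Sum>i<n. \<xi> i \<omega> * (B (ts (Suc i)) \<omega> - B (ts i) \<omega>)))"

text \<open>\<open>I\<close> is a version of the Ito integral \<open>\<integral>\<^sub>0\<^sup>t H dB\<close> of a progressively measurable integrand:
  there are elementary integrands \<open>S k\<close> with \<open>\<integral>\<^sub>0\<^sup>t (S k - H)\<^sup>2 du \<rightarrow> 0\<close> in probability whose
  integrals converge to \<open>I\<close> in probability. The limit does not depend, up to null sets, on the
  choice of the \<open>S k\<close>.\<close>

definition ito_integral ::
  "'a measure \<Rightarrow> (real \<Rightarrow> 'a measure) \<Rightarrow> (real \<Rightarrow> 'a \<Rightarrow> real) \<Rightarrow> real \<Rightarrow>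
   (real \<Rightarrow> 'a \<Rightarrow> real) \<Rightarrow> ('a \<Rightarrow> real) \<Rightarrow> bool" where
  "ito_integral M F B t H I \<longleftrightarrow>
     (\<forall>s\<in>{0..t}. (\<lambda>(u, \<omega>). H u \<omega>) \<in> borel_measurable (restrict_space borel {0..s} \<Otimes>\<^sub>M F s)) \<and>
     (AE \<omega> in M. set_integrable lborel {0..t} (\<lambda>u. (H u \<omega>)\<^sup>2)) \<and>
     I \<in> borel_measurable M \<and>
     (\<exists>S J. (\<forall>k::nat. elementary_integral M F B t (S k) (J k)) \<and>
        (\<forall>\<epsilon>>0. (\<lambda>k. measure M {\<omega> \<in> space M.
            (\<integral>\<^sup>+u\<in>{0..t}. ennreal ((S k u \<omega> - H u \<omega>)\<^sup>2) \<partial>lborel) > ennreal \<epsilon>}) \<longlonglongrightarrow> 0) \<and>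
        (\<forall>\<epsilon>>0. (\<lambda>k. measure M {\<omega> \<in> space M. \<bar>J k \<omega> - I \<omega>\<bar> > \<epsilon>}) \<longlonglongrightarrow> 0))"

text \<open>\<open>(M, F, B, X)\<close> is a weak solution of \<open>dX = \<sigma>(X) dB + \<mu>(X) dt\<close>, \<open>X 0 = x\<close>, with values in the
  state space \<open>D\<close>; the values of \<open>\<sigma>\<close> and \<open>\<mu>\<close> outside \<open>D\<close> are irrelevant.\<close>

definition weak_solution ::
  "real set \<Rightarrow> (real \<Rightarrow> real) \<Rightarrow> (real \<Rightarrow> real) \<Rightarrow> real \<Rightarrow>
   'a measure \<Rightarrow> (real \<Rightarrow> 'a measure) \<Rightarrow> (real \<Rightarrow> 'a \<Rightarrow> real) \<Rightarrow> (real \<Rightarrow> 'a \<Rightarrow> real) \<Rightarrow> bool" where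
  "weak_solution D \<sigma> \<mu> x M F B X \<longleftrightarrow>
     brownian_motion M F B \<and> adapted F X \<and> continuous_paths M X \<and>
     (\<forall>t\<ge>0. \<forall>\<omega>\<in>space M. X t \<omega> \<in> D) \<and>
     (AE \<omega> in M. X 0 \<omega> = x) \<and>
     (\<forall>t\<ge>0. (AE \<omega> in M. set_integrable lborel {0..t} (\<lambda>u. \<mu> (X u \<omega>))) \<and>
        (\<exists>I. ito_integral M F B t (\<lambda>u \<omega>. \<sigma> (X u \<omega>)) I \<and>
           (AE \<omega> in M. X t \<omega> = x + I \<omega> + (LINT u:{0..t}|lborel. \<mu> (X u \<omega>)))))"

definition path_law :: "'a measure \<Rightarrow> (real \<Rightarrow> 'a \<Rightarrow> real) \<Rightarrow> (real \<Rightarrow> real) measure" where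
  "path_law M X = distr M (Pi\<^sub>M {0..} (\<lambda>_. borel)) (\<lambda>\<omega>. \<lambda>t\<in>{0..}. X t \<omega>)"

text \<open>Uniqueness in law. A formula cannot quantify over types, so the two solutions range over the
  probability spaces whose sample points have the given type. This is no loss once a Brownian motion
  lives on some probability space of that type: the type then has at least the cardinality of the
  continuum, hence carries a copy of every law on the space of continuous paths.\<close>

definition weakly_unique ::
  "'a itself \<Rightarrow> real set \<Rightarrow> (real \<Rightarrow> real) \<Rightarrow> (real \<Rightarrow> real) \<Rightarrow> real \<Rightarrow> bool" where
  "weakly_unique _ D \<sigma> \<mu> x \<longleftrightarrow>
     (\<forall>(M::'a measure) F B X (M'::'a measure) F' B' X'.
        weak_solution D \<sigma> \<mu> x M F B X \<longrightarrow> weak_solution D \<sigma> \<mu> x M' F' B' X' \<longrightarrow>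
        path_law M X = path_law M' X')"

text \<open>At a boundary point of \<open>D\<close> derivatives are one-sided.\<close>

definition C1_on :: "real set \<Rightarrow> (real \<Rightarrow> real) \<Rightarrow> (real \<Rightarrow> real) \<Rightarrow> bool" where
  "C1_on D g g' \<longleftrightarrow>
     (\<forall>y\<in>D. (g has_real_derivative g' y) (at y within D)) \<and> continuous_on D g'"

text \<open>\<open>f(y) = exp (\<integral>\<^sub>a\<^sup>y dz / \<sigma>(z))\<close> is well defined for \<open>y \<ge> 0\<close>. The value at the boundary point \<open>0\<close> is
  the limit of the values at \<open>y > 0\<close>: it is the formula itself if \<open>1/\<sigma>\<close> is integrable at \<open>0\<close>, and
  \<open>exp (-\<infinity>) = 0\<close> if the integral diverges to \<open>-\<infinity>\<close> (as for \<open>\<sigma>(z) = z\<close>, \<open>f(y) = y/a\<close>);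
  divergence to \<open>+\<infinity>\<close> is excluded. Plain Lebesgue integrals would return the junk value \<open>0\<close> in
  the divergent cases.\<close>

definition exp_primitive :: "real \<Rightarrow> (real \<Rightarrow> real) \<Rightarrow> (real \<Rightarrow> real) \<Rightarrow> bool" where
  "exp_primitive a \<sigma> f \<longleftrightarrow>
     0 \<le> a \<and>
     (\<forall>y>0. interval_lebesgue_integrable lborel (ereal a) (ereal y) (\<lambda>z. inverse (\<sigma> z)) \<and>
        f y = exp (LBINT z=ereal a..ereal y. inverse (\<sigma> z))) \<and>
     (f \<longlongrightarrow> f 0) (at_right 0)"

text \<open>The Laplace variable \<open>l\<close> ranges over \<open>[0,\<infinity>)\<close>, so derivatives with respect to it at \<open>0\<close> are
  right derivatives. The second derivative is stated as the derivative of the first one.\<close>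

definition hypothesis_H ::
  "real set \<Rightarrow> (real \<Rightarrow> real) \<Rightarrow> (real \<Rightarrow> real) \<Rightarrow> 'a measure \<Rightarrow> (real \<Rightarrow> 'a \<Rightarrow> real) \<Rightarrow>
   (real \<Rightarrow> real) \<Rightarrow> bool" where
  "hypothesis_H D \<sigma> \<mu> M X f \<longleftrightarrow>
     (\<exists>f' f''. C1_on D f f' \<and> C1_on D f' f'' \<and>
       (\<forall>t\<ge>0. \<forall>l\<ge>0.
          integrable M (\<lambda>\<omega>. exp (- l * f (X t \<omega>))) \<and>
          (\<integral>\<^sup>+\<omega>. (\<integral>\<^sup>+u\<in>{0..t}. ennreal (exp (- 2 * l * f (X u \<omega>)) * (f' (X u \<omega>))\<^sup>2
             * (\<sigma> (X u \<omega>))\<^sup>2) \<partial>lborel) \<partial>M) < \<infinity> \<and>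
          (\<integral>\<^sup>+\<omega>. (\<integral>\<^sup>+u\<in>{0..t}. ennreal (exp (- l * f (X u \<omega>)) *
             \<bar>f'' (X u \<omega>) * (\<sigma> (X u \<omega>))\<^sup>2 / 2 + f' (X u \<omega>) * \<mu> (X u \<omega>)\<bar>) \<partial>lborel) \<partial>M) < \<infinity> \<and>
          integrable M (\<lambda>\<omega>. f (X t \<omega>) * exp (- l * f (X t \<omega>))) \<and>
          ((\<lambda>k. \<integral>\<omega>. exp (- k * f (X t \<omega>)) \<partial>M) has_real_derivative
             - (\<integral>\<omega>. f (X t \<omega>) * exp (- l * f (X t \<omega>)) \<partial>M)) (at l within {0..}) \<and>
          integrable M (\<lambda>\<omega>. (f (X t \<omega>))\<^sup>2 * exp (- l * f (X t \<omega>))) \<and>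
          ((\<lambda>k. - (\<integral>\<omega>. f (X t \<omega>) * exp (- k * f (X t \<omega>)) \<partial>M)) has_real_derivative
             (\<integral>\<omega>. (f (X t \<omega>))\<^sup>2 * exp (- l * f (X t \<omega>)) \<partial>M)) (at l within {0..})))"

definition associated ::
  "'a measure \<Rightarrow> (real \<Rightarrow> 'a \<Rightarrow> real) \<Rightarrow> 'b measure \<Rightarrow> (real \<Rightarrow> 'b \<Rightarrow> real) \<Rightarrow> bool" where
  "associated M Y N Z \<longleftrightarrow>
     (\<forall>t\<ge>0. Y t \<in> borel_measurable M \<and> Z t \<in> borel_measurable N \<and>
        distr M borel (Y t) = distr N borel (Z t))"

end

theory Submission
  imports Defs
begin

text \<open>The choice of \<open>f\<close> and \<open>\<mu>\<close> gives \<open>f' \<sigma> = f\<close> and \<open>f'' \<sigma>\<^sup>2 / 2 + f' \<mu> = f\<close>, on \<open>(0,\<infinity>)\<close> by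
  differentiating \<open>f\<close> and at \<open>0\<close> by continuity. So \<open>Y = f(X)\<close> solves \<open>dY = Y dB + Y dt\<close>, and Ito's formula
  gives \<open>d(e Y) = 0\<close> for \<open>e = exp (- B - t / 2)\<close>; hence \<open>f(X\<^sub>t) = f(x) exp (B\<^sub>t + t / 2)\<close> almost surely, which
  is stronger than equality in law.

  The cancellation is carried out on equidistant partitions of \<open>[0,T]\<close> by a second order Taylor
  expansion of \<open>e f(X)\<close>. Let \<open>q = \<Delta>I - \<sigma>(X) \<Delta>B\<close>, where \<open>I\<close> is the martingale part of \<open>X\<close>. Once \<open>X\<close> and
  \<open>B\<close> are stopped (at partition points) on leaving a bounded set, the surviving sums of \<open>e f' q\<close> and of
  multiples of \<open>(\<Delta>B)\<^sup>2 - \<Delta>t\<close> tend to \<open>0\<close> in \<open>L\<^sup>2\<close>, and the sum of \<open>q\<^sup>2\<close>, which controls the remainder, tends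
  to \<open>0\<close> in \<open>L\<^sup>1\<close>. Along a subsequence the convergence is almost sure, and the rest of the argument is
  pathwise.\<close>

section \<open>Brownian increments\<close>

text \<open>The factor \<open>exp (- B - t / 2)\<close> is forced: it solves
  \<open>de = - e dB\<close>, so in \<open>d(e Y) = e dY + Y de + d<e,Y>\<close> the noise terms
  \<open>e Y dB\<close> and \<open>- e Y dB\<close> cancel, and the covariation
  \<open>- e Y dt\<close> removes the drift \<open>e Y dt\<close>. The obstacle is the notion of Ito
  integral: a limit in probability, taken separately for each upper limit, which brings along
  neither an isometry nor a link between different times. What can be recovered is the upper half of
  the isometry. For an elementary integrand it survives on the event that the time integral of the
  squared integrand is at most \<open>K\<close>, and two uses of Fatou's lemma turn this into
  \<open>E I^2 \<le> 2 E sq_int\<close>. The factor 2 stems from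
  \<open>(a + b)^2 \<le> 2 a^2 + 2 b^2\<close> and is harmless, because the bound is applied to
  differences between \<open>\<sigma>(X)\<close> and its step approximation, which tend to 0 by
  dominated convergence; the assumed square integrability of \<open>\<sigma>(X)\<close> provides the
  majorant. No stochastic integral of \<open>e Y\<close> is ever formed: after a purely algebraic
  cancellation in each cell, only errors have to be estimated.\<close>

lemma filtered_sub:
  assumes "filtered_prob_space M F"
  shows "space (F t) = space M" "sets (F t) \<subseteq> sets M" "s \<le> t \<Longrightarrow> sets (F s) \<subseteq> sets (F t)"
  using assms by (auto simp: filtered_prob_space_def filtration_def)

locale brownian =
  fixes M :: "'a measure" and F :: "real \<Rightarrow> 'a measure" and B :: "real \<Rightarrow> 'a \<Rightarrow> real"
  assumes bm: "brownian_motion M F B"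

sublocale brownian \<subseteq> prob_space M
  using bm by (auto simp: brownian_motion_def filtered_prob_space_def)

context brownian
begin

lemma filt: "filtered_prob_space M F"
  using bm by (simp add: brownian_motion_def)

lemma space_F [simp]: "space (F t) = space M"
  using filtered_sub[OF filt] by simp

lemma measurable_F_mono: "g \<in> borel_measurable (F s) \<Longrightarrow> s \<le> t \<Longrightarrow> g \<in> borel_measurable (F t)"
  using measurable_mono[of borel borel "F s" "F t"] filtered_sub[OF filt] by auto

lemma measurable_F_M: "g \<in> borel_measurable (F s) \<Longrightarrow> g \<in> borel_measurable M"
  using measurable_mono[of borel borel "F s" M] filtered_sub[OF filt] by auto

lemma B_measurable: "0 \<le> t \<Longrightarrow> B t \<in> borel_measurable (F t)"
  using bm by (simp add: brownian_motion_def adapted_def)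

lemma B_measurable_M [measurable (raw)]: "0 \<le> t \<Longrightarrow> B t \<in> borel_measurable M"
  using B_measurable measurable_F_M by blast

lemma increment_distributed:
  "0 \<le> s \<Longrightarrow> s < t \<Longrightarrow> distributed M lborel (\<lambda>\<omega>. B t \<omega> - B s \<omega>)
     (\<lambda>y. ennreal (normal_density 0 (sqrt (t - s)) y))"
  using bm by (simp add: brownian_motion_def)

text \<open>For \<open>s = t\<close> the increment vanishes and has no density. That case is split
  off here and in later lemmas on increments, so that degenerate partition cells are
  allowed.\<close>

lemma increment_power:
  assumes "0 \<le> s" "s \<le> t"
  shows "integrable M (\<lambda>\<omega>. (B t \<omega> - B s \<omega>) ^ k)" (is ?i)
    and "has_bochner_integral lborel (\<lambda>y. normal_density 0 (sqrt (t - s)) y * y ^ k) v \<Longrightarrow> s < t \<Longrightarrow>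
       expectation (\<lambda>\<omega>. (B t \<omega> - B s \<omega>) ^ k) = v" (is "?d \<Longrightarrow> _ \<Longrightarrow> ?e")
proof -
  show ?i
  proof (cases "s < t")
    case True
    have "\<exists>v. has_bochner_integral lborel (\<lambda>y. normal_density 0 (sqrt (t - s)) y * y ^ k) v"
    proof (cases "even k")
      case True
      then obtain b where b: "k = 2 * b" by (rule evenE)
      show ?thesis using \<open>s < t\<close> normal_moment_even[where \<mu>=0 and \<sigma>="sqrt (t - s)" and k=b] unfolding b diff_0_right by auto
    next
      case False
      then obtain b where b: "k = 2 * b + 1" by (rule oddE)
      show ?thesis using \<open>s < t\<close> normal_moment_odd[where \<mu>=0 and \<sigma>="sqrt (t - s)" and k=b] unfolding b diff_0_right by auto
    qed
    then have "integrable lborel (\<lambda>y. normal_density 0 (sqrt (t - s)) y * y ^ k)"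
      by (auto simp: has_bochner_integral_iff)
    then show ?thesis
      using distributed_integrable[OF increment_distributed[OF assms(1) True], of "\<lambda>y. y ^ k"] by simp
  next
    case False
    then show ?thesis using assms by simp
  qed
  show ?e if ?d "s < t"
    using distributed_integral[OF increment_distributed[OF assms(1) that(2)], of "\<lambda>y. y ^ k"] that
    by (simp add: has_bochner_integral_iff)
qed

lemma increment_moments:
  assumes "0 \<le> s" "s \<le> t"
  shows "expectation (\<lambda>\<omega>. B t \<omega> - B s \<omega>) = 0"
    and "expectation (\<lambda>\<omega>. (B t \<omega> - B s \<omega>)\<^sup>2) = t - s"
    and "expectation (\<lambda>\<omega>. (B t \<omega> - B s \<omega>) ^ 4) = 3 * (t - s)\<^sup>2"
proof -
  have "expectation (\<lambda>\<omega>. B t \<omega> - B s \<omega>) = 0 \<and> expectation (\<lambda>\<omega>. (B t \<omega> - B s \<omega>)\<^sup>2) = t - s \<and>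
    expectation (\<lambda>\<omega>. (B t \<omega> - B s \<omega>) ^ 4) = 3 * (t - s)\<^sup>2"
  proof (cases "s < t")
    case True
    have "expectation (\<lambda>\<omega>. (B t \<omega> - B s \<omega>) ^ 1) = 0"
      by (rule increment_power(2)[OF assms _ True]) (use True normal_moment_odd[where \<mu>=0 and \<sigma>="sqrt (t - s)" and k=0] in simp)
    moreover have "expectation (\<lambda>\<omega>. (B t \<omega> - B s \<omega>)\<^sup>2) = t - s"
      by (rule increment_power(2)[OF assms _ True]) (use True normal_moment_even[where \<mu>=0 and \<sigma>="sqrt (t - s)" and k=1] in \<open>simp add: diff_divide_distrib\<close>)
    moreover have "expectation (\<lambda>\<omega>. (B t \<omega> - B s \<omega>) ^ 4) = 3 * (t - s)\<^sup>2"
      by (rule increment_power(2)[OF assms _ True])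
        (use True normal_moment_even[where \<mu>=0 and \<sigma>="sqrt (t - s)" and k=2] in \<open>simp add: fact_numeral power_divide\<close>)
    ultimately show ?thesis by simp
  next
    case False
    then show ?thesis using assms by simp
  qed
  then show "expectation (\<lambda>\<omega>. B t \<omega> - B s \<omega>) = 0" "expectation (\<lambda>\<omega>. (B t \<omega> - B s \<omega>)\<^sup>2) = t - s"
    "expectation (\<lambda>\<omega>. (B t \<omega> - B s \<omega>) ^ 4) = 3 * (t - s)\<^sup>2" by auto
qed

text \<open>Independence concerns the generated sigma-algebras. Those of \<open>g\<close> and of a
  Borel function of the increment lie inside \<open>F s\<close> and inside the sigma-algebra of the
  increment, and independence passes to smaller families.\<close>

lemma increment_indep_var:
  fixes \<phi> :: "real \<Rightarrow> real"
  assumes "0 \<le> s" "s < t" and g: "g \<in> borel_measurable (F s)" and [measurable]: "\<phi> \<in> borel_measurable borel"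
  shows "indep_var borel g borel (\<lambda>\<omega>. \<phi> (B t \<omega> - B s \<omega>))"
  unfolding indep_var_eq
proof (intro conjI)
  show "random_variable borel g" using g measurable_F_M by blast
  have [measurable]: "B t \<in> borel_measurable M" "B s \<in> borel_measurable M" using assms by auto
  show "random_variable borel (\<lambda>\<omega>. \<phi> (B t \<omega> - B s \<omega>))"
    by simp
  let ?V = "vimage_algebra (space M) (\<lambda>\<omega>. B t \<omega> - B s \<omega>) (borel :: real measure)"
  have ind: "indep_set (sets (F s)) (sets ?V)"
    using bm assms(1,2) by (simp add: brownian_motion_def)
  have 1: "sigma_sets (space M) {g -` A \<inter> space M |A. A \<in> sets borel} \<subseteq> sets (F s)"
    using sets.sigma_sets_subset[of "{g -` A \<inter> space M |A. A \<in> sets borel}" "F s"] measurable_sets[OF g]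
    by auto
  have "(\<lambda>\<omega>. B t \<omega> - B s \<omega>) \<in> borel_measurable ?V"
    by (rule measurable_vimage_algebra1) auto
  then have *: "(\<lambda>\<omega>. \<phi> (B t \<omega> - B s \<omega>)) \<in> borel_measurable ?V"
    by measurable
  have 2: "sigma_sets (space M) {(\<lambda>\<omega>. \<phi> (B t \<omega> - B s \<omega>)) -` A \<inter> space M |A. A \<in> sets borel} \<subseteq> sets ?V"
    using sets.sigma_sets_subset[of "{(\<lambda>\<omega>. \<phi> (B t \<omega> - B s \<omega>)) -` A \<inter> space M |A. A \<in> sets borel}" ?V]
      measurable_sets[OF *]
    by auto
  show "indep_set (sigma_sets (space M) {g -` A \<inter> space M |A. A \<in> sets borel})
     (sigma_sets (space M) {(\<lambda>\<omega>. \<phi> (B t \<omega> - B s \<omega>)) -` A \<inter> space M |A. A \<in> sets borel})"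
    using ind 1 2 unfolding indep_sets2_eq by blast
qed

lemma increment_indep:
  fixes \<phi> :: "real \<Rightarrow> real"
  assumes "0 \<le> s" "s \<le> t" "g \<in> borel_measurable (F s)" "\<phi> \<in> borel_measurable borel"
    and "integrable M g" "integrable M (\<lambda>\<omega>. \<phi> (B t \<omega> - B s \<omega>))"
  shows "integrable M (\<lambda>\<omega>. g \<omega> * \<phi> (B t \<omega> - B s \<omega>))"
    and "expectation (\<lambda>\<omega>. g \<omega> * \<phi> (B t \<omega> - B s \<omega>)) = expectation g * expectation (\<lambda>\<omega>. \<phi> (B t \<omega> - B s \<omega>))"
proof -
  have "integrable M (\<lambda>\<omega>. g \<omega> * \<phi> (B t \<omega> - B s \<omega>)) \<and>
    expectation (\<lambda>\<omega>. g \<omega> * \<phi> (B t \<omega> - B s \<omega>)) = expectation g * expectation (\<lambda>\<omega>. \<phi> (B t \<omega> - B s \<omega>))"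
  proof (cases "s < t")
    case True
    from increment_indep_var[OF assms(1) True assms(3,4)] show ?thesis
      using indep_var_integrable indep_var_lebesgue_integral assms by blast
  next
    case False
    then show ?thesis using assms by (simp add: prob_space)
  qed
  then show "integrable M (\<lambda>\<omega>. g \<omega> * \<phi> (B t \<omega> - B s \<omega>))"
    "expectation (\<lambda>\<omega>. g \<omega> * \<phi> (B t \<omega> - B s \<omega>)) = expectation g * expectation (\<lambda>\<omega>. \<phi> (B t \<omega> - B s \<omega>))"
    by auto
qed

text \<open>Discrete Ito isometry, by induction on the number of cells. The partial sum and
  \<open>c m\<close> are known at time \<open>p m\<close>, while \<open>d m\<close> is centred and
  independent of that past: the cross term has expectation 0 and the diagonal term factorises. The
  function \<open>\<phi>\<close> brings two uses under one proof, \<open>\<phi> x = x\<close> for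
  elementary integrals and \<open>\<phi> x = x^2 - h\<close> for the quadratic variation.\<close>

lemma sum_increments_square:
  fixes \<phi> :: "nat \<Rightarrow> real \<Rightarrow> real" and c :: "nat \<Rightarrow> 'a \<Rightarrow> real" and p :: "nat \<Rightarrow> real"
  defines "d \<equiv> \<lambda>i \<omega>. \<phi> i (B (p (Suc i)) \<omega> - B (p i) \<omega>)"
  assumes p: "0 \<le> p 0" "\<And>i. i < n \<Longrightarrow> p i \<le> p (Suc i)"
    and c: "\<And>i. i < n \<Longrightarrow> c i \<in> borel_measurable (F (p i))" "\<And>i \<omega>. i < n \<Longrightarrow> \<omega> \<in> space M \<Longrightarrow> \<bar>c i \<omega>\<bar> \<le> C i"
    and \<phi>: "\<And>i. i < n \<Longrightarrow> \<phi> i \<in> borel_measurable borel"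
    and d2: "\<And>i. i < n \<Longrightarrow> integrable M (\<lambda>\<omega>. (d i \<omega>)\<^sup>2)"
    and d0: "\<And>i. i < n \<Longrightarrow> expectation (d i) = 0"
  shows "integrable M (\<lambda>\<omega>. (\<Sum>i<n. c i \<omega> * d i \<omega>)\<^sup>2)"
    and "expectation (\<lambda>\<omega>. (\<Sum>i<n. c i \<omega> * d i \<omega>)\<^sup>2) =
      (\<Sum>i<n. expectation (\<lambda>\<omega>. (c i \<omega>)\<^sup>2) * expectation (\<lambda>\<omega>. (d i \<omega>)\<^sup>2))"
proof -
  have "(\<lambda>\<omega>. \<Sum>i<m. c i \<omega> * d i \<omega>) \<in> borel_measurable (F (p m)) \<and> 0 \<le> p m \<and>
    integrable M (\<lambda>\<omega>. (\<Sum>i<m. c i \<omega> * d i \<omega>)\<^sup>2) \<and>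
    expectation (\<lambda>\<omega>. (\<Sum>i<m. c i \<omega> * d i \<omega>)\<^sup>2) =
      (\<Sum>i<m. expectation (\<lambda>\<omega>. (c i \<omega>)\<^sup>2) * expectation (\<lambda>\<omega>. (d i \<omega>)\<^sup>2))" if "m \<le> n" for m
    using that
  proof (induction m)
    case 0
    then show ?case using p by simp
  next
    case (Suc m)
    let ?Q = "\<lambda>\<omega>. \<Sum>i<m. c i \<omega> * d i \<omega>"
    have mn: "m < n" and IH: "?Q \<in> borel_measurable (F (p m))" "0 \<le> p m" "integrable M (\<lambda>\<omega>. (?Q \<omega>)\<^sup>2)"
      "expectation (\<lambda>\<omega>. (?Q \<omega>)\<^sup>2) =
        (\<Sum>i<m. expectation (\<lambda>\<omega>. (c i \<omega>)\<^sup>2) * expectation (\<lambda>\<omega>. (d i \<omega>)\<^sup>2))"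
      using Suc by auto
    note [measurable] = \<phi>[OF mn]
    have le: "p m \<le> p (Suc m)" "0 \<le> p (Suc m)" using p mn IH(2) by force+
    have [measurable]: "?Q \<in> borel_measurable (F (p (Suc m)))" "c m \<in> borel_measurable (F (p (Suc m)))"
      "B (p m) \<in> borel_measurable (F (p (Suc m)))" "B (p (Suc m)) \<in> borel_measurable (F (p (Suc m)))"
      using measurable_F_mono[OF _ le(1)] IH(1,2) c(1)[OF mn] B_measurable le by auto
    have [measurable]: "c m \<in> borel_measurable M" "B (p m) \<in> borel_measurable M"
       "B (p (Suc m)) \<in> borel_measurable M" "?Q \<in> borel_measurable M"
      using measurable_F_M[OF c(1)[OF mn]] le IH measurable_F_M by auto
    have dmF: "d m \<in> borel_measurable (F (p (Suc m)))" unfolding d_def by simp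
    have [measurable]: "d m \<in> borel_measurable M" unfolding d_def by simp
    have dm: "integrable M (d m)" by (rule square_integrable_imp_integrable) (use d2[OF mn] in simp_all)
    have Qi: "integrable M ?Q" by (rule square_integrable_imp_integrable) (use IH(3) in simp_all)
    have Cb: "AE \<omega> in M. \<bar>c m \<omega>\<bar> \<le> C m" using c(2)[OF mn] by auto
    \<comment> \<open>The induction provides \<open>?Q\<close> in L2 only; the bound on
      \<open>c m\<close> keeps the product integrable, which the factorisation of the cross term
      requires.\<close>
    have cQ: "integrable M (\<lambda>\<omega>. c m \<omega> * ?Q \<omega>)"
      by (rule Bochner_Integration.integrable_bound[OF integrable_mult_right[OF Qi, of "C m"]])
        (use Cb in \<open>auto simp: abs_mult elim!: eventually_mono intro!: mult_right_mono\<close>)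
    have c2: "integrable M (\<lambda>\<omega>. (c m \<omega>)\<^sup>2)"
      by (rule integrable_const_bound[where B="(C m)\<^sup>2"])
        (use Cb in \<open>auto elim!: eventually_mono simp: abs_le_square_iff[symmetric]\<close>)
    have cF: "c m \<in> borel_measurable (F (p m))" using c(1)[OF mn] .
    have cQF: "(\<lambda>\<omega>. c m \<omega> * ?Q \<omega>) \<in> borel_measurable (F (p m))" 
      using cF IH(1) by (rule borel_measurable_times)
    have c2F: "(\<lambda>\<omega>. (c m \<omega>)\<^sup>2) \<in> borel_measurable (F (p m))" 
      using cF by (rule borel_measurable_power)
    have c1: "integrable M (\<lambda>\<omega>. c m \<omega> * ?Q \<omega> * d m \<omega>)"
       "expectation (\<lambda>\<omega>. c m \<omega> * ?Q \<omega> * d m \<omega>) = 0"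
      using increment_indep[OF IH(2) le(1) cQF \<phi>[OF mn] cQ] dm d0[OF mn] unfolding d_def by auto
    have c3: "integrable M (\<lambda>\<omega>. (c m \<omega>)\<^sup>2 * (d m \<omega>)\<^sup>2)"
       "expectation (\<lambda>\<omega>. (c m \<omega>)\<^sup>2 * (d m \<omega>)\<^sup>2) = expectation (\<lambda>\<omega>. (c m \<omega>)\<^sup>2) * expectation (\<lambda>\<omega>. (d m \<omega>)\<^sup>2)"
      using increment_indep[OF IH(2) le(1) c2F _ c2, of "\<lambda>x. (\<phi> m x)\<^sup>2"] d2[OF mn] 
      unfolding d_def by auto
    have eq: "(\<Sum>i<Suc m. c i \<omega> * d i \<omega>)\<^sup>2 = (?Q \<omega>)\<^sup>2 + 2 * (c m \<omega> * ?Q \<omega> * d m \<omega>) + (c m \<omega>)\<^sup>2 * (d m \<omega>)\<^sup>2" for \<omega>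
      by (simp add: power2_eq_square algebra_simps)
    have "(\<lambda>\<omega>. \<Sum>i<Suc m. c i \<omega> * d i \<omega>) \<in> borel_measurable (F (p (Suc m)))"
      using dmF by simp
    then show ?case
      unfolding eq using IH c1 c3 le by simp
  qed
  from this[of n] show "integrable M (\<lambda>\<omega>. (\<Sum>i<n. c i \<omega> * d i \<omega>)\<^sup>2)"
    and "expectation (\<lambda>\<omega>. (\<Sum>i<n. c i \<omega> * d i \<omega>)\<^sup>2) =
      (\<Sum>i<n. expectation (\<lambda>\<omega>. (c i \<omega>)\<^sup>2) * expectation (\<lambda>\<omega>. (d i \<omega>)\<^sup>2))"
    by auto
qed

end

section \<open>Elementary integrals\<close>

lemma mono_upto:
  fixes ts :: "nat \<Rightarrow> real"
  assumes "\<And>i. i < n \<Longrightarrow> ts i \<le> ts (Suc i)" "i \<le> j" "j \<le> n"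
  shows "ts i \<le> ts j"
  using assms(2,3)
proof (induction j rule: dec_induct)
  case (step k)
  then show ?case using assms(1)[of k] by fastforce
qed simp

lemma sum_step_eq:
  fixes ts :: "nat \<Rightarrow> real" and g :: "nat \<Rightarrow> real"
  assumes mono: "\<And>i. i < n \<Longrightarrow> ts i \<le> ts (Suc i)" and i: "i < n" "u \<in> {ts i<..ts (Suc i)}"
  shows "(\<Sum>j<n. g j * indicator {ts j<..ts (Suc j)} u) = g i"
proof -
  have "u \<notin> {ts j<..ts (Suc j)}" if "j < n" "j \<noteq> i" for j
  proof (cases "j < i")
    case True
    then have "ts (Suc j) \<le> ts i" using mono_upto[of n ts "Suc j" i] mono i by auto
    then show ?thesis using i by auto
  next
    case False
    then have "ts (Suc i) \<le> ts j" using mono_upto[of n ts "Suc i" j] mono i that by auto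
    then show ?thesis using i by auto
  qed
  then have "(\<Sum>j<n. g j * indicator {ts j<..ts (Suc j)} u) = (\<Sum>j<n. if j = i then g i else 0)"
    using i(2) by (intro sum.cong) (auto simp del: greaterThanAtMost_iff)
  then show ?thesis using i by simp
qed

text \<open>The cells are disjoint, so at each \<open>u\<close> at most one summand survives and all
  cross products vanish.\<close>

lemma sum_step_square:
  fixes ts :: "nat \<Rightarrow> real" and g :: "nat \<Rightarrow> real"
  assumes mono: "\<And>i. i < n \<Longrightarrow> ts i \<le> ts (Suc i)"
  shows "(\<Sum>j<n. g j * indicator {ts j<..ts (Suc j)} u)\<^sup>2 = (\<Sum>j<n. (g j)\<^sup>2 * indicator {ts j<..ts (Suc j)} u)"
proof (cases "\<exists>i<n. u \<in> {ts i<..ts (Suc i)}")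
  case True
  then obtain i where "i < n" "u \<in> {ts i<..ts (Suc i)}" by blast
  then show ?thesis using sum_step_eq[of n ts i u] mono by (simp del: greaterThanAtMost_iff)
next
  case False
  then have "\<And>i. i < n \<Longrightarrow> indicator {ts i<..ts (Suc i)} u = (0::real)" by auto
  then show ?thesis by simp
qed

lemma sum_subinterval_telescope:
  fixes g h :: "_ \<Rightarrow> real"
  assumes g: "\<And>i. i < k \<Longrightarrow> g i < g (Suc i)" and "a \<le> b" "b \<le> k"
  shows "(\<Sum>j<k. of_bool (g a \<le> g j \<and> g (Suc j) \<le> g b) * (h (g (Suc j)) - h (g j))) = h (g b) - h (g a)"
proof -
  have mono: "g i \<le> g j" if "i \<le> j" "j \<le> k" for i j
    using mono_upto[of k g i j] g that by (auto simp: less_imp_le)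
  have less: "g i < g j" if "i < j" "j \<le> k" for i j
    using mono[of "Suc i" j] g[of i] that by force
  have "g a \<le> g j \<and> g (Suc j) \<le> g b \<longleftrightarrow> j \<in> {a..<b}" if "j < k" for j
  proof -
    have "a \<le> j \<longleftrightarrow> g a \<le> g j"
      using that assms(2,3) less[of j a] mono[of a j] by (cases "a \<le> j") auto
    moreover have "Suc j \<le> b \<longleftrightarrow> g (Suc j) \<le> g b"
      using that assms(2,3) less[of b "Suc j"] mono[of "Suc j" b] by (cases "Suc j \<le> b") auto
    ultimately show ?thesis by auto
  qed
  then have "(\<Sum>j<k. of_bool (g a \<le> g j \<and> g (Suc j) \<le> g b) * (h (g (Suc j)) - h (g j))) =
    (\<Sum>j<k. if j \<in> {a..<b} then h (g (Suc j)) - h (g j) else 0)"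
    by (intro sum.cong) auto
  also have "\<dots> = (\<Sum>j\<in>{a..<b}. h (g (Suc j)) - h (g j))"
    using assms by (subst sum.inter_restrict[symmetric]) (auto intro!: sum.cong)
  also have "\<dots> = h (g b) - h (g a)"
    using sum_Suc_diff'[of a b "\<lambda>j. h (g j)"] assms by simp
  finally show ?thesis .
qed

section \<open>The time integral of the squared integrand, and the truncated isometry\<close>

definition sq_int :: "real \<Rightarrow> (real \<Rightarrow> 'a \<Rightarrow> real) \<Rightarrow> 'a \<Rightarrow> ennreal" where
  "sq_int T S \<omega> = (\<integral>\<^sup>+u\<in>{0..T}. ennreal ((S u \<omega>)\<^sup>2) \<partial>lborel)"

context brownian
begin

lemma elementary_sq_int:
  assumes ts: "0 \<le> ts 0" "\<And>i. i < n \<Longrightarrow> ts i \<le> ts (Suc i)" "ts n \<le> T"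
    and S: "S = (\<lambda>u \<omega>. \<Sum>i<n. \<xi> i \<omega> * indicator {ts i<..ts (Suc i)} u)"
  shows "sq_int T S \<omega> = ennreal (\<Sum>i<n. (\<xi> i \<omega>)\<^sup>2 * (ts (Suc i) - ts i))"
proof -
  have sub: "{ts i<..ts (Suc i)} \<subseteq> {0..T}" if "i < n" for i
  proof -
    have "ts 0 \<le> ts i" "ts (Suc i) \<le> ts n"
      using mono_upto[of n ts 0 i] mono_upto[of n ts "Suc i" n] ts(2) that by auto
    then show ?thesis using ts by auto
  qed
  have "sq_int T S \<omega> = (\<integral>\<^sup>+u. (\<Sum>i<n. ennreal ((\<xi> i \<omega>)\<^sup>2) * indicator {ts i<..ts (Suc i)} u) \<partial>lborel)"
    unfolding sq_int_def
  proof (rule nn_integral_cong)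
    fix u
    have "(\<Sum>i<n. ennreal ((\<xi> i \<omega>)\<^sup>2) * indicator {ts i<..ts (Suc i)} u) =
      ennreal (\<Sum>i<n. (\<xi> i \<omega>)\<^sup>2 * indicator {ts i<..ts (Suc i)} u)"
    proof -
      have "ennreal ((\<xi> i \<omega>)\<^sup>2) * indicator {ts i<..ts (Suc i)} u = ennreal ((\<xi> i \<omega>)\<^sup>2 * indicator {ts i<..ts (Suc i)} u)" for i
        by (auto split: split_indicator)
      then show ?thesis by (simp only: sum_ennreal[OF mult_nonneg_nonneg[OF zero_le_power2 indicator_pos_le]])
    qed
    also have "\<dots> = ennreal (\<Sum>i<n. (\<xi> i \<omega>)\<^sup>2 * indicator {ts i<..ts (Suc i)} u) * indicator {0..T} u"
    proof (cases "u \<in> {0..T}")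
      case False
      then have "indicator {ts i<..ts (Suc i)} u = (0::real)" if "i < n" for i
        using sub[OF that] by (auto simp: indicator_def)
      then have "(\<Sum>i<n. (\<xi> i \<omega>)\<^sup>2 * indicator {ts i<..ts (Suc i)} u) = 0"
        by (intro sum.neutral) simp
      then show ?thesis by (simp only: ennreal_0 mult_zero_left)
    qed simp
    finally show "ennreal ((S u \<omega>)\<^sup>2) * indicator {0..T} u = (\<Sum>i<n. ennreal ((\<xi> i \<omega>)\<^sup>2) * indicator {ts i<..ts (Suc i)} u)"
      using sum_step_square[of n ts "\<lambda>i. \<xi> i \<omega>" u] ts(2) unfolding S by simp
  qed
  also have "\<dots> = (\<Sum>i<n. ennreal ((\<xi> i \<omega>)\<^sup>2) * ennreal (ts (Suc i) - ts i))"
    using ts(2) by (subst nn_integral_sum) (auto simp: nn_integral_cmult_indicator intro!: sum.cong)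
  also have "\<dots> = ennreal (\<Sum>i<n. (\<xi> i \<omega>)\<^sup>2 * (ts (Suc i) - ts i))"
    using ts(2) by (subst sum_ennreal[symmetric]) (auto intro!: sum.cong simp: ennreal_mult')
  finally show ?thesis .
qed

text \<open>Dropping the summands from the first index at which the partial sums of \<open>\<xi>\<^sup>2 \<Delta>t\<close> exceed \<open>K\<close>
  keeps the integrand predictable, and changes nothing on the event in question.\<close>

lemma elementary_truncated:
  assumes el: "elementary_integral M F B T S J" and K: "0 \<le> K"
  shows "J \<in> borel_measurable M" and "sq_int T S \<in> borel_measurable M"
    and "(\<integral>\<^sup>+\<omega>. ennreal ((J \<omega>)\<^sup>2) * indicator {\<omega>. sq_int T S \<omega> \<le> ennreal K} \<omega> \<partial>M) \<le>
      (\<integral>\<^sup>+\<omega>. min (sq_int T S \<omega>) (ennreal K) \<partial>M)"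
proof -
  obtain n ts \<xi> where ts: "0 \<le> ts 0" "\<And>i. i < n \<Longrightarrow> ts i \<le> ts (Suc i)" "ts n \<le> T"
    and \<xi>: "\<And>i. i < n \<Longrightarrow> \<xi> i \<in> borel_measurable (F (ts i))"
       "\<And>i. i < n \<Longrightarrow> (\<exists>C. \<forall>\<omega>\<in>space M. \<bar>\<xi> i \<omega>\<bar> \<le> C)"
    and S: "S = (\<lambda>u \<omega>. \<Sum>i<n. \<xi> i \<omega> * indicator {ts i<..ts (Suc i)} u)"
    and J: "J = (\<lambda>\<omega>. \<Sum>i<n. \<xi> i \<omega> * (B (ts (Suc i)) \<omega> - B (ts i) \<omega>))"
    using el unfolding elementary_integral_def by blast
  obtain C where C: "\<And>i \<omega>. i < n \<Longrightarrow> \<omega> \<in> space M \<Longrightarrow> \<bar>\<xi> i \<omega>\<bar> \<le> C i"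
    using \<xi>(2) by metis
  have mono: "ts i \<le> ts j" if "i \<le> j" "j \<le> n" for i j
    using mono_upto[of n ts i j] ts(2) that by simp
  have pos: "0 \<le> ts i" if "i \<le> n" for i
    using mono[of 0 i] ts(1) that by simp
  have \<xi>M [measurable]: "\<xi> i \<in> borel_measurable M" if "i < n" for i
    using \<xi>(1)[OF that] measurable_F_M by blast
  have BM [measurable]: "B (ts i) \<in> borel_measurable M" if "i \<le> n" for i
    using pos[OF that] by simp
  show JM: "J \<in> borel_measurable M"
    unfolding J by (intro borel_measurable_sum borel_measurable_times borel_measurable_diff BM \<xi>M) auto
  define N where "N k \<omega> = (\<Sum>i<k. (\<xi> i \<omega>)\<^sup>2 * (ts (Suc i) - ts i))" for k \<omega>
  have sq: "sq_int T S = (\<lambda>\<omega>. ennreal (N n \<omega>))"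
    using elementary_sq_int[OF ts S] unfolding N_def by auto
  \<comment> \<open>The sum up to and including index \<open>k\<close> is already known at the left
    endpoint \<open>ts k\<close>, since \<open>\<xi> k\<close> is. So testing
    \<open>N (Suc k) \<le> K\<close> may decide about the summand \<open>k\<close> without looking
    into the future; a test of \<open>N k\<close> would let the last summand overshoot
    \<open>K\<close>.\<close>
  have NF: "N (Suc k) \<in> borel_measurable (F (ts k))" if "k < n" for k
    unfolding N_def
    by (intro borel_measurable_sum borel_measurable_times borel_measurable_power borel_measurable_const
        measurable_F_mono[OF \<xi>(1)]) (use that mono in auto)
  have NM [measurable]: "N n \<in> borel_measurable M"
    unfolding N_def by (intro borel_measurable_sum borel_measurable_times borel_measurable_power borel_measurable_const \<xi>M) auto
  then show "sq_int T S \<in> borel_measurable M" unfolding sq by simp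
  define y where "y i \<omega> = (if N (Suc i) \<omega> \<le> K then \<xi> i \<omega> else 0)" for i \<omega>
  have N_mono: "N k \<omega> \<le> N l \<omega>" if "k \<le> l" "l \<le> n" for k l \<omega>
    unfolding N_def by (rule sum_mono2) (use that ts(2) in auto)
  have bound: "(\<Sum>i<k. (y i \<omega>)\<^sup>2 * (ts (Suc i) - ts i)) \<le> min (N k \<omega>) K" if "k \<le> n" for k \<omega>
    using that
  proof (induction k)
    case 0
    then show ?case using K by (simp add: N_def)
  next
    case (Suc k)
    show ?case
    proof (cases "N (Suc k) \<omega> \<le> K")
      case True
      then have "y i \<omega> = \<xi> i \<omega>" if "i < Suc k" for i
        using N_mono[of "Suc i" "Suc k" \<omega>] Suc.prems that unfolding y_def by auto
      then show ?thesis using True by (simp add: N_def)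
    next
      case False
      then have "y k \<omega> = 0" by (simp add: y_def)
      then show ?thesis using Suc N_mono[of k "Suc k" \<omega>] by simp
    qed
  qed
  have yF: "y i \<in> borel_measurable (F (ts i))" if "i < n" for i
  proof -
    have [measurable]: "N (Suc i) \<in> borel_measurable (F (ts i))" "\<xi> i \<in> borel_measurable (F (ts i))"
      using NF \<xi> that by auto
    show ?thesis unfolding y_def by measurable
  qed
  have yC: "\<bar>y i \<omega>\<bar> \<le> C i" if "i < n" "\<omega> \<in> space M" for i \<omega>
    using C[OF that] unfolding y_def by auto
  have yM [measurable]: "y i \<in> borel_measurable M" if "i < n" for i
    using yF[OF that] measurable_F_M by blast
  let ?J = "\<lambda>\<omega>. \<Sum>i<n. y i \<omega> * (B (ts (Suc i)) \<omega> - B (ts i) \<omega>)"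
  have int: "integrable M (\<lambda>\<omega>. (?J \<omega>)\<^sup>2)"
    and ex: "expectation (\<lambda>\<omega>. (?J \<omega>)\<^sup>2) =
      (\<Sum>i<n. expectation (\<lambda>\<omega>. (y i \<omega>)\<^sup>2) * expectation (\<lambda>\<omega>. (B (ts (Suc i)) \<omega> - B (ts i) \<omega>)\<^sup>2))"
    using sum_increments_square[of ts n y C "\<lambda>_ x. x"] ts yF yC pos increment_power(1)[of "ts _" "ts (Suc _)" 2]
      increment_moments[of "ts _" "ts (Suc _)"] by auto
  have y2: "integrable M (\<lambda>\<omega>. (y i \<omega>)\<^sup>2)" if "i < n" for i
    by (rule integrable_const_bound[where B="(C i)\<^sup>2"])
      (use yM[OF that] yC[OF that] in \<open>auto intro!: AE_I2 simp: abs_le_square_iff[symmetric] intro: order.trans[OF _ abs_ge_self]\<close>)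
  have "(\<integral>\<^sup>+\<omega>. ennreal ((J \<omega>)\<^sup>2) * indicator {\<omega>. sq_int T S \<omega> \<le> ennreal K} \<omega> \<partial>M) \<le>
    (\<integral>\<^sup>+\<omega>. ennreal ((?J \<omega>)\<^sup>2) \<partial>M)"
  proof (rule nn_integral_mono)
    fix \<omega>
    show "ennreal ((J \<omega>)\<^sup>2) * indicator {\<omega>. sq_int T S \<omega> \<le> ennreal K} \<omega> \<le> ennreal ((?J \<omega>)\<^sup>2)"
    proof (cases "N n \<omega> \<le> K")
      case True
      then have "y i \<omega> = \<xi> i \<omega>" if "i < n" for i
        using N_mono[of "Suc i" n \<omega>] that unfolding y_def by auto
      then show ?thesis unfolding J by (simp split: split_indicator)
    qed (use K in \<open>simp add: sq\<close>)
  qed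
  also have "\<dots> = ennreal (expectation (\<lambda>\<omega>. (?J \<omega>)\<^sup>2))"
    using int by (intro nn_integral_eq_integral) auto
  also have "expectation (\<lambda>\<omega>. (?J \<omega>)\<^sup>2) = expectation (\<lambda>\<omega>. \<Sum>i<n. (y i \<omega>)\<^sup>2 * (ts (Suc i) - ts i))"
    unfolding ex using y2 ts pos increment_moments(2)[of "ts _" "ts (Suc _)"]
    by (subst Bochner_Integration.integral_sum) auto
  also have "ennreal \<dots> = (\<integral>\<^sup>+\<omega>. ennreal (\<Sum>i<n. (y i \<omega>)\<^sup>2 * (ts (Suc i) - ts i)) \<partial>M)"
    using y2 ts by (intro nn_integral_eq_integral[symmetric]) (auto intro!: sum_nonneg)
  also have "\<dots> \<le> (\<integral>\<^sup>+\<omega>. min (sq_int T S \<omega>) (ennreal K) \<partial>M)"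
    using bound[of n] unfolding sq
    by (intro nn_integral_mono) (force intro!: ennreal_leI)
  finally show "(\<integral>\<^sup>+\<omega>. ennreal ((J \<omega>)\<^sup>2) * indicator {\<omega>. sq_int T S \<omega> \<le> ennreal K} \<omega> \<partial>M) \<le>
      (\<integral>\<^sup>+\<omega>. min (sq_int T S \<omega>) (ennreal K) \<partial>M)" .
qed

section \<open>Refinement, linearity and restriction of elementary integrals\<close>

lemma elementary_refine:
  assumes ts: "\<And>i. i < n \<Longrightarrow> ts i \<le> ts (Suc i)"
    and \<xi>: "\<And>i. i < n \<Longrightarrow> \<xi> i \<in> borel_measurable (F (ts i))"
       "\<And>i. i < n \<Longrightarrow> (\<exists>C. \<forall>\<omega>\<in>space M. \<bar>\<xi> i \<omega>\<bar> \<le> C)"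
    and g: "\<And>j. j < k \<Longrightarrow> g j < g (Suc j)" "\<And>i. i \<le> n \<Longrightarrow> ts i \<in> g ` {..k}"
  shows "\<exists>\<zeta>. (\<forall>j<k. \<zeta> j \<in> borel_measurable (F (g j)) \<and> (\<exists>C. \<forall>\<omega>\<in>space M. \<bar>\<zeta> j \<omega>\<bar> \<le> C)) \<and>
    (\<forall>h::real \<Rightarrow> real. \<forall>\<omega>. (\<Sum>i<n. \<xi> i \<omega> * (h (ts (Suc i)) - h (ts i))) = (\<Sum>j<k. \<zeta> j \<omega> * (h (g (Suc j)) - h (g j))))"
proof -
  \<comment> \<open>A cell of the finer grid inherits the coefficient of the old cell around it.
    There \<open>ts i \<le> g j\<close>, so the coefficient is known at the new left endpoint. One
    \<open>\<zeta>\<close> serves every \<open>h\<close>: a path of \<open>B\<close> yields the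
    integral, and \<open>of_bool (u \<le> t)\<close> as a function of \<open>t\<close> yields the
    integrand.\<close>
  define \<zeta> where "\<zeta> j \<omega> = (\<Sum>i<n. \<xi> i \<omega> * of_bool (ts i \<le> g j \<and> g (Suc j) \<le> ts (Suc i)))" for j \<omega>
  have "\<zeta> j \<in> borel_measurable (F (g j))" for j
  proof -
    have "(\<lambda>\<omega>. \<xi> i \<omega> * of_bool (ts i \<le> g j \<and> g (Suc j) \<le> ts (Suc i))) \<in> borel_measurable (F (g j))" if "i < n" for i
      using measurable_F_mono[OF \<xi>(1)[OF that]] by (cases "ts i \<le> g j") auto
    then show ?thesis unfolding \<zeta>_def by (intro borel_measurable_sum) auto
  qed
  moreover have "\<exists>C. \<forall>\<omega>\<in>space M. \<bar>\<zeta> j \<omega>\<bar> \<le> C" for j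
  proof -
    obtain C where C: "\<And>i \<omega>. i < n \<Longrightarrow> \<omega> \<in> space M \<Longrightarrow> \<bar>\<xi> i \<omega>\<bar> \<le> C i"
      using \<xi>(2) by metis
    have "\<bar>\<zeta> j \<omega>\<bar> \<le> (\<Sum>i<n. C i)" if "\<omega> \<in> space M" for \<omega>
      unfolding \<zeta>_def
      by (rule order.trans[OF sum_abs sum_mono]) (use C that in \<open>force simp: abs_mult intro: order.trans[OF abs_ge_zero]\<close>)
    then show ?thesis by blast
  qed
  moreover have "(\<Sum>i<n. \<xi> i \<omega> * (h (ts (Suc i)) - h (ts i))) = (\<Sum>j<k. \<zeta> j \<omega> * (h (g (Suc j)) - h (g j)))"
    for h :: "real \<Rightarrow> real" and \<omega>
  proof -
    have eq: "h (ts (Suc i)) - h (ts i) = (\<Sum>j<k. of_bool (ts i \<le> g j \<and> g (Suc j) \<le> ts (Suc i)) * (h (g (Suc j)) - h (g j)))"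
      if i: "i < n" for i
    proof -
      obtain a b where ab: "a \<le> k" "b \<le> k" "ts i = g a" "ts (Suc i) = g b"
        using g(2)[of i] g(2)[of "Suc i"] i by auto
      show ?thesis
      proof (cases "a \<le> b")
        case True
        then show ?thesis using sum_subinterval_telescope[of k g a b h] g ab by simp
      next
        case False
        then have "g (Suc b) \<le> g a" "g b < g (Suc b)"
          using mono_upto[of k g "Suc b" a] g ab by (auto simp: less_imp_le)
        then show ?thesis using ts[OF i] ab by simp
      qed
    qed
    have "(\<Sum>i<n. \<xi> i \<omega> * (h (ts (Suc i)) - h (ts i))) =
      (\<Sum>i<n. \<Sum>j<k. \<xi> i \<omega> * (of_bool (ts i \<le> g j \<and> g (Suc j) \<le> ts (Suc i)) * (h (g (Suc j)) - h (g j))))"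
    proof (rule sum.cong[OF refl])
      fix i assume "i \<in> {..<n}"
      then show "\<xi> i \<omega> * (h (ts (Suc i)) - h (ts i)) =
        (\<Sum>j<k. \<xi> i \<omega> * (of_bool (ts i \<le> g j \<and> g (Suc j) \<le> ts (Suc i)) * (h (g (Suc j)) - h (g j))))"
        using eq[of i] by (simp only: lessThan_iff sum_distrib_left[symmetric])
    qed
    also have "\<dots> = (\<Sum>j<k. \<zeta> j \<omega> * (h (g (Suc j)) - h (g j)))"
      unfolding \<zeta>_def sum_distrib_right by (rule trans[OF sum.swap]) (simp only: mult.assoc)
    finally show ?thesis .
  qed
  ultimately show ?thesis by blast
qed

lemma indicator_Ioc_diff: "s \<le> t \<Longrightarrow> indicator {s<..t} u = (of_bool (u \<le> t) - of_bool (u \<le> s) :: real)" for s t u :: real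
  by (auto split: split_indicator)

text \<open>The two integrands live on unrelated partitions. Both are rewritten on the sorted union
  of the partition points, where coefficients add.\<close>

lemma elementary_add:
  assumes "elementary_integral M F B T S J" "elementary_integral M F B T S' J'"
  shows "elementary_integral M F B T (\<lambda>u \<omega>. S u \<omega> + S' u \<omega>) (\<lambda>\<omega>. J \<omega> + J' \<omega>)"
proof -
  obtain n ts \<xi> where ts: "0 \<le> ts 0" "\<And>i. i < n \<Longrightarrow> ts i \<le> ts (Suc i)" "ts n \<le> T"
    and \<xi>: "\<And>i. i < n \<Longrightarrow> \<xi> i \<in> borel_measurable (F (ts i))"
       "\<And>i. i < n \<Longrightarrow> (\<exists>C. \<forall>\<omega>\<in>space M. \<bar>\<xi> i \<omega>\<bar> \<le> C)"
    and S: "S = (\<lambda>u \<omega>. \<Sum>i<n. \<xi> i \<omega> * indicator {ts i<..ts (Suc i)} u)"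
    and J: "J = (\<lambda>\<omega>. \<Sum>i<n. \<xi> i \<omega> * (B (ts (Suc i)) \<omega> - B (ts i) \<omega>))"
    using assms(1) unfolding elementary_integral_def by blast
  obtain m us \<eta> where us: "0 \<le> us 0" "\<And>i. i < m \<Longrightarrow> us i \<le> us (Suc i)" "us m \<le> T"
    and \<eta>: "\<And>i. i < m \<Longrightarrow> \<eta> i \<in> borel_measurable (F (us i))"
       "\<And>i. i < m \<Longrightarrow> (\<exists>C. \<forall>\<omega>\<in>space M. \<bar>\<eta> i \<omega>\<bar> \<le> C)"
    and S': "S' = (\<lambda>u \<omega>. \<Sum>i<m. \<eta> i \<omega> * indicator {us i<..us (Suc i)} u)"
    and J': "J' = (\<lambda>\<omega>. \<Sum>i<m. \<eta> i \<omega> * (B (us (Suc i)) \<omega> - B (us i) \<omega>))"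
    using assms(2) unfolding elementary_integral_def by blast
  define P where "P = ts ` {..n} \<union> us ` {..m}"
  define L where "L = sorted_list_of_set P"
  define k where "k = length L - 1"
  have "finite P" "P \<noteq> {}" unfolding P_def by auto
  then have L: "set L = P" "sorted L" "distinct L" "length L = Suc k"
    unfolding L_def k_def by (auto simp: Suc_leI card_gt_0_iff)
  have g: "L ! j < L ! Suc j" if "j < k" for j
    using sorted_wrt_nth_less[of "(<)" L j "Suc j"] L that by (simp add: strict_sorted_iff)
  have gP: "P = (!) L ` {..k}" by (auto simp: L(1)[symmetric] set_conv_nth L(4) image_iff less_Suc_eq_le)
  have "0 \<le> ts i" "ts i \<le> T" if "i \<le> n" for i
    using mono_upto[of n ts 0 i] mono_upto[of n ts i n] ts that by fastforce+
  moreover have "0 \<le> us i" "us i \<le> T" if "i \<le> m" for i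
    using mono_upto[of m us 0 i] mono_upto[of m us i m] us that by fastforce+
  ultimately have P: "P \<subseteq> {0..T}" unfolding P_def by auto
  obtain \<zeta> where \<zeta>: "\<And>j. j < k \<Longrightarrow> \<zeta> j \<in> borel_measurable (F (L ! j))" "\<And>j. j < k \<Longrightarrow> (\<exists>C. \<forall>\<omega>\<in>space M. \<bar>\<zeta> j \<omega>\<bar> \<le> C)"
    and \<zeta>e: "\<And>(h::real\<Rightarrow>real) \<omega>. (\<Sum>i<n. \<xi> i \<omega> * (h (ts (Suc i)) - h (ts i))) = (\<Sum>j<k. \<zeta> j \<omega> * (h (L ! Suc j) - h (L ! j)))"
    using elementary_refine[of n ts \<xi> k "(!) L"] ts \<xi> g gP unfolding P_def by blast
  obtain \<zeta>' where \<zeta>': "\<And>j. j < k \<Longrightarrow> \<zeta>' j \<in> borel_measurable (F (L ! j))" "\<And>j. j < k \<Longrightarrow> (\<exists>C. \<forall>\<omega>\<in>space M. \<bar>\<zeta>' j \<omega>\<bar> \<le> C)"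
    and \<zeta>'e: "\<And>(h::real\<Rightarrow>real) \<omega>. (\<Sum>i<m. \<eta> i \<omega> * (h (us (Suc i)) - h (us i))) = (\<Sum>j<k. \<zeta>' j \<omega> * (h (L ! Suc j) - h (L ! j)))"
    using elementary_refine[of m us \<eta> k "(!) L"] us \<eta> g gP unfolding P_def by blast
  show ?thesis
    unfolding elementary_integral_def
  proof (intro exI[of _ k] exI[of _ "(!) L"] exI[of _ "\<lambda>j \<omega>. \<zeta> j \<omega> + \<zeta>' j \<omega>"] conjI allI impI)
    show "0 \<le> L ! 0" "L ! k \<le> T" using P gP by auto
    fix j assume j: "j < k"
    show "L ! j \<le> L ! Suc j" using g[OF j] by simp
    show "(\<lambda>\<omega>. \<zeta> j \<omega> + \<zeta>' j \<omega>) \<in> borel_measurable (F (L ! j))" using \<zeta>(1) \<zeta>'(1) j by simp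
    obtain C C' where "\<forall>\<omega>\<in>space M. \<bar>\<zeta> j \<omega>\<bar> \<le> C" "\<forall>\<omega>\<in>space M. \<bar>\<zeta>' j \<omega>\<bar> \<le> C'"
      using \<zeta>(2) \<zeta>'(2) j by blast
    then have "\<forall>\<omega>\<in>space M. \<bar>\<zeta> j \<omega> + \<zeta>' j \<omega>\<bar> \<le> C + C'" by (meson abs_triangle_ineq add_mono order.trans)
    then show "\<exists>C. \<forall>\<omega>\<in>space M. \<bar>\<zeta> j \<omega> + \<zeta>' j \<omega>\<bar> \<le> C" by blast
  next
    show "(\<lambda>\<omega>. J \<omega> + J' \<omega>) = (\<lambda>\<omega>. \<Sum>i<k. (\<zeta> i \<omega> + \<zeta>' i \<omega>) * (B (L ! Suc i) \<omega> - B (L ! i) \<omega>))"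
      unfolding J J' using \<zeta>e[of _ "\<lambda>t. B t _"] \<zeta>'e[of _ "\<lambda>t. B t _"] by (simp add: distrib_right sum.distrib)
    show "(\<lambda>u \<omega>. S u \<omega> + S' u \<omega>) = (\<lambda>u \<omega>. \<Sum>i<k. (\<zeta> i \<omega> + \<zeta>' i \<omega>) * indicator {L ! i<..L ! Suc i} u)"
      unfolding S S' using \<zeta>e[of _ "\<lambda>t. of_bool (_ \<le> t)"] \<zeta>'e[of _ "\<lambda>t. of_bool (_ \<le> t)"] ts(2) us(2) g
      by (simp add: distrib_right sum.distrib indicator_Ioc_diff less_imp_le)
  qed
qed

lemma elementary_const:
  fixes c :: "'a \<Rightarrow> real"
  assumes "0 \<le> s" "s \<le> t" "t \<le> T" "c \<in> borel_measurable (F s)" "\<And>\<omega>. \<omega> \<in> space M \<Longrightarrow> \<bar>c \<omega>\<bar> \<le> C"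
  shows "elementary_integral M F B T (\<lambda>u \<omega>. c \<omega> * indicator {s<..t} u) (\<lambda>\<omega>. c \<omega> * (B t \<omega> - B s \<omega>))"
  unfolding elementary_integral_def
  by (rule exI[of _ 1], rule exI[of _ "\<lambda>i. if i = 0 then s else t"], rule exI[of _ "\<lambda>_. c"])
    (use assms in auto)

lemma elementary_zero: "0 \<le> T \<Longrightarrow> elementary_integral M F B T (\<lambda>u \<omega>. 0) (\<lambda>\<omega>. 0)"
  using elementary_const[of 0 0 T "\<lambda>_. 0" 0] by simp

lemma elementary_sum:
  assumes "0 \<le> T" "\<And>i. i < n \<Longrightarrow> elementary_integral M F B T (S i) (J i)"
  shows "elementary_integral M F B T (\<lambda>u \<omega>. \<Sum>i<n. S i u \<omega>) (\<lambda>\<omega>. \<Sum>i<(n::nat). J i \<omega>)"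
  using assms(2)
proof (induction n)
  case (Suc n)
  then show ?case using elementary_add[of T "\<lambda>u \<omega>. \<Sum>i<n. S i u \<omega>" "\<lambda>\<omega>. \<Sum>i<n. J i \<omega>" "S n" "J n"] by simp
qed (simp add: elementary_zero assms)

lemma elementary_uminus:
  assumes "elementary_integral M F B T S J"
  shows "elementary_integral M F B T (\<lambda>u \<omega>. - S u \<omega>) (\<lambda>\<omega>. - J \<omega>)"
proof -
  obtain n ts \<xi> where *: "0 \<le> ts 0" "\<forall>i<n. ts i \<le> ts (Suc i)" "ts n \<le> T"
    "\<forall>i<n. \<xi> i \<in> borel_measurable (F (ts i)) \<and> (\<exists>C. \<forall>\<omega>\<in>space M. \<bar>\<xi> i \<omega>\<bar> \<le> C)"
    and S: "S = (\<lambda>u \<omega>. \<Sum>i<n. \<xi> i \<omega> * indicator {ts i<..ts (Suc i)} u)"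
    and J: "J = (\<lambda>\<omega>. \<Sum>i<n. \<xi> i \<omega> * (B (ts (Suc i)) \<omega> - B (ts i) \<omega>))"
    using assms(1) unfolding elementary_integral_def by blast
  show ?thesis
    unfolding elementary_integral_def
    by (rule exI[of _ n], rule exI[of _ ts], rule exI[of _ "\<lambda>i \<omega>. - \<xi> i \<omega>"])
      (use * in \<open>auto simp: S J sum_negf\<close>)
qed

text \<open>A single process \<open>Js\<close> serves all windows \<open>{s<..t}\<close> and all
  weights known at time \<open>s\<close>. It is used to cut the approximations of an Ito integral
  over \<open>[0,T]\<close> down to the cells of a partition.\<close>

lemma elementary_stopped:
  assumes "elementary_integral M F B T S J"
  obtains Js where "Js T = J" "Js 0 = (\<lambda>_. 0)"
    "\<And>s t (c::'a \<Rightarrow> real) C. 0 \<le> s \<Longrightarrow> s \<le> t \<Longrightarrow> c \<in> borel_measurable (F s) \<Longrightarrow> (\<And>\<omega>. \<omega> \<in> space M \<Longrightarrow> \<bar>c \<omega>\<bar> \<le> C) \<Longrightarrow>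
      elementary_integral M F B t (\<lambda>u \<omega>. c \<omega> * (S u \<omega> * indicator {s<..t} u)) (\<lambda>\<omega>. c \<omega> * (Js t \<omega> - Js s \<omega>))"
proof -
  obtain n ts \<xi> where ts: "0 \<le> ts 0" "\<And>i. i < n \<Longrightarrow> ts i \<le> ts (Suc i)" "ts n \<le> T"
    and \<xi>: "\<And>i. i < n \<Longrightarrow> \<xi> i \<in> borel_measurable (F (ts i))"
       "\<And>i. i < n \<Longrightarrow> (\<exists>C. \<forall>\<omega>\<in>space M. \<bar>\<xi> i \<omega>\<bar> \<le> C)"
    and S: "S = (\<lambda>u \<omega>. \<Sum>i<n. \<xi> i \<omega> * indicator {ts i<..ts (Suc i)} u)"
    and J: "J = (\<lambda>\<omega>. \<Sum>i<n. \<xi> i \<omega> * (B (ts (Suc i)) \<omega> - B (ts i) \<omega>))"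
    using assms(1) unfolding elementary_integral_def by blast
  have le: "0 \<le> ts i" "ts i \<le> T" if "i \<le> n" for i
    using mono_upto[of n ts 0 i] mono_upto[of n ts i n] ts that by fastforce+
  define Js where "Js t \<omega> = (\<Sum>i<n. \<xi> i \<omega> * (B (min (ts (Suc i)) t) \<omega> - B (min (ts i) t) \<omega>))" for t \<omega>
  show thesis
  proof (rule that[of Js])
    show "Js T = J" unfolding J Js_def using le by (auto simp: fun_eq_iff min_absorb1 intro!: sum.cong)
    show "Js 0 = (\<lambda>_. 0)" unfolding Js_def using le by (auto simp: fun_eq_iff min_absorb2 intro!: sum.neutral)
    fix s t :: real and c :: "'a \<Rightarrow> real" and C assume st: "0 \<le> s" "s \<le> t" and c: "c \<in> borel_measurable (F s)"
      and C: "\<And>\<omega>. \<omega> \<in> space M \<Longrightarrow> \<bar>c \<omega>\<bar> \<le> C"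
    define r where "r i = min (max (ts i) s) t" for i
    \<comment> \<open>The clipped endpoint satisfies \<open>ts i \<le> r i\<close> exactly when
      \<open>ts i \<le> t\<close>. Otherwise \<open>\<xi> i\<close> need not be known at
      \<open>r i = t\<close>, but then both ends of the cell collapse to \<open>t\<close> and the
      coefficient may be set to 0.\<close>
    define \<zeta> where "\<zeta> i \<omega> = (if ts i \<le> r i then c \<omega> * \<xi> i \<omega> else 0)" for i \<omega>
    show "elementary_integral M F B t (\<lambda>u \<omega>. c \<omega> * (S u \<omega> * indicator {s<..t} u)) (\<lambda>\<omega>. c \<omega> * (Js t \<omega> - Js s \<omega>))"
      unfolding elementary_integral_def
    proof (intro exI[of _ n] exI[of _ r] exI[of _ \<zeta>] conjI allI impI)
      show "0 \<le> r 0" "r n \<le> t" unfolding r_def using st by auto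
      fix i assume i: "i < n"
      show "r i \<le> r (Suc i)" unfolding r_def using ts(2)[OF i] by auto
      show "\<zeta> i \<in> borel_measurable (F (r i))"
      proof (cases "ts i \<le> r i")
        case True
        moreover have "s \<le> r i" unfolding r_def using st by auto
        ultimately show ?thesis
          unfolding \<zeta>_def using measurable_F_mono[OF c] measurable_F_mono[OF \<xi>(1)[OF i]] by simp
      next
        case False
        then have "\<zeta> i = (\<lambda>_. 0)" by (simp add: \<zeta>_def fun_eq_iff)
        then show ?thesis by simp
      qed
      obtain D where D: "\<forall>\<omega>\<in>space M. \<bar>\<xi> i \<omega>\<bar> \<le> D" using \<xi>(2)[OF i] by blast
      have "\<bar>\<zeta> i \<omega>\<bar> \<le> C * D" if "\<omega> \<in> space M" for \<omega>
      proof -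
        have *: "\<bar>c \<omega>\<bar> \<le> C" "\<bar>\<xi> i \<omega>\<bar> \<le> D" using C[OF that] D that by auto
        then have "\<bar>c \<omega>\<bar> * \<bar>\<xi> i \<omega>\<bar> \<le> C * D" "0 \<le> C" "0 \<le> D"
          by (auto intro!: mult_mono elim: order.trans[OF abs_ge_zero])
        then show ?thesis unfolding \<zeta>_def by (simp add: abs_mult)
      qed
      then show "\<exists>C. \<forall>\<omega>\<in>space M. \<bar>\<zeta> i \<omega>\<bar> \<le> C" by blast
    next
      have 1: "c \<omega> * \<xi> i \<omega> * (indicator {ts i<..ts (Suc i)} u * indicator {s<..t} u) =
        \<zeta> i \<omega> * indicator {r i<..r (Suc i)} u" for i u \<omega>
        unfolding \<zeta>_def r_def using st by (auto split: split_indicator)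
      show "(\<lambda>u \<omega>. c \<omega> * (S u \<omega> * indicator {s<..t} u)) = (\<lambda>u \<omega>. \<Sum>i<n. \<zeta> i \<omega> * indicator {r i<..r (Suc i)} u)"
        unfolding S 1[symmetric] sum_distrib_right sum_distrib_left by (simp only: mult.assoc)
      have 2: "c \<omega> * \<xi> i \<omega> * ((B (min (ts (Suc i)) t) \<omega> - B (min (ts i) t) \<omega>) - (B (min (ts (Suc i)) s) \<omega> - B (min (ts i) s) \<omega>))
        = \<zeta> i \<omega> * (B (r (Suc i)) \<omega> - B (r i) \<omega>)" if "i < n" for i \<omega>
        unfolding \<zeta>_def r_def using st ts(2)[OF that] by (auto simp: min_def max_def)
      show "(\<lambda>\<omega>. c \<omega> * (Js t \<omega> - Js s \<omega>)) = (\<lambda>\<omega>. \<Sum>i<n. \<zeta> i \<omega> * (B (r (Suc i)) \<omega> - B (r i) \<omega>))"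
        unfolding Js_def sum_subtractf[symmetric] sum_distrib_left
        using 2 by (intro ext sum.cong) (simp_all add: algebra_simps)
    qed
  qed
qed

end

section \<open>Convergence in probability\<close>

lemma ennreal_tendsto_0I:
  fixes f :: "nat \<Rightarrow> ennreal"
  assumes "\<And>e::real. 0 < e \<Longrightarrow> eventually (\<lambda>k. f k \<le> ennreal e) sequentially"
  shows "f \<longlonglongrightarrow> 0"
proof (rule order_tendstoI)
  fix a :: ennreal assume "0 < a"
  then obtain z where z: "0 < z" "z < a" using dense by blast
  then obtain r where r: "0 < r" "z = ennreal r" by (cases z) auto
  show "eventually (\<lambda>k. f k < a) sequentially"
    using assms[OF r(1)] by (rule eventually_mono) (use z r in auto)
qed simp

lemma min_one_add: "min 1 (a + b) \<le> min 1 a + min 1 (b::ennreal)"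
proof -
  consider "1 \<le> a" | "1 \<le> b" | "a \<le> 1" "b \<le> 1" by (meson linear)
  then show ?thesis
  proof cases
    case 1 then show ?thesis by (simp add: min_absorb1 min.coboundedI1)
  next
    case 2 then show ?thesis by (simp add: min_absorb1 min.coboundedI1)
  next
    case 3 then show ?thesis by (simp add: min_absorb2)
  qed
qed

lemma min_cmult_le:
  fixes a c K :: ennreal
  assumes "c \<le> K"
  shows "min K (c * a) \<le> K * min 1 a"
proof (cases "a \<le> 1")
  case True
  then show ?thesis using assms by (simp add: min_absorb2 min.coboundedI2 mult_right_mono)
next
  case False
  then show ?thesis by (simp add: min_absorb1)
qed

lemma square_add_le: "ennreal ((a + b)\<^sup>2) \<le> 2 * ennreal (a\<^sup>2) + 2 * ennreal (b\<^sup>2)"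
proof -
  have "(a + b)\<^sup>2 \<le> 2 * a\<^sup>2 + 2 * b\<^sup>2" 
    using sum_squares_bound[of a b] by (simp add: power2_sum)
  then have "ennreal ((a + b)\<^sup>2) \<le> ennreal (2 * a\<^sup>2 + 2 * b\<^sup>2)" by (rule ennreal_leI)
  then show ?thesis by (simp add: ennreal_mult)
qed

text \<open>The quantifier over \<open>g\<close> stands inside each case: the same cell evaluates
  all step sums over the partition at \<open>u\<close>, so that two of them can be compared
  pointwise.\<close>

lemma step_cases:
  fixes ts :: "nat \<Rightarrow> real"
  assumes "\<And>i. i < n \<Longrightarrow> ts i \<le> ts (Suc i)"
  obtains i where "i < n" "u \<in> {ts i<..ts (Suc i)}"
      "\<And>g::nat \<Rightarrow> real. (\<Sum>j<n. g j * indicator {ts j<..ts (Suc j)} u) = g i"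
    | "\<And>g::nat \<Rightarrow> real. (\<Sum>j<n. g j * indicator {ts j<..ts (Suc j)} u) = 0"
proof (cases "\<exists>i<n. u \<in> {ts i<..ts (Suc i)}")
  case True
  then obtain i where i: "i < n" "u \<in> {ts i<..ts (Suc i)}" by blast
  show ?thesis by (rule that(1)[OF i]) (rule sum_step_eq[OF assms i])
next
  case False
  then have "\<And>i. i < n \<Longrightarrow> indicator {ts i<..ts (Suc i)} u = (0::real)" by auto
  then show ?thesis by (intro that(2)) simp
qed

lemma elementary_integral_mono:
  assumes "elementary_integral M F B s S J" "s \<le> t"
  shows "elementary_integral M F B t S J"
proof -
  have "z \<le> t" if "z \<le> s" for z using assms(2) that by simp
  then show ?thesis using assms(1) unfolding elementary_integral_def by blast
qed

text \<open>Cells are open on the left and start at nonnegative times. Thus multiplying by the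
  indicator of \<open>{0<..t}\<close> changes nothing on \<open>[0,t]\<close>, not even at time
  0.\<close>

lemma elementary_at_0:
  assumes "elementary_integral M F B T S J"
  shows "S 0 \<omega> = 0"
proof -
  obtain n ts \<xi> where ts: "0 \<le> ts 0" "\<And>i. i < n \<Longrightarrow> ts i \<le> ts (Suc i)"
    and S: "S = (\<lambda>u \<omega>. \<Sum>i<n. \<xi> i \<omega> * indicator {ts i<..ts (Suc i)} u)"
    using assms unfolding elementary_integral_def by blast
  have "0 \<le> ts i" if "i < n" for i
    using mono_upto[of n ts 0 i] ts(2) that ts(1) by force
  then have "0 \<notin> {ts i<..ts (Suc i)}" if "i < n" for i
    using that by force
  then show ?thesis unfolding S by (intro sum.neutral) (auto simp del: greaterThanAtMost_iff)
qed

section \<open>Joint measurability in time and sample point\<close>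

abbreviation joint_measurable :: "'a measure \<Rightarrow> real \<Rightarrow> (real \<Rightarrow> 'a \<Rightarrow> real) \<Rightarrow> bool" where
  "joint_measurable M T V \<equiv> (\<lambda>(u, \<omega>). V u \<omega>) \<in> borel_measurable (restrict_space borel {0..T} \<Otimes>\<^sub>M M)"

lemma sq_int_restrict: "sq_int T V \<omega> = (\<integral>\<^sup>+u. ennreal ((V u \<omega>)\<^sup>2) \<partial>restrict_space lborel {0..T})"
  unfolding sq_int_def by (subst nn_integral_restrict_space) auto

lemma joint_measurable_sq_int:
  assumes "joint_measurable M T V"
  shows "sq_int T V \<in> borel_measurable M"
proof -
  \<comment> \<open>Measurability of a parameter integral asks for a sigma-finite measure in the
    integrated variable. The time interval carries a finite one; for negative \<open>T\<close> it is
    empty.\<close>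
  interpret R: finite_measure "restrict_space lborel {0..T}"
    by (rule finite_measureI) (cases "0 \<le> T"; simp add: emeasure_restrict_space space_restrict_space)
  have "sets (restrict_space borel {0..T} \<Otimes>\<^sub>M M) = sets (restrict_space lborel {0..T} \<Otimes>\<^sub>M M)"
    by (intro sets_pair_measure_cong sets_restrict_space_cong) auto
  then have [measurable]: "(\<lambda>(u, \<omega>). V u \<omega>) \<in> borel_measurable (restrict_space lborel {0..T} \<Otimes>\<^sub>M M)"
    using assms measurable_cong_sets by blast
  have "(\<lambda>(\<omega>, u). ennreal ((V u \<omega>)\<^sup>2)) \<in> borel_measurable (M \<Otimes>\<^sub>M restrict_space lborel {0..T})"
    using measurable_compose[OF measurable_pair_swap'[of M "restrict_space lborel {0..T}"],
       of "\<lambda>(u, \<omega>). ennreal ((V u \<omega>)\<^sup>2)" borel] by (simp add: case_prod_beta')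
  then show ?thesis
    unfolding sq_int_restrict[abs_def] by (intro R.borel_measurable_nn_integral)
qed

lemma joint_measurable_path:
  assumes "joint_measurable M T V" "\<omega> \<in> space M"
  shows "(\<lambda>u. V u \<omega>) \<in> borel_measurable (restrict_space lborel {0..T})"
proof -
  have "(\<lambda>u. (u, \<omega>)) \<in> restrict_space borel {0..T} \<rightarrow>\<^sub>M restrict_space borel {0..T} \<Otimes>\<^sub>M M"
    using assms(2) by measurable
  from measurable_compose[OF this assms(1)]
  show ?thesis
    using measurable_cong_sets[OF sets_restrict_space_cong[OF sets_lborel, of "{0..T}"] refl] by auto
qed

lemma joint_measurable_mono:
  assumes "joint_measurable M T V" "s \<le> T"
  shows "joint_measurable M s V"
proof -
  have "(\<lambda>x. x) \<in> restrict_space borel {0..s} \<rightarrow>\<^sub>M restrict_space borel {0..T}"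
    using assms(2) by (intro measurable_restrict_space3) auto
  then have "(\<lambda>x. (fst x, snd x)) \<in> restrict_space borel {0..s} \<Otimes>\<^sub>M M \<rightarrow>\<^sub>M restrict_space borel {0..T} \<Otimes>\<^sub>M M"
    by (intro measurable_Pair measurable_compose[OF measurable_fst] measurable_snd) auto
  from measurable_compose[OF this assms(1)] show ?thesis by (simp add: case_prod_beta')
qed

lemma joint_measurable_fst: "(g::real\<Rightarrow>real) \<in> borel_measurable borel \<Longrightarrow> joint_measurable M T (\<lambda>u \<omega>. g u)"
  unfolding case_prod_beta'
  by (rule measurable_compose[OF measurable_fst]) (simp add: measurable_restrict_space1)

lemma joint_measurable_snd: "(c::_\<Rightarrow>real) \<in> borel_measurable M \<Longrightarrow> joint_measurable M T (\<lambda>u \<omega>. c \<omega>)"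
  unfolding case_prod_beta' by (rule measurable_compose[OF measurable_snd])

lemma joint_measurable_diff:
  "joint_measurable M T U \<Longrightarrow> joint_measurable M T V \<Longrightarrow> joint_measurable M T (\<lambda>u \<omega>. U u \<omega> - V u \<omega>)"
  by (simp add: case_prod_beta')

lemma joint_measurable_mult:
  "joint_measurable M T U \<Longrightarrow> joint_measurable M T V \<Longrightarrow> joint_measurable M T (\<lambda>u \<omega>. U u \<omega> * V u \<omega>)"
  by (simp add: case_prod_beta')

lemma joint_measurable_sum:
  "(\<And>i. i < n \<Longrightarrow> joint_measurable M T (U i)) \<Longrightarrow> joint_measurable M T (\<lambda>u \<omega>. \<Sum>i<(n::nat). U i u \<omega>)"
  by (auto simp: case_prod_beta')

lemma sq_int_add_le:
  assumes "joint_measurable M T U" "joint_measurable M T V" "\<omega> \<in> space M"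
    and "\<And>u. u \<in> {0..T} \<Longrightarrow> W u \<omega> = U u \<omega> + V u \<omega>"
  shows "sq_int T W \<omega> \<le> 2 * sq_int T U \<omega> + 2 * sq_int T V \<omega>"
proof -
  note [measurable] = joint_measurable_path[OF assms(1,3)] joint_measurable_path[OF assms(2,3)]
  have "sq_int T W \<omega> \<le> (\<integral>\<^sup>+u. 2 * ennreal ((U u \<omega>)\<^sup>2) + 2 * ennreal ((V u \<omega>)\<^sup>2) \<partial>restrict_space lborel {0..T})"
    unfolding sq_int_restrict using assms(4) square_add_le
    by (intro nn_integral_mono) (simp add: space_restrict_space)
  also have "\<dots> = 2 * sq_int T U \<omega> + 2 * sq_int T V \<omega>"
    unfolding sq_int_restrict by (simp add: nn_integral_add nn_integral_cmult)
  finally show ?thesis .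
qed

lemma sq_int_cmult_le:
  assumes "joint_measurable M T U" "\<omega> \<in> space M"
    and "\<And>u. u \<in> {0..T} \<Longrightarrow> \<bar>W u \<omega>\<bar> \<le> C * \<bar>U u \<omega>\<bar>"
  shows "sq_int T W \<omega> \<le> ennreal (C\<^sup>2) * sq_int T U \<omega>"
proof -
  note [measurable] = joint_measurable_path[OF assms(1,2)]
  have "(W u \<omega>)\<^sup>2 \<le> C\<^sup>2 * (U u \<omega>)\<^sup>2" if "u \<in> {0..T}" for u
    using power_mono[OF assms(3)[OF that], of 2] by (simp add: power_mult_distrib)
  then have "sq_int T W \<omega> \<le> (\<integral>\<^sup>+u. ennreal (C\<^sup>2) * ennreal ((U u \<omega>)\<^sup>2) \<partial>restrict_space lborel {0..T})"
    unfolding sq_int_restrict ennreal_mult'[OF zero_le_power2, symmetric]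
    by (intro nn_integral_mono ennreal_leI) (simp add: space_restrict_space)
  also have "\<dots> = ennreal (C\<^sup>2) * sq_int T U \<omega>"
    unfolding sq_int_restrict by (simp add: nn_integral_cmult)
  finally show ?thesis .
qed

section \<open>Calculus of convergence to 0 in probability\<close>

context prob_space
begin

text \<open>Convergence to \<open>0\<close> in probability: truncating the expectation at \<open>1\<close> makes the notion additive and
  stable under multiplication by constants without any integrability.\<close>

definition tends_prob :: "(nat \<Rightarrow> 'a \<Rightarrow> ennreal) \<Rightarrow> bool" where
  "tends_prob N \<longleftrightarrow> (\<lambda>k. \<integral>\<^sup>+\<omega>. min 1 (N k \<omega>) \<partial>M) \<longlonglongrightarrow> 0"

lemma tends_probI:
  assumes [measurable]: "\<And>k. N k \<in> borel_measurable M"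
    and lim: "\<And>\<epsilon>. 0 < \<epsilon> \<Longrightarrow> (\<lambda>k. measure M {\<omega> \<in> space M. ennreal \<epsilon> < N k \<omega>}) \<longlonglongrightarrow> 0"
  shows "tends_prob N"
  unfolding tends_prob_def
proof (rule ennreal_tendsto_0I)
  fix e :: real assume e: "0 < e"
  have "eventually (\<lambda>k. measure M {\<omega> \<in> space M. ennreal (e/2) < N k \<omega>} < e / 2) sequentially"
    using order_tendstoD(2)[OF lim[of "e/2"], of "e/2"] e by simp
  then show "eventually (\<lambda>k. (\<integral>\<^sup>+\<omega>. min 1 (N k \<omega>) \<partial>M) \<le> ennreal e) sequentially"
  proof eventually_elim
    case (elim k)
    have "(\<integral>\<^sup>+\<omega>. min 1 (N k \<omega>) \<partial>M) \<le> (\<integral>\<^sup>+\<omega>. ennreal (e/2) + indicator {\<omega> \<in> space M. ennreal (e/2) < N k \<omega>} \<omega> \<partial>M)"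
      by (intro nn_integral_mono) (auto split: split_indicator simp: min.coboundedI2 min.coboundedI1 add_increasing not_less)
    also have "\<dots> = ennreal (e/2) + ennreal (measure M {\<omega> \<in> space M. ennreal (e/2) < N k \<omega>})"
      by (simp add: nn_integral_add emeasure_eq_measure prob_space)
    also have "\<dots> \<le> ennreal (e/2) + ennreal (e/2)"
      using elim by (intro add_left_mono ennreal_leI) simp
    also have "\<dots> = ennreal e" using e by (simp add: ennreal_plus[symmetric] del: ennreal_plus)
    finally show ?case .
  qed
qed

lemma tends_prob_mono:
  assumes "tends_prob N" "\<And>k \<omega>. \<omega> \<in> space M \<Longrightarrow> N' k \<omega> \<le> N k \<omega>"
  shows "tends_prob N'"
  unfolding tends_prob_def
  by (rule tendsto_sandwich[OF _ _ tendsto_const assms(1)[unfolded tends_prob_def]])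
    (use assms(2) in \<open>auto intro!: always_eventually nn_integral_mono min.mono\<close>)

lemma tends_prob_bound:
  assumes "tends_prob N" "\<And>k. (\<integral>\<^sup>+\<omega>. min 1 (N' k \<omega>) \<partial>M) \<le> ennreal C * (\<integral>\<^sup>+\<omega>. min 1 (N k \<omega>) \<partial>M)"
  shows "tends_prob N'"
  unfolding tends_prob_def
proof (rule tendsto_sandwich[OF _ _ tendsto_const])
  show "(\<lambda>k. ennreal C * (\<integral>\<^sup>+\<omega>. min 1 (N k \<omega>) \<partial>M)) \<longlonglongrightarrow> 0"
    using ennreal_tendsto_cmult[of "ennreal C", OF _ assms(1)[unfolded tends_prob_def]] by simp
qed (use assms(2) in auto)

lemma tends_prob_add:
  assumes [measurable]: "\<And>k. N k \<in> borel_measurable M" "\<And>k. N' k \<in> borel_measurable M"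
    and "tends_prob N" "tends_prob N'"
  shows "tends_prob (\<lambda>k \<omega>. N k \<omega> + N' k \<omega>)"
  unfolding tends_prob_def
proof (rule tendsto_sandwich[OF _ _ tendsto_const])
  show "(\<lambda>k. (\<integral>\<^sup>+\<omega>. min 1 (N k \<omega>) \<partial>M) + (\<integral>\<^sup>+\<omega>. min 1 (N' k \<omega>) \<partial>M)) \<longlonglongrightarrow> 0"
    using tendsto_add[OF assms(3,4)[unfolded tends_prob_def]] by simp
  have "(\<integral>\<^sup>+\<omega>. min 1 (N k \<omega> + N' k \<omega>) \<partial>M) \<le> (\<integral>\<^sup>+\<omega>. min 1 (N k \<omega>) \<partial>M) + (\<integral>\<^sup>+\<omega>. min 1 (N' k \<omega>) \<partial>M)" for k
    by (subst nn_integral_add[symmetric]) (auto intro!: nn_integral_mono min_one_add)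
  then show "\<forall>\<^sub>F k in sequentially. (\<integral>\<^sup>+\<omega>. min 1 (N k \<omega> + N' k \<omega>) \<partial>M) \<le> (\<integral>\<^sup>+\<omega>. min 1 (N k \<omega>) \<partial>M) + (\<integral>\<^sup>+\<omega>. min 1 (N' k \<omega>) \<partial>M)"
    by simp
qed simp

text \<open>The constant is \<open>max 1 C\<close>, not \<open>C\<close>: for \<open>C < 1\<close>
  and large \<open>a\<close> the value of \<open>min 1 (C * a)\<close> is still 1, which exceeds
  \<open>C * min 1 a\<close>.\<close>

lemma tends_prob_cmult:
  assumes [measurable]: "\<And>k. N k \<in> borel_measurable M" and "tends_prob N"
  shows "tends_prob (\<lambda>k \<omega>. ennreal C * N k \<omega>)"
proof (rule tends_prob_bound[OF assms(2), of _ "max 1 C"])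
  fix k
  have "min 1 (ennreal C * N k \<omega>) \<le> ennreal (max 1 C) * min 1 (N k \<omega>)" for \<omega>
  proof -
    have "min 1 (ennreal C * N k \<omega>) \<le> min (ennreal (max 1 C)) (ennreal C * N k \<omega>)"
      by (rule min.mono) auto
    also have "\<dots> \<le> ennreal (max 1 C) * min 1 (N k \<omega>)"
      by (rule min_cmult_le) (auto intro: ennreal_leI)
    finally show ?thesis .
  qed
  then show "(\<integral>\<^sup>+\<omega>. min 1 (ennreal C * N k \<omega>) \<partial>M) \<le> ennreal (max 1 C) * (\<integral>\<^sup>+\<omega>. min 1 (N k \<omega>) \<partial>M)"
    by (subst nn_integral_cmult[symmetric]) (auto intro!: nn_integral_mono)
qed

lemma tends_prob_subseq:
  "tends_prob N \<Longrightarrow> strict_mono r \<Longrightarrow> tends_prob (\<lambda>k. N (r k))"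
  unfolding tends_prob_def using LIMSEQ_subseq_LIMSEQ by (fastforce simp: o_def)

text \<open>Truncation at 1 turns the convergence into L1 convergence of bounded variables, which
  has an almost surely convergent subsequence. Once \<open>min 1 (N k)\<close> lies below 1 the
  truncation is inactive, so the limit 0 passes to \<open>N k\<close> itself.\<close>

lemma tends_prob_AE_subseq:
  assumes [measurable]: "\<And>k. N k \<in> borel_measurable M" and "tends_prob N"
  shows "\<exists>r::nat \<Rightarrow> nat. strict_mono r \<and> (AE \<omega> in M. (\<lambda>k. N (r k) \<omega>) \<longlonglongrightarrow> 0)"
proof -
  let ?u = "\<lambda>k \<omega>. enn2real (min 1 (N k \<omega>))"
  have fin: "min 1 y < top" for y :: ennreal
    using order.strict_trans1[of "min 1 y" 1 top] by (simp add: min.coboundedI1)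
  have u: "ennreal (?u k \<omega>) = min 1 (N k \<omega>)" for k \<omega>
    using fin by (simp add: less_top[symmetric])
  have bd: "?u k \<omega> \<le> 1" for k \<omega>
    using enn2real_mono[of "min 1 (N k \<omega>)" 1] by simp
  have int: "integrable M (?u k)" for k
    by (rule integrable_const_bound[where B=1]) (auto simp: bd)
  have "(\<integral>\<omega>. norm (?u k \<omega>) \<partial>M) = enn2real (\<integral>\<^sup>+\<omega>. min 1 (N k \<omega>) \<partial>M)" for k
    using nn_integral_eq_integral[OF int[of k]] by (simp add: u)
  moreover have "(\<lambda>k. enn2real (\<integral>\<^sup>+\<omega>. min 1 (N k \<omega>) \<partial>M)) \<longlonglongrightarrow> enn2real 0"
    using assms(2) unfolding tends_prob_def by (intro tendsto_enn2real) auto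
  ultimately have "(\<lambda>k. \<integral>\<omega>. norm (?u k \<omega>) \<partial>M) \<longlonglongrightarrow> 0" by simp
  from tendsto_L1_AE_subseq[OF int this] obtain r where r: "strict_mono r" "AE \<omega> in M. (\<lambda>k. ?u (r k) \<omega>) \<longlonglongrightarrow> 0"
    by blast
  have "(\<lambda>k. N (r k) \<omega>) \<longlonglongrightarrow> 0" if "(\<lambda>k. ?u (r k) \<omega>) \<longlonglongrightarrow> 0" for \<omega>
  proof -
    have *: "(\<lambda>k. min 1 (N (r k) \<omega>)) \<longlonglongrightarrow> 0"
      using tendsto_ennrealI[OF that] by (simp add: u)
    have "eventually (\<lambda>k. min 1 (N (r k) \<omega>) < 1) sequentially"
      using order_tendstoD(2)[OF *, of 1] by simp
    then have "eventually (\<lambda>k. min 1 (N (r k) \<omega>) = N (r k) \<omega>) sequentially"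
      by (rule eventually_mono) (auto simp: min_def split: if_splits)
    then show ?thesis using * tendsto_cong by fast
  qed
  then show ?thesis using r by (auto elim!: eventually_mono)
qed

lemma tends_prob_square_add:
  assumes [measurable]: "\<And>k. Y k \<in> borel_measurable M" "\<And>k. Z k \<in> borel_measurable M"
    and "tends_prob (\<lambda>k \<omega>. ennreal ((Y k \<omega>)\<^sup>2))" "tends_prob (\<lambda>k \<omega>. ennreal ((Z k \<omega>)\<^sup>2))"
  shows "tends_prob (\<lambda>k \<omega>. ennreal ((Y k \<omega> + Z k \<omega>)\<^sup>2))"
proof (rule tends_prob_mono)
  show "tends_prob (\<lambda>k \<omega>. ennreal 2 * ennreal ((Y k \<omega>)\<^sup>2) + ennreal 2 * ennreal ((Z k \<omega>)\<^sup>2))"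
    by (intro tends_prob_add tends_prob_cmult assms) auto
qed (use square_add_le in simp)

lemma tends_prob_square_sum:
  assumes [measurable]: "\<And>i k. i < n \<Longrightarrow> Y i k \<in> borel_measurable M"
    and "\<And>i. i < n \<Longrightarrow> tends_prob (\<lambda>k \<omega>. ennreal ((Y i k \<omega>)\<^sup>2))"
  shows "tends_prob (\<lambda>k \<omega>. ennreal ((\<Sum>i<(n::nat). Y i k \<omega>)\<^sup>2))"
  using assms
proof (induction n)
  case 0
  then show ?case by (simp add: tends_prob_def)
next
  case (Suc n)
  then show ?case
    using tends_prob_square_add[of "\<lambda>k \<omega>. \<Sum>i<n. Y i k \<omega>" "Y n"] by simp
qed

lemma tends_prob_square_mult:
  assumes [measurable]: "\<And>k. Y k \<in> borel_measurable M"
    and "tends_prob (\<lambda>k \<omega>. ennreal ((Y k \<omega>)\<^sup>2))" "\<And>\<omega>. \<omega> \<in> space M \<Longrightarrow> \<bar>c \<omega>\<bar> \<le> C"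
  shows "tends_prob (\<lambda>k \<omega>. ennreal ((c \<omega> * Y k \<omega>)\<^sup>2))"
proof (rule tends_prob_mono)
  show "tends_prob (\<lambda>k \<omega>. ennreal (C\<^sup>2) * ennreal ((Y k \<omega>)\<^sup>2))"
    by (intro tends_prob_cmult assms) auto
  fix k \<omega> assume "\<omega> \<in> space M"
  then have "(c \<omega>)\<^sup>2 \<le> C\<^sup>2" using power_mono[OF assms(3), of \<omega> 2] by simp
  then show "ennreal ((c \<omega> * Y k \<omega>)\<^sup>2) \<le> ennreal (C\<^sup>2) * ennreal ((Y k \<omega>)\<^sup>2)"
    by (simp add: ennreal_mult'[symmetric] power_mult_distrib ennreal_leI mult_right_mono)
qed

lemma tends_prob_squareI:
  assumes [measurable]: "\<And>k. Y k \<in> borel_measurable M"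
    and "\<And>\<epsilon>. 0 < \<epsilon> \<Longrightarrow> (\<lambda>k. measure M {\<omega> \<in> space M. \<epsilon> < \<bar>Y k \<omega>\<bar>}) \<longlonglongrightarrow> 0"
  shows "tends_prob (\<lambda>k \<omega>. ennreal ((Y k \<omega>)\<^sup>2))"
proof (rule tends_probI)
  fix \<epsilon> :: real assume e: "0 < \<epsilon>"
  have "ennreal \<epsilon> < ennreal (y\<^sup>2) \<longleftrightarrow> sqrt \<epsilon> < \<bar>y\<bar>" for y
    using e real_sqrt_less_iff[of \<epsilon> "y\<^sup>2"] by (simp add: ennreal_less_iff)
  then show "(\<lambda>k. measure M {\<omega> \<in> space M. ennreal \<epsilon> < ennreal ((Y k \<omega>)\<^sup>2)}) \<longlonglongrightarrow> 0"
    using assms(2)[of "sqrt \<epsilon>"] e by simp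
qed simp

end

section \<open>From elementary integrands to limits in probability\<close>

context brownian
begin

lemma elementary_joint_measurable:
  assumes "elementary_integral M F B T S J"
  shows "joint_measurable M t S"
proof -
  obtain n ts \<xi> where \<xi>: "\<And>i. i < n \<Longrightarrow> \<xi> i \<in> borel_measurable (F (ts i))"
    and S: "S = (\<lambda>u \<omega>. \<Sum>i<n. \<xi> i \<omega> * indicator {ts i<..ts (Suc i)} u)"
    using assms unfolding elementary_integral_def by blast
  show ?thesis unfolding S
    by (intro joint_measurable_sum joint_measurable_mult joint_measurable_snd joint_measurable_fst
        measurable_F_M[OF \<xi>]) auto
qed

text \<open>A domination inequality. Where \<open>sq_int\<close> is at most 1 the truncated isometry
  bounds the second moment of \<open>J k\<close>; elsewhere \<open>min 1 (sq_int T (S k))\<close>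
  equals 1 and dominates the truncated square. Each part costs one copy of the right-hand side,
  hence the factor 2.\<close>

lemma tends_prob_elementary:
  assumes el: "\<And>k. elementary_integral M F B T (S k) (J k)" and tp: "tends_prob (\<lambda>k. sq_int T (S k))"
  shows "tends_prob (\<lambda>k \<omega>. ennreal ((J k \<omega>)\<^sup>2))"
proof (rule tends_prob_bound[OF tp, of _ 2])
  fix k
  note tr = elementary_truncated[OF el[of k], of 1]
  have [measurable]: "J k \<in> borel_measurable M" "sq_int T (S k) \<in> borel_measurable M" using tr by auto
  let ?N = "sq_int T (S k)"
  have "(\<integral>\<^sup>+\<omega>. min 1 (ennreal ((J k \<omega>)\<^sup>2)) \<partial>M) \<le>
    (\<integral>\<^sup>+\<omega>. ennreal ((J k \<omega>)\<^sup>2) * indicator {\<omega>. ?N \<omega> \<le> ennreal 1} \<omega> + min 1 (?N \<omega>) \<partial>M)"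
  proof (intro nn_integral_mono)
    fix \<omega>
    show "min 1 (ennreal ((J k \<omega>)\<^sup>2)) \<le> ennreal ((J k \<omega>)\<^sup>2) * indicator {\<omega>. ?N \<omega> \<le> ennreal 1} \<omega> + min 1 (?N \<omega>)"
      by (cases "?N \<omega> \<le> 1") (auto simp: min.coboundedI2 min.coboundedI1 min_absorb1 add_increasing2)
  qed
  also have "\<dots> = (\<integral>\<^sup>+\<omega>. ennreal ((J k \<omega>)\<^sup>2) * indicator {\<omega>. ?N \<omega> \<le> ennreal 1} \<omega> \<partial>M) + (\<integral>\<^sup>+\<omega>. min 1 (?N \<omega>) \<partial>M)"
    by (rule nn_integral_add) auto
  also have "\<dots> \<le> (\<integral>\<^sup>+\<omega>. min (?N \<omega>) (ennreal 1) \<partial>M) + (\<integral>\<^sup>+\<omega>. min 1 (?N \<omega>) \<partial>M)"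
    using tr(3) by (intro add_right_mono) simp
  also have "\<dots> = ennreal 2 * (\<integral>\<^sup>+\<omega>. min 1 (?N \<omega>) \<partial>M)"
    by (simp add: min.commute mult_2)
  finally show "(\<integral>\<^sup>+\<omega>. min 1 (ennreal ((J k \<omega>)\<^sup>2)) \<partial>M) \<le> ennreal 2 * (\<integral>\<^sup>+\<omega>. min 1 (?N \<omega>) \<partial>M)" .
qed

text \<open>The approximations converge in probability only, so second moments cannot be passed to
  the limit directly. For a fixed level \<open>K\<close> the truncated isometry gives
  \<open>E min (sq_int S) K \<le> 2 E sq_int V + K * E min 1 a\<close>, where \<open>a\<close> is
  the \<open>sq_int\<close> of \<open>S - V\<close>; the last term vanishes along the sequence, and
  Fatou's lemma moves the bound to \<open>Q\<close>. A second use of Fatou's lemma lets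
  \<open>K\<close> grow.\<close>

lemma L2_bound_limit:
  assumes el: "\<And>k. elementary_integral M F B T (S k) (J k)"
    and V: "joint_measurable M T V" and Q [measurable]: "Q \<in> borel_measurable M"
    and SV: "tends_prob (\<lambda>k. sq_int T (\<lambda>u \<omega>. S k u \<omega> - V u \<omega>))"
    and JQ: "tends_prob (\<lambda>k \<omega>. ennreal ((J k \<omega> - Q \<omega>)\<^sup>2))"
  shows "(\<integral>\<^sup>+\<omega>. ennreal ((Q \<omega>)\<^sup>2) \<partial>M) \<le> 2 * (\<integral>\<^sup>+\<omega>. sq_int T V \<omega> \<partial>M)"
proof (cases "(\<integral>\<^sup>+\<omega>. sq_int T V \<omega> \<partial>M) = \<infinity>")
  case True
  then show ?thesis by (simp add: ennreal_mult_top)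
next
  case False
  let ?N = "sq_int T V" and ?a = "\<lambda>k. sq_int T (\<lambda>u \<omega>. S k u \<omega> - V u \<omega>)"
  have jmD: "joint_measurable M T (\<lambda>u \<omega>. S k u \<omega> - V u \<omega>)" for k
    by (intro joint_measurable_diff elementary_joint_measurable[OF el] V)
  have [measurable]: "?N \<in> borel_measurable M" "?a k \<in> borel_measurable M"
    "sq_int T (S k) \<in> borel_measurable M" "J k \<in> borel_measurable M" for k
    using joint_measurable_sq_int[OF V] joint_measurable_sq_int[OF jmD]
      elementary_truncated(1,2)[OF el, of 1] by auto
  have AEN: "AE \<omega> in M. ?N \<omega> \<noteq> \<infinity>"
    by (rule nn_integral_PInf_AE) (use False in auto)
  obtain r1 where r1: "strict_mono r1" "AE \<omega> in M. (\<lambda>k. ?a (r1 k) \<omega>) \<longlonglongrightarrow> 0"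
    using tends_prob_AE_subseq[OF _ SV] by auto
  obtain r2 where r2: "strict_mono r2" "AE \<omega> in M. (\<lambda>k. ennreal ((J (r1 (r2 k)) \<omega> - Q \<omega>)\<^sup>2)) \<longlonglongrightarrow> 0"
    using tends_prob_AE_subseq[OF _ tends_prob_subseq[OF JQ r1(1)]] by auto
  define r where "r = r1 \<circ> r2"
  have r: "strict_mono r" unfolding r_def using r1 r2 strict_mono_o by blast
  have AEa: "AE \<omega> in M. (\<lambda>k. ?a (r k) \<omega>) \<longlonglongrightarrow> 0"
    using r1(2) by eventually_elim (use LIMSEQ_subseq_LIMSEQ r2(1) in \<open>fastforce simp: r_def o_def\<close>)
  have AEJ: "AE \<omega> in M. (\<lambda>k. ennreal ((J (r k) \<omega> - Q \<omega>)\<^sup>2)) \<longlonglongrightarrow> 0"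
    using r2(2) by (simp add: r_def)
  have le: "sq_int T (S k) \<omega> \<le> 2 * ?N \<omega> + 2 * ?a k \<omega>" if "\<omega> \<in> space M" for k \<omega>
    by (rule sq_int_add_le[OF V jmD that]) simp
  have K: "(\<integral>\<^sup>+\<omega>. ennreal ((Q \<omega>)\<^sup>2) * indicator {\<omega>. 2 * ?N \<omega> < ennreal K} \<omega> \<partial>M) \<le> 2 * (\<integral>\<^sup>+\<omega>. ?N \<omega> \<partial>M)"
    if K2: "2 \<le> K" for K :: real
  proof -
    \<comment> \<open>The truncated isometry speaks of the event that \<open>sq_int\<close> of the
      elementary integrand is at most \<open>K\<close>. By \<open>le\<close> and the almost sure
      convergence of \<open>?a\<close>, a point with \<open>2 * ?N < K\<close> belongs to these
      events for all large \<open>k\<close>.\<close>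
    let ?f = "\<lambda>k \<omega>. ennreal ((J (r k) \<omega>)\<^sup>2) * indicator {\<omega>. sq_int T (S (r k)) \<omega> \<le> ennreal K} \<omega>"
    have "AE \<omega> in M. ennreal ((Q \<omega>)\<^sup>2) * indicator {\<omega>. 2 * ?N \<omega> < ennreal K} \<omega> \<le> liminf (\<lambda>k. ?f k \<omega>)"
      using AEa AEJ AE_space
    proof eventually_elim
      case (elim \<omega>)
      show ?case
      proof (cases "2 * ?N \<omega> < ennreal K")
        case True
        have "(\<lambda>k. 2 * ?N \<omega> + 2 * ?a (r k) \<omega>) \<longlonglongrightarrow> 2 * ?N \<omega> + 2 * 0"
          by (intro tendsto_add tendsto_const ennreal_tendsto_cmult elim) simp
        then have "eventually (\<lambda>k. 2 * ?N \<omega> + 2 * ?a (r k) \<omega> < ennreal K) sequentially"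
          using True by (intro order_tendstoD(2)) auto
        then have ev: "eventually (\<lambda>k. ennreal ((J (r k) \<omega>)\<^sup>2) = ?f k \<omega>) sequentially"
        proof (rule eventually_mono)
          fix k assume "2 * ?N \<omega> + 2 * ?a (r k) \<omega> < ennreal K"
          then have "sq_int T (S (r k)) \<omega> \<le> ennreal K"
            using le[OF elim(3), of "r k"] by (meson less_imp_le order.strict_trans1)
          then show "ennreal ((J (r k) \<omega>)\<^sup>2) = ?f k \<omega>" by simp
        qed
        have "(\<lambda>k. (J (r k) \<omega> - Q \<omega>)\<^sup>2) \<longlonglongrightarrow> 0"
          by (rule tendsto_ennrealD) (use elim(2) in auto)
        then have "(\<lambda>k. sqrt ((J (r k) \<omega> - Q \<omega>)\<^sup>2)) \<longlonglongrightarrow> sqrt 0" by (rule tendsto_real_sqrt)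
        then have "(\<lambda>k. J (r k) \<omega>) \<longlonglongrightarrow> Q \<omega>" by (simp add: LIM_zero_iff tendsto_rabs_zero_iff)
        then have "(\<lambda>k. ennreal ((J (r k) \<omega>)\<^sup>2)) \<longlonglongrightarrow> ennreal ((Q \<omega>)\<^sup>2)" by (intro tendsto_ennrealI tendsto_power)
        then have "(\<lambda>k. ?f k \<omega>) \<longlonglongrightarrow> ennreal ((Q \<omega>)\<^sup>2)" using ev tendsto_cong by fast
        then have "liminf (\<lambda>k. ?f k \<omega>) = ennreal ((Q \<omega>)\<^sup>2)" by (intro lim_imp_Liminf) auto
        then show ?thesis using True by simp
      qed simp
    qed
    then have "(\<integral>\<^sup>+\<omega>. ennreal ((Q \<omega>)\<^sup>2) * indicator {\<omega>. 2 * ?N \<omega> < ennreal K} \<omega> \<partial>M) \<le> (\<integral>\<^sup>+\<omega>. liminf (\<lambda>k. ?f k \<omega>) \<partial>M)"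
      by (rule nn_integral_mono_AE)
    also have "\<dots> \<le> liminf (\<lambda>k. \<integral>\<^sup>+\<omega>. ?f k \<omega> \<partial>M)"
      by (rule nn_integral_liminf) simp
    also have "\<dots> \<le> liminf (\<lambda>k. 2 * (\<integral>\<^sup>+\<omega>. ?N \<omega> \<partial>M) + ennreal K * (\<integral>\<^sup>+\<omega>. min 1 (?a (r k) \<omega>) \<partial>M))"
    proof (intro Liminf_mono always_eventually allI)
      fix k
      have "(\<integral>\<^sup>+\<omega>. ?f k \<omega> \<partial>M) \<le> (\<integral>\<^sup>+\<omega>. min (sq_int T (S (r k)) \<omega>) (ennreal K) \<partial>M)"
        using elementary_truncated(3)[OF el, of K] K2 by simp
      also have "\<dots> \<le> (\<integral>\<^sup>+\<omega>. 2 * ?N \<omega> + ennreal K * min 1 (?a (r k) \<omega>) \<partial>M)"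
      proof (rule nn_integral_mono)
        fix \<omega> assume w: "\<omega> \<in> space M"
        have "min (sq_int T (S (r k)) \<omega>) (ennreal K) \<le> min (2 * ?N \<omega> + 2 * ?a (r k) \<omega>) (ennreal K)"
          using le[OF w] by (rule min.mono) simp
        also have "\<dots> \<le> 2 * ?N \<omega> + min (ennreal K) (2 * ?a (r k) \<omega>)"
          by (cases "2 * ?a (r k) \<omega> \<le> ennreal K") (simp_all add: min.coboundedI1 min.coboundedI2 min_absorb1 min_absorb2 add_increasing)
        also have "\<dots> \<le> 2 * ?N \<omega> + ennreal K * min 1 (?a (r k) \<omega>)"
          using ennreal_leI[OF K2] by (intro add_left_mono min_cmult_le) simp
        finally show "min (sq_int T (S (r k)) \<omega>) (ennreal K) \<le> 2 * ?N \<omega> + ennreal K * min 1 (?a (r k) \<omega>)" .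
      qed
      also have "\<dots> = 2 * (\<integral>\<^sup>+\<omega>. ?N \<omega> \<partial>M) + ennreal K * (\<integral>\<^sup>+\<omega>. min 1 (?a (r k) \<omega>) \<partial>M)"
        by (simp add: nn_integral_add nn_integral_cmult)
      finally show "(\<integral>\<^sup>+\<omega>. ?f k \<omega> \<partial>M) \<le> 2 * (\<integral>\<^sup>+\<omega>. ?N \<omega> \<partial>M) + ennreal K * (\<integral>\<^sup>+\<omega>. min 1 (?a (r k) \<omega>) \<partial>M)" .
    qed
    also have "\<dots> = 2 * (\<integral>\<^sup>+\<omega>. ?N \<omega> \<partial>M) + ennreal K * 0"
      by (intro lim_imp_Liminf tendsto_add tendsto_const ennreal_tendsto_cmult
          tends_prob_subseq[OF SV r, unfolded tends_prob_def]) auto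
    finally show ?thesis by simp
  qed
  \<comment> \<open>The shift \<open>m + 2\<close> keeps the level at least 2, which is what allows
    the factor 2 in front of \<open>?a\<close> to be absorbed into \<open>K\<close>. As
    \<open>?N\<close> is finite almost surely, each level set is eventually entered.\<close>
  have "(\<integral>\<^sup>+\<omega>. ennreal ((Q \<omega>)\<^sup>2) \<partial>M) \<le> (\<integral>\<^sup>+\<omega>. liminf (\<lambda>m. ennreal ((Q \<omega>)\<^sup>2) * indicator {\<omega>. 2 * ?N \<omega> < ennreal (real (m + 2))} \<omega>) \<partial>M)"
  proof (rule nn_integral_mono_AE, use AEN in eventually_elim)
    case (elim \<omega>)
    obtain y where y: "2 * ?N \<omega> = ennreal y" "0 \<le> y"
      using elim by (cases "2 * ?N \<omega>") (auto simp: ennreal_mult_eq_top_iff)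
    have "eventually (\<lambda>m::nat. y < real m) sequentially"
      using filterlim_real_sequentially filterlim_at_top_dense by blast
    then have "eventually (\<lambda>m. ennreal ((Q \<omega>)\<^sup>2) * indicator {\<omega>. 2 * ?N \<omega> < ennreal (real (m + 2))} \<omega> = ennreal ((Q \<omega>)\<^sup>2)) sequentially"
    proof (rule eventually_mono)
      fix m :: nat assume "y < real m"
      then have "2 * ?N \<omega> < ennreal (real (m + 2))" unfolding y(1) using y(2) by (intro ennreal_lessI) auto
      then show "ennreal ((Q \<omega>)\<^sup>2) * indicator {\<omega>. 2 * ?N \<omega> < ennreal (real (m + 2))} \<omega> = ennreal ((Q \<omega>)\<^sup>2)"
        by (simp only: indicator_simps mem_Collect_eq simp_thms mult_1_right)
    qed
    then have "(\<lambda>m. ennreal ((Q \<omega>)\<^sup>2) * indicator {\<omega>. 2 * ?N \<omega> < ennreal (real (m + 2))} \<omega>) \<longlonglongrightarrow> ennreal ((Q \<omega>)\<^sup>2)"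
      by (rule tendsto_eventually)
    then show ?case by (simp add: lim_imp_Liminf)
  qed
  also have "\<dots> \<le> liminf (\<lambda>m. \<integral>\<^sup>+\<omega>. ennreal ((Q \<omega>)\<^sup>2) * indicator {\<omega>. 2 * ?N \<omega> < ennreal (real (m + 2))} \<omega> \<partial>M)"
    by (rule nn_integral_liminf) simp
  also have "\<dots> \<le> liminf (\<lambda>m::nat. 2 * (\<integral>\<^sup>+\<omega>. ?N \<omega> \<partial>M))"
    by (intro Liminf_mono always_eventually allI K) simp
  also have "\<dots> = 2 * (\<integral>\<^sup>+\<omega>. ?N \<omega> \<partial>M)" by (simp add: Liminf_const)
  finally show ?thesis .
qed

end

section \<open>Ito integrals\<close>

context brownian
begin

lemma ito_integral_joint_measurable:
  assumes "ito_integral M F B t H I" "0 \<le> t"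
  shows "joint_measurable M t H"
proof -
  have *: "(\<lambda>(u, \<omega>). H u \<omega>) \<in> borel_measurable (restrict_space borel {0..t} \<Otimes>\<^sub>M F t)"
    using assms unfolding ito_integral_def by auto
  have "(\<lambda>\<omega>. \<omega>) \<in> M \<rightarrow>\<^sub>M F t"
    using filtered_sub[OF filt] by (intro measurableI) auto
  then have "(\<lambda>x. (fst x, snd x)) \<in> restrict_space borel {0..t} \<Otimes>\<^sub>M M \<rightarrow>\<^sub>M restrict_space borel {0..t} \<Otimes>\<^sub>M F t"
    by (intro measurable_Pair measurable_fst measurable_compose[OF measurable_snd])
  from measurable_compose[OF this *] show ?thesis by (simp add: case_prod_beta')
qed

lemma ito_integral_approx:
  assumes "ito_integral M F B t H I" "0 \<le> t"
  shows "\<exists>S J. (\<forall>k::nat. elementary_integral M F B t (S k) (J k)) \<and>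
    tends_prob (\<lambda>k. sq_int t (\<lambda>u \<omega>. S k u \<omega> - H u \<omega>)) \<and>
    tends_prob (\<lambda>k \<omega>. ennreal ((J k \<omega> - I \<omega>)\<^sup>2))"
proof -
  obtain S J where el: "\<And>k::nat. elementary_integral M F B t (S k) (J k)"
    and S: "\<And>\<epsilon>. 0 < \<epsilon> \<Longrightarrow> (\<lambda>k. measure M {\<omega> \<in> space M. ennreal \<epsilon> < sq_int t (\<lambda>u \<omega>. S k u \<omega> - H u \<omega>) \<omega>}) \<longlonglongrightarrow> 0"
    and J: "\<And>\<epsilon>. 0 < \<epsilon> \<Longrightarrow> (\<lambda>k. measure M {\<omega> \<in> space M. \<epsilon> < \<bar>J k \<omega> - I \<omega>\<bar>}) \<longlonglongrightarrow> 0"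
    and [measurable]: "I \<in> borel_measurable M"
    using assms(1) unfolding ito_integral_def sq_int_def by blast
  have [measurable]: "J k \<in> borel_measurable M" for k
    using elementary_truncated(1)[OF el, of 1] by simp
  have [measurable]: "sq_int t (\<lambda>u \<omega>. S k u \<omega> - H u \<omega>) \<in> borel_measurable M" for k
    by (intro joint_measurable_sq_int joint_measurable_diff elementary_joint_measurable[OF el]
        ito_integral_joint_measurable[OF assms])
  have "tends_prob (\<lambda>k. sq_int t (\<lambda>u \<omega>. S k u \<omega> - H u \<omega>))" by (rule tends_probI) (use S in auto)
  moreover have "tends_prob (\<lambda>k \<omega>. ennreal ((J k \<omega> - I \<omega>)\<^sup>2))" by (rule tends_prob_squareI) (use J in auto)
  ultimately show ?thesis using el by blast
qed

text \<open>In the definition of the Ito integral the approximations for different upper limits are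
  unrelated; this lemma lets those for \<open>T\<close> serve for all \<open>t \<le> T\<close>.\<close>

lemma ito_integral_stopped:
  assumes I: "ito_integral M F B t H I" "0 \<le> t" "t \<le> T"
    and el: "\<And>k::nat. elementary_integral M F B T (S k) (J k)"
    and SH: "tends_prob (\<lambda>k. sq_int T (\<lambda>u \<omega>. S k u \<omega> - H u \<omega>))"
    and H: "joint_measurable M T H"
    and Js: "\<And>k. elementary_integral M F B t (\<lambda>u \<omega>. S k u \<omega> * indicator {0<..t} u) (Js k)"
  shows "tends_prob (\<lambda>k \<omega>. ennreal ((Js k \<omega> - I \<omega>)\<^sup>2))"
proof -
  obtain S' J' where el': "\<And>k::nat. elementary_integral M F B t (S' k) (J' k)"
    and S'H: "tends_prob (\<lambda>k. sq_int t (\<lambda>u \<omega>. S' k u \<omega> - H u \<omega>))"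
    and J'I: "tends_prob (\<lambda>k \<omega>. ennreal ((J' k \<omega> - I \<omega>)\<^sup>2))"
    using ito_integral_approx[OF I(1,2)] by blast
  have [measurable]: "I \<in> borel_measurable M" using I(1) unfolding ito_integral_def by simp
  have [measurable]: "J' k \<in> borel_measurable M" "Js k \<in> borel_measurable M" for k
    using elementary_truncated(1)[OF el', of 1] elementary_truncated(1)[OF Js, of 1] by simp_all
  have elD: "elementary_integral M F B t (\<lambda>u \<omega>. S k u \<omega> * indicator {0<..t} u + - S' k u \<omega>) (\<lambda>\<omega>. Js k \<omega> + - J' k \<omega>)" for k
    by (intro elementary_add elementary_uminus Js el')
  have jm: "joint_measurable M T (\<lambda>u \<omega>. S k u \<omega> - H u \<omega>)" "joint_measurable M t (\<lambda>u \<omega>. S k u \<omega> - H u \<omega>)"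
    "joint_measurable M t (\<lambda>u \<omega>. H u \<omega> - S' k u \<omega>)" "joint_measurable M t (\<lambda>u \<omega>. S' k u \<omega> - H u \<omega>)" for k
    using joint_measurable_mono[OF H I(3)] H
    by (auto intro!: joint_measurable_diff elementary_joint_measurable[OF el] elementary_joint_measurable[OF el'])
  note [measurable] = joint_measurable_sq_int[OF jm(1)] joint_measurable_sq_int[OF jm(4)]
  have "tends_prob (\<lambda>k. sq_int t (\<lambda>u \<omega>. S k u \<omega> * indicator {0<..t} u + - S' k u \<omega>))"
  proof (rule tends_prob_mono)
    show "tends_prob (\<lambda>k \<omega>. ennreal 2 * sq_int T (\<lambda>u \<omega>. S k u \<omega> - H u \<omega>) \<omega> + ennreal 2 * sq_int t (\<lambda>u \<omega>. S' k u \<omega> - H u \<omega>) \<omega>)"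
      by (intro tends_prob_add tends_prob_cmult SH S'H) auto
    fix k \<omega> assume w: "\<omega> \<in> space M"
    have "sq_int t (\<lambda>u \<omega>. S k u \<omega> * indicator {0<..t} u + - S' k u \<omega>) \<omega> \<le>
      2 * sq_int t (\<lambda>u \<omega>. S k u \<omega> - H u \<omega>) \<omega> + 2 * sq_int t (\<lambda>u \<omega>. H u \<omega> - S' k u \<omega>) \<omega>"
    proof (rule sq_int_add_le[OF jm(2,3) w])
      fix u assume "u \<in> {0..t}"
      then show "S k u \<omega> * indicator {0<..t} u + - S' k u \<omega> = S k u \<omega> - H u \<omega> + (H u \<omega> - S' k u \<omega>)"
        using elementary_at_0[OF el] by (cases "u = 0") auto
    qed
    also have "sq_int t (\<lambda>u \<omega>. S k u \<omega> - H u \<omega>) \<omega> \<le> sq_int T (\<lambda>u \<omega>. S k u \<omega> - H u \<omega>) \<omega>"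
      unfolding sq_int_def using I(3) by (intro nn_integral_mono) (auto split: split_indicator)
    also have "sq_int t (\<lambda>u \<omega>. H u \<omega> - S' k u \<omega>) \<omega> = sq_int t (\<lambda>u \<omega>. S' k u \<omega> - H u \<omega>) \<omega>"
      unfolding sq_int_def by (simp add: power2_commute)
    finally show "sq_int t (\<lambda>u \<omega>. S k u \<omega> * indicator {0<..t} u + - S' k u \<omega>) \<omega> \<le>
      ennreal 2 * sq_int T (\<lambda>u \<omega>. S k u \<omega> - H u \<omega>) \<omega> + ennreal 2 * sq_int t (\<lambda>u \<omega>. S' k u \<omega> - H u \<omega>) \<omega>"
      by (simp add: mult_left_mono add_right_mono)
  qed
  from tends_prob_elementary[OF elD this]
  have "tends_prob (\<lambda>k \<omega>. ennreal ((Js k \<omega> + - J' k \<omega>)\<^sup>2))" .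
  from tends_prob_square_add[OF _ _ this J'I] show ?thesis by simp
qed

text \<open>The sum is itself a stochastic integral, with integrand
  \<open>c i * (H - \<xi> i)\<close> on cell \<open>i\<close>. Elementary approximations of
  \<open>H\<close>, cut to the cells and weighted by \<open>c i\<close>, stay elementary because
  \<open>c i\<close> is bounded and known at \<open>p i\<close>; subtracting \<open>\<xi> i\<close>
  subtracts another elementary integrand. \<open>L2_bound_limit\<close> then applies to this
  approximating sequence.\<close>

lemma ito_increment_L2:
  assumes p: "0 \<le> p 0" "\<And>i. i < n \<Longrightarrow> p i \<le> p (Suc i)"
    and I: "\<And>i. i \<le> n \<Longrightarrow> ito_integral M F B (p i) H (I i)"
    and c: "\<And>i. i < n \<Longrightarrow> c i \<in> borel_measurable (F (p i))" "\<And>i \<omega>. i < n \<Longrightarrow> \<omega> \<in> space M \<Longrightarrow> \<bar>c i \<omega>\<bar> \<le> C"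
    and \<xi>: "\<And>i. i < n \<Longrightarrow> \<xi> i \<in> borel_measurable (F (p i))" "\<And>i \<omega>. i < n \<Longrightarrow> \<omega> \<in> space M \<Longrightarrow> \<bar>\<xi> i \<omega>\<bar> \<le> D"
  shows "(\<integral>\<^sup>+\<omega>. ennreal ((\<Sum>i<n. c i \<omega> * (I (Suc i) \<omega> - I i \<omega> - \<xi> i \<omega> * (B (p (Suc i)) \<omega> - B (p i) \<omega>)))\<^sup>2) \<partial>M) \<le>
    2 * (\<integral>\<^sup>+\<omega>. sq_int (p n) (\<lambda>u \<omega>. \<Sum>i<n. c i \<omega> * (H u \<omega> - \<xi> i \<omega>) * indicator {p i<..p (Suc i)} u) \<omega> \<partial>M)"
proof -
  define T where "T = p n"
  have mono: "p i \<le> p j" if "i \<le> j" "j \<le> n" for i j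
    using mono_upto[of n p i j] p(2) that by simp
  have pT: "0 \<le> p i" "p i \<le> T" if "i \<le> n" for i
    using mono[of 0 i] mono[of i n] p(1) that unfolding T_def by auto
  have T0: "0 \<le> T" using pT[of 0] by simp
  have IT: "ito_integral M F B T H (I n)" using I[of n] unfolding T_def by simp
  have H: "joint_measurable M T H" by (rule ito_integral_joint_measurable[OF IT T0])
  obtain S J where el: "\<And>k::nat. elementary_integral M F B T (S k) (J k)"
    and SH: "tends_prob (\<lambda>k. sq_int T (\<lambda>u \<omega>. S k u \<omega> - H u \<omega>))"
    using ito_integral_approx[OF IT T0] by blast
  \<comment> \<open>\<open>P\<close> packs the properties of a stopped version so that one can be
    chosen for all \<open>k\<close> simultaneously.\<close>
  define P where "P k Js \<longleftrightarrow> Js 0 = (\<lambda>_. 0) \<and> (\<forall>s t (c::'a\<Rightarrow>real) C. 0 \<le> s \<longrightarrow> s \<le> t \<longrightarrow> c \<in> borel_measurable (F s) \<longrightarrow>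
      (\<forall>\<omega>\<in>space M. \<bar>c \<omega>\<bar> \<le> C) \<longrightarrow>
      elementary_integral M F B t (\<lambda>u \<omega>. c \<omega> * (S k u \<omega> * indicator {s<..t} u)) (\<lambda>\<omega>. c \<omega> * (Js t \<omega> - Js s \<omega>)))" for k Js
  have "\<exists>Js. P k Js" for k
  proof (rule elementary_stopped[OF el[of k]])
    fix Js assume "Js 0 = (\<lambda>_. 0)" and *: "\<And>s t (c::'a\<Rightarrow>real) C. 0 \<le> s \<Longrightarrow> s \<le> t \<Longrightarrow> c \<in> borel_measurable (F s) \<Longrightarrow>
      (\<And>\<omega>. \<omega> \<in> space M \<Longrightarrow> \<bar>c \<omega>\<bar> \<le> C) \<Longrightarrow>
      elementary_integral M F B t (\<lambda>u \<omega>. c \<omega> * (S k u \<omega> * indicator {s<..t} u)) (\<lambda>\<omega>. c \<omega> * (Js t \<omega> - Js s \<omega>))"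
    then show ?thesis unfolding P_def by (intro exI[of _ Js] conjI allI impI) (assumption, rule *, auto)
  qed
  then obtain Js where "\<And>k. P k (Js k)" using choice[of P] by blast
  then have Js0: "Js k 0 = (\<lambda>_. 0)" and Js: "0 \<le> s \<Longrightarrow> s \<le> t \<Longrightarrow> c \<in> borel_measurable (F s) \<Longrightarrow>
      (\<And>\<omega>. \<omega> \<in> space M \<Longrightarrow> \<bar>c \<omega>\<bar> \<le> C) \<Longrightarrow>
      elementary_integral M F B t (\<lambda>u \<omega>. c \<omega> * (S k u \<omega> * indicator {s<..t} u)) (\<lambda>\<omega>. c \<omega> * (Js k t \<omega> - Js k s \<omega>))"
    for k s t C and c :: "'a \<Rightarrow> real"
    unfolding P_def by blast+
  have Js1: "elementary_integral M F B t (\<lambda>u \<omega>. S k u \<omega> * indicator {0<..t} u) (Js k t)" if "0 \<le> t" for k t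
    using Js[of 0 t "\<lambda>_. 1" 1 k] that Js0 by auto
  have JsM [measurable]: "Js k t \<in> borel_measurable M" if "0 \<le> t" for k t
    using elementary_truncated(1)[OF Js1[OF that], of 1] by simp
  have IM [measurable]: "I i \<in> borel_measurable M" if "i \<le> n" for i
    using I[OF that] unfolding ito_integral_def by simp
  have cM [measurable]: "c i \<in> borel_measurable M" "\<xi> i \<in> borel_measurable M" if "i < n" for i
    using c(1) \<xi>(1) measurable_F_M that by blast+
  have BM [measurable]: "B (p i) \<in> borel_measurable M" if "i \<le> n" for i
    using pT[OF that] by simp
  have JI: "tends_prob (\<lambda>k \<omega>. ennreal ((Js k (p i) \<omega> - I i \<omega>)\<^sup>2))" if "i \<le> n" for i
    by (rule ito_integral_stopped[OF I[OF that] pT[OF that] el SH H Js1[OF pT(1)[OF that]]])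
  have cx: "(\<lambda>\<omega>. c i \<omega> * \<xi> i \<omega>) \<in> borel_measurable (F (p i))" "\<omega> \<in> space M \<Longrightarrow> \<bar>c i \<omega> * \<xi> i \<omega>\<bar> \<le> C * D" if "i < n" for i \<omega>
  proof -
    show "(\<lambda>\<omega>. c i \<omega> * \<xi> i \<omega>) \<in> borel_measurable (F (p i))" using c(1) \<xi>(1) that by simp
    assume w: "\<omega> \<in> space M"
    show "\<bar>c i \<omega> * \<xi> i \<omega>\<bar> \<le> C * D"
      using mult_mono[OF c(2)[OF that w] \<xi>(2)[OF that w]] c(2)[OF that w] by (simp add: abs_mult)
  qed
  let ?Q = "\<lambda>\<omega>. \<Sum>i<n. c i \<omega> * (I (Suc i) \<omega> - I i \<omega> - \<xi> i \<omega> * (B (p (Suc i)) \<omega> - B (p i) \<omega>))"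
  let ?V = "\<lambda>u \<omega>. \<Sum>i<n. c i \<omega> * (H u \<omega> - \<xi> i \<omega>) * indicator {p i<..p (Suc i)} u"
  let ?Qk = "\<lambda>k \<omega>. \<Sum>i<n. c i \<omega> * (Js k (p (Suc i)) \<omega> - Js k (p i) \<omega>) + - (c i \<omega> * \<xi> i \<omega> * (B (p (Suc i)) \<omega> - B (p i) \<omega>))"
  let ?Vk = "\<lambda>k u \<omega>. \<Sum>i<n. c i \<omega> * (S k u \<omega> * indicator {p i<..p (Suc i)} u) + - (c i \<omega> * \<xi> i \<omega> * indicator {p i<..p (Suc i)} u)"
  let ?E = "\<lambda>k u \<omega>. \<Sum>i<n. (c i \<omega> * (S k u \<omega> - H u \<omega>)) * indicator {p i<..p (Suc i)} u"
  have elk: "elementary_integral M F B T (?Vk k) (?Qk k)" for k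
  proof (rule elementary_sum[OF T0])
    fix i assume i: "i < n"
    have "elementary_integral M F B T (\<lambda>u \<omega>. c i \<omega> * (S k u \<omega> * indicator {p i<..p (Suc i)} u)) (\<lambda>\<omega>. c i \<omega> * (Js k (p (Suc i)) \<omega> - Js k (p i) \<omega>))"
      by (rule elementary_integral_mono[of _ _ _ "p (Suc i)"])
        (use Js[of "p i" "p (Suc i)" "c i" C k] i pT[of i] p(2)[OF i] c[OF i] pT[of "Suc i"] in auto)
    moreover have "elementary_integral M F B T (\<lambda>u \<omega>. - (c i \<omega> * \<xi> i \<omega> * indicator {p i<..p (Suc i)} u)) (\<lambda>\<omega>. - (c i \<omega> * \<xi> i \<omega> * (B (p (Suc i)) \<omega> - B (p i) \<omega>)))"
      by (intro elementary_uminus elementary_const[where C="C * D"]) (use cx[OF i] p(2)[OF i] pT[of i] pT[of "Suc i"] i in auto)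
    ultimately show "elementary_integral M F B T (\<lambda>u \<omega>. c i \<omega> * (S k u \<omega> * indicator {p i<..p (Suc i)} u) + - (c i \<omega> * \<xi> i \<omega> * indicator {p i<..p (Suc i)} u))
      (\<lambda>\<omega>. c i \<omega> * (Js k (p (Suc i)) \<omega> - Js k (p i) \<omega>) + - (c i \<omega> * \<xi> i \<omega> * (B (p (Suc i)) \<omega> - B (p i) \<omega>)))"
      by (rule elementary_add)
  qed
  have V: "joint_measurable M T ?V"
    by (intro joint_measurable_sum joint_measurable_mult joint_measurable_diff H joint_measurable_snd cM joint_measurable_fst) auto
  have QM: "?Q \<in> borel_measurable M"
    by (intro borel_measurable_sum borel_measurable_times borel_measurable_diff IM BM cM) auto
  have jm: "joint_measurable M T (\<lambda>u \<omega>. S k u \<omega> - H u \<omega>)" for k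
    by (intro joint_measurable_diff elementary_joint_measurable[OF el] H)
  \<comment> \<open>Both integrands are step sums over the same cells. The terms with
    \<open>\<xi>\<close> cancel, and \<open>c i * (S k - H)\<close> remains on cell
    \<open>i\<close>.\<close>
  have VV: "tends_prob (\<lambda>k. sq_int T (\<lambda>u \<omega>. ?Vk k u \<omega> - ?V u \<omega>))"
  proof (rule tends_prob_mono)
    show "tends_prob (\<lambda>k \<omega>. ennreal (C\<^sup>2) * sq_int T (\<lambda>u \<omega>. S k u \<omega> - H u \<omega>) \<omega>)"
      by (intro tends_prob_cmult SH joint_measurable_sq_int jm)
    fix k \<omega> assume w: "\<omega> \<in> space M"
    have "sq_int T (\<lambda>u \<omega>. ?Vk k u \<omega> - ?V u \<omega>) \<omega> \<le> ennreal (\<bar>C\<bar>\<^sup>2) * sq_int T (\<lambda>u \<omega>. S k u \<omega> - H u \<omega>) \<omega>"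
    proof (rule sq_int_cmult_le[OF jm w])
      fix u
      have eq: "?Vk k u \<omega> - ?V u \<omega> = ?E k u \<omega>"
        unfolding sum_subtractf[symmetric] by (intro sum.cong refl) (simp add: algebra_simps)
      show "\<bar>?Vk k u \<omega> - ?V u \<omega>\<bar> \<le> \<bar>C\<bar> * \<bar>S k u \<omega> - H u \<omega>\<bar>"
        unfolding eq
      proof (rule step_cases[where ts=p and u=u and n=n])
        fix i assume i: "i < n" and e: "\<And>g::nat\<Rightarrow>real. (\<Sum>j<n. g j * indicator {p j<..p (Suc j)} u) = g i"
        show "\<bar>?E k u \<omega>\<bar> \<le> \<bar>C\<bar> * \<bar>S k u \<omega> - H u \<omega>\<bar>"
          unfolding e abs_mult by (rule mult_right_mono) (use c(2)[OF i w] in auto)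
      next
        assume e: "\<And>g::nat\<Rightarrow>real. (\<Sum>j<n. g j * indicator {p j<..p (Suc j)} u) = 0"
        show "\<bar>?E k u \<omega>\<bar> \<le> \<bar>C\<bar> * \<bar>S k u \<omega> - H u \<omega>\<bar>"
          unfolding e by simp
      qed (use p(2) in auto)
    qed
    then show "sq_int T (\<lambda>u \<omega>. ?Vk k u \<omega> - ?V u \<omega>) \<omega> \<le> ennreal (C\<^sup>2) * sq_int T (\<lambda>u \<omega>. S k u \<omega> - H u \<omega>) \<omega>"
      by (simp only: power2_abs)
  qed
  have "tends_prob (\<lambda>k \<omega>. ennreal ((\<Sum>i<n. c i \<omega> * ((Js k (p (Suc i)) \<omega> - I (Suc i) \<omega>) + (I i \<omega> - Js k (p i) \<omega>)))\<^sup>2))"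
  proof (intro tends_prob_square_sum tends_prob_square_mult[where C=C] tends_prob_square_add)
    fix i assume i: "i < n"
    show "tends_prob (\<lambda>k \<omega>. ennreal (((I i \<omega> - Js k (p i) \<omega>))\<^sup>2))"
      using JI[of i] i by (simp add: power2_commute)
    show "tends_prob (\<lambda>k \<omega>. ennreal ((Js k (p (Suc i)) \<omega> - I (Suc i) \<omega>)\<^sup>2))"
      using JI[of "Suc i"] i by simp
  qed (use c cM IM JsM pT in auto)
  moreover have "(\<Sum>i<n. c i \<omega> * ((Js k (p (Suc i)) \<omega> - I (Suc i) \<omega>) + (I i \<omega> - Js k (p i) \<omega>))) = ?Qk k \<omega> - ?Q \<omega>" for k \<omega>
    unfolding sum_subtractf[symmetric] by (intro sum.cong refl) (simp add: algebra_simps)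
  ultimately have "tends_prob (\<lambda>k \<omega>. ennreal ((?Qk k \<omega> - ?Q \<omega>)\<^sup>2))" by simp
  from L2_bound_limit[OF elk V QM VV this] show ?thesis unfolding T_def .
qed

end

section \<open>Convergence of the sums over equidistant partitions\<close>

lemma sum_step_sq_int:
  fixes p :: "nat \<Rightarrow> real" and V :: "nat \<Rightarrow> real \<Rightarrow> 'a \<Rightarrow> real"
  assumes p: "\<And>i. i < n \<Longrightarrow> p i \<le> p (Suc i)"
    and V: "\<And>i. i < n \<Longrightarrow> joint_measurable M T (V i)" and \<omega>: "\<omega> \<in> space M"
  shows "(\<Sum>i<n. sq_int T (\<lambda>u \<omega>. V i u \<omega> * indicator {p i<..p (Suc i)} u) \<omega>) =
    sq_int T (\<lambda>u \<omega>. \<Sum>i<n. V i u \<omega> * indicator {p i<..p (Suc i)} u) \<omega>"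
proof -
  have m: "(\<lambda>u. V i u \<omega> * indicator {p i<..p (Suc i)} u) \<in> borel_measurable (restrict_space lborel {0..T})" if "i < n" for i
    by (rule joint_measurable_path[where M=M and T=T and V="\<lambda>u \<omega>. V i u \<omega> * indicator {p i<..p (Suc i)} u", OF _ \<omega>])
      (intro joint_measurable_mult V that joint_measurable_fst, simp)
  have "ennreal ((\<Sum>i<n. V i u \<omega> * indicator {p i<..p (Suc i)} u)\<^sup>2) =
    (\<Sum>i<n. ennreal ((V i u \<omega> * indicator {p i<..p (Suc i)} u)\<^sup>2))" for u
  proof -
    have "(\<Sum>i<n. ennreal ((V i u \<omega> * indicator {p i<..p (Suc i)} u)\<^sup>2)) =
      ennreal (\<Sum>i<n. (V i u \<omega> * indicator {p i<..p (Suc i)} u)\<^sup>2)"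
      by (rule sum_ennreal) simp
    also have "(\<Sum>i<n. (V i u \<omega> * indicator {p i<..p (Suc i)} u)\<^sup>2) = (\<Sum>i<n. (V i u \<omega>)\<^sup>2 * indicator {p i<..p (Suc i)} u)"
      by (intro sum.cong refl) (simp add: power_mult_distrib split: split_indicator)
    finally show ?thesis using sum_step_square[of n p "\<lambda>i. V i u \<omega>" u] p by simp
  qed
  then show ?thesis
    unfolding sq_int_restrict using m by (subst nn_integral_sum[symmetric]) auto
qed

lemma sq_int_le_const:
  assumes "\<And>u. u \<in> {0..T} \<Longrightarrow> \<bar>V u \<omega>\<bar> \<le> C" "0 \<le> T" "0 \<le> C"
  shows "sq_int T V \<omega> \<le> ennreal (C\<^sup>2 * T)"
proof -
  have "sq_int T V \<omega> \<le> (\<integral>\<^sup>+u. ennreal (C\<^sup>2) * indicator {0..T} u \<partial>lborel)"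
    unfolding sq_int_def using assms(1) power_mono[of "\<bar>V _ \<omega>\<bar>" C 2] 
    by (intro nn_integral_mono) (auto split: split_indicator intro!: ennreal_leI)
  also have "\<dots> = ennreal (C\<^sup>2 * T)" using assms(2) by (simp add: nn_integral_cmult_indicator ennreal_mult)
  finally show ?thesis .
qed

context brownian
begin

lemma tends_prob_L2:
  assumes "\<And>k. (\<integral>\<^sup>+\<omega>. N k \<omega> \<partial>M) \<le> g k" "g \<longlonglongrightarrow> 0"
  shows "tends_prob N"
  unfolding tends_prob_def
proof (rule tendsto_sandwich[OF _ _ tendsto_const assms(2)])
  have "(\<integral>\<^sup>+\<omega>. min 1 (N k \<omega>) \<partial>M) \<le> (\<integral>\<^sup>+\<omega>. N k \<omega> \<partial>M)" for k
    by (intro nn_integral_mono) simp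
  then show "\<forall>\<^sub>F k in sequentially. (\<integral>\<^sup>+\<omega>. min 1 (N k \<omega>) \<partial>M) \<le> g k"
    by (intro always_eventually allI) (blast intro: order.trans assms(1))
qed simp

text \<open>The variables \<open>(\<Delta>B)^2 - h\<close> are centred with second moment
  \<open>3 h^2 - 2 h^2 + h^2 = 2 h^2\<close>, so the isometry bounds the sum of \<open>n + 1\<close>
  weighted ones by \<open>C^2 * 2 h^2 * (n + 1)\<close> with \<open>h = T / (n + 1)\<close>.
  Counting cells by \<open>Suc n\<close> avoids a division by zero.\<close>

lemma quadratic_variation_L2:
  assumes T: "0 < T" and c: "\<And>i. i < Suc n \<Longrightarrow> c i \<in> borel_measurable (F (T * real i / real (Suc n)))"
    "\<And>i \<omega>. i < Suc n \<Longrightarrow> \<omega> \<in> space M \<Longrightarrow> \<bar>c i \<omega>\<bar> \<le> C"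
  shows "(\<integral>\<^sup>+\<omega>. ennreal ((\<Sum>i<Suc n. c i \<omega> *
     ((B (T * real (Suc i) / real (Suc n)) \<omega> - B (T * real i / real (Suc n)) \<omega>)\<^sup>2 - T / real (Suc n)))\<^sup>2) \<partial>M)
    \<le> ennreal (2 * C\<^sup>2 * T\<^sup>2 / real (Suc n))"
proof -
  define h p where "h = T / real (Suc n)" and "p i = T * real i / real (Suc n)" for i
  have p: "0 \<le> p i" "p i \<le> p (Suc i)" "p (Suc i) - p i = h" for i
    using T by (auto simp: p_def h_def divide_right_mono diff_divide_distrib[symmetric] algebra_simps)
  let ?d = "\<lambda>i \<omega>. (B (p (Suc i)) \<omega> - B (p i) \<omega>)\<^sup>2 - h"
  have eq: "(?d i \<omega>)\<^sup>2 = (B (p (Suc i)) \<omega> - B (p i) \<omega>) ^ 4 - 2 * h * (B (p (Suc i)) \<omega> - B (p i) \<omega>)\<^sup>2 + h\<^sup>2" for i \<omega>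
  proof -
    have "(z\<^sup>2 - h)\<^sup>2 = z ^ 4 - 2 * h * z\<^sup>2 + h\<^sup>2" for z by (simp add: power2_diff power_mult[symmetric])
    then show ?thesis .
  qed
  note inc = increment_power(1)[OF p(1,2)] increment_moments[OF p(1,2), unfolded p(3)]
  have d2: "integrable M (\<lambda>\<omega>. (?d i \<omega>)\<^sup>2)" "expectation (\<lambda>\<omega>. (?d i \<omega>)\<^sup>2) = 2 * h\<^sup>2" for i
    unfolding eq using inc(1)[of i 4] inc(1)[of i 2] inc(3,4)[of i] by (simp_all add: prob_space power2_eq_square)
  have d0: "expectation (?d i) = 0" for i
    using inc(1)[of i 2] inc(3)[of i] by (simp add: prob_space)
  note sq = sum_increments_square[of p "Suc n" c "\<lambda>_. C" "\<lambda>_ x. x\<^sup>2 - h"]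
  have 1: "integrable M (\<lambda>\<omega>. (\<Sum>i<Suc n. c i \<omega> * ?d i \<omega>)\<^sup>2)"
    and 2: "expectation (\<lambda>\<omega>. (\<Sum>i<Suc n. c i \<omega> * ?d i \<omega>)\<^sup>2) =
      (\<Sum>i<Suc n. expectation (\<lambda>\<omega>. (c i \<omega>)\<^sup>2) * expectation (\<lambda>\<omega>. (?d i \<omega>)\<^sup>2))"
    by (rule sq; use p c d2 d0 in \<open>auto simp: p_def\<close>)+
  have c2: "expectation (\<lambda>\<omega>. (c i \<omega>)\<^sup>2) \<le> C\<^sup>2" if "i < Suc n" for i
  proof -
    have "expectation (\<lambda>\<omega>. (c i \<omega>)\<^sup>2) \<le> expectation (\<lambda>\<omega>. C\<^sup>2)"
    proof (rule integral_mono_AE')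
      show "AE \<omega> in M. (c i \<omega>)\<^sup>2 \<le> C\<^sup>2"
        using power_mono[OF c(2)[OF that], of _ 2] by (auto intro!: AE_I2)
    qed auto
    then show ?thesis by (simp add: prob_space)
  qed
  have "(\<integral>\<^sup>+\<omega>. ennreal ((\<Sum>i<Suc n. c i \<omega> * ?d i \<omega>)\<^sup>2) \<partial>M) = ennreal (expectation (\<lambda>\<omega>. (\<Sum>i<Suc n. c i \<omega> * ?d i \<omega>)\<^sup>2))"
    by (rule nn_integral_eq_integral[OF 1]) simp
  also have "\<dots> \<le> ennreal (\<Sum>i<Suc n. C\<^sup>2 * (2 * h\<^sup>2))"
    unfolding 2 d2(2) using c2 by (intro ennreal_leI sum_mono mult_right_mono) auto
  also have "(\<Sum>i<Suc n. C\<^sup>2 * (2 * h\<^sup>2)) = 2 * C\<^sup>2 * T\<^sup>2 / real (Suc n)"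
    by (simp add: h_def power2_eq_square field_simps del: of_nat_Suc)
  finally show ?thesis unfolding p_def h_def .
qed

text \<open>\<open>Q\<close> is the error of freezing the integrand at the left end of a cell, and
  the weight \<open>\<theta>\<close> localises. Both sums containing \<open>Q\<close> are controlled
  by one quantity \<open>gap n\<close>, the expected squared distance between \<open>H\<close> and
  its left-endpoint step approximation on the surviving cells; the other two sums are quadratic
  variation.\<close>

lemma ito_sums_converge:
  fixes H I :: "real \<Rightarrow> 'a \<Rightarrow> real" and T C :: real and c e \<theta> :: "nat \<Rightarrow> nat \<Rightarrow> 'a \<Rightarrow> real"
  defines "p \<equiv> \<lambda>n i. T * real i / real (Suc n)"
  defines "\<beta> \<equiv> \<lambda>n i \<omega>. B (p n (Suc i)) \<omega> - B (p n i) \<omega>"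
  defines "Q \<equiv> \<lambda>n i \<omega>. I (p n (Suc i)) \<omega> - I (p n i) \<omega> - H (p n i) \<omega> * \<beta> n i \<omega>"
  assumes T: "0 < T" and I: "\<And>t. 0 \<le> t \<Longrightarrow> ito_integral M F B t H (I t)"
    and HF: "\<And>t. 0 \<le> t \<Longrightarrow> H t \<in> borel_measurable (F t)"
    and H2: "(\<integral>\<^sup>+\<omega>. sq_int T H \<omega> \<partial>M) < \<infinity>"
    and Hc: "\<And>\<omega>. \<omega> \<in> space M \<Longrightarrow> continuous_on {0..T} (\<lambda>u. H u \<omega>)"
    and \<theta>: "\<And>n i. \<theta> n i \<in> borel_measurable (F (p n i))" "\<And>n i \<omega>. \<theta> n i \<omega> \<in> {0, 1}"
      "\<And>n i \<omega>. \<omega> \<in> space M \<Longrightarrow> \<bar>\<theta> n i \<omega> * H (p n i) \<omega>\<bar> \<le> C"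
    and c: "\<And>n i. c n i \<in> borel_measurable (F (p n i))" "\<And>n i \<omega>. \<omega> \<in> space M \<Longrightarrow> \<bar>c n i \<omega>\<bar> \<le> C"
    and e: "\<And>n i. e n i \<in> borel_measurable (F (p n i))" "\<And>n i \<omega>. \<omega> \<in> space M \<Longrightarrow> \<bar>e n i \<omega>\<bar> \<le> C"
  shows "\<exists>r. strict_mono r \<and> (AE \<omega> in M.
    (\<lambda>k. \<Sum>i<Suc (r k). c (r k) i \<omega> * (\<theta> (r k) i \<omega> * Q (r k) i \<omega>)) \<longlonglongrightarrow> 0 \<and>
    (\<lambda>k. \<Sum>i<Suc (r k). (\<theta> (r k) i \<omega> * Q (r k) i \<omega>)\<^sup>2) \<longlonglongrightarrow> 0 \<and>
    (\<lambda>k. \<Sum>i<Suc (r k). e (r k) i \<omega> * ((\<beta> (r k) i \<omega>)\<^sup>2 - T / real (Suc (r k)))) \<longlonglongrightarrow> 0 \<and>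
    (\<lambda>k. \<Sum>i<Suc (r k). (\<beta> (r k) i \<omega>)\<^sup>2) \<longlonglongrightarrow> T)"
proof -
  obtain \<omega>0 where "\<omega>0 \<in> space M" using not_empty by blast
  then have C0: "0 \<le> C" using c(2)[of \<omega>0 0 0] by simp
  have p0: "0 \<le> p n i" "p n i \<le> p n (Suc i)" for n i
    using T unfolding p_def by (auto intro!: divide_right_mono)
  have pT: "p n (Suc n) = T" for n unfolding p_def by simp
  have pmono: "p n i \<le> p n j" if "i \<le> j" for n i j
    using T that unfolding p_def by (intro divide_right_mono mult_left_mono) auto
  have H: "joint_measurable M T H" using ito_integral_joint_measurable[OF I] T by simp
  have \<xi>F: "(\<lambda>\<omega>. \<theta> n i \<omega> * H (p n i) \<omega>) \<in> borel_measurable (F (p n i))" for n i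
    using \<theta>(1) HF[OF p0(1)] by simp
  have c\<theta>F: "(\<lambda>\<omega>. c n i \<omega> * \<theta> n i \<omega>) \<in> borel_measurable (F (p n i))" for n i
    using \<theta>(1) c(1) by simp
  have \<theta>1: "\<bar>\<theta> n i \<omega>\<bar> \<le> 1" "\<theta> n i \<omega> * (\<theta> n i \<omega> * z) = \<theta> n i \<omega> * z" for n i \<omega> z using \<theta>(2)[of n i \<omega>] by auto
  have [measurable]: "\<theta> n i \<in> borel_measurable M" "c n i \<in> borel_measurable M" "e n i \<in> borel_measurable M"
    "H (p n i) \<in> borel_measurable M" "B (p n i) \<in> borel_measurable M" "I (p n i) \<in> borel_measurable M" for n i
    using measurable_F_M[OF \<theta>(1)] measurable_F_M[OF c(1)] measurable_F_M[OF e(1)] measurable_F_M[OF HF[OF p0(1)]] p0(1)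
      I[OF p0(1)[of n i]]
    unfolding ito_integral_def by auto
  let ?W = "\<lambda>n i u \<omega>. \<theta> n i \<omega> * (H u \<omega> - \<theta> n i \<omega> * H (p n i) \<omega>)"
  let ?V = "\<lambda>n u \<omega>. \<Sum>i<Suc n. ?W n i u \<omega> * indicator {p n i<..p n (Suc i)} u"
  let ?W1 = "\<lambda>n i u \<omega>. ?W n i u \<omega> * indicator {p n i<..p n (Suc i)} u"
  let ?U = "\<lambda>n u \<omega>. \<Sum>i<Suc n. c n i \<omega> * \<theta> n i \<omega> * (H u \<omega> - \<theta> n i \<omega> * H (p n i) \<omega>) * indicator {p n i<..p n (Suc i)} u"
  let ?q = "\<lambda>n i \<omega>. I (p n (Suc i)) \<omega> - I (p n i) \<omega> - \<theta> n i \<omega> * H (p n i) \<omega> * (B (p n (Suc i)) \<omega> - B (p n i) \<omega>)"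
  have W: "joint_measurable M T (?W n i)" for n i
    by (intro joint_measurable_mult joint_measurable_diff H joint_measurable_snd) auto
  have V: "joint_measurable M T (?V n)" for n
    by (intro joint_measurable_sum joint_measurable_mult W joint_measurable_fst) auto
  define gap where "gap n = (\<integral>\<^sup>+\<omega>. sq_int T (?V n) \<omega> \<partial>M)" for n
  have SC: "(\<exists>i<Suc n. u \<in> {p n i<..p n (Suc i)} \<and> (\<Sum>j<Suc n. G j * indicator {p n j<..p n (Suc j)} u) = G i) \<or>
    (\<Sum>j<Suc n. G j * indicator {p n j<..p n (Suc j)} u) = 0" for n u and G :: "nat \<Rightarrow> real"
  proof (rule step_cases[of "Suc n" "p n" u])
    fix i assume "i < Suc n" "u \<in> {p n i<..p n (Suc i)}" "\<And>g::nat \<Rightarrow> real. (\<Sum>j<Suc n. g j * indicator {p n j<..p n (Suc j)} u) = g i"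
    then show ?thesis by blast
  next
    assume "\<And>g::nat \<Rightarrow> real. (\<Sum>j<Suc n. g j * indicator {p n j<..p n (Suc j)} u) = 0"
    then show ?thesis by blast
  qed (rule p0)
  have Vcases: "(\<exists>i<Suc n. u \<in> {p n i<..p n (Suc i)} \<and> ?V n u \<omega> = ?W n i u \<omega>) \<or> ?V n u \<omega> = 0" for n u \<omega>
    using SC[of n u "\<lambda>i. ?W n i u \<omega>"] .
  have gap0: "gap \<longlonglongrightarrow> 0"
  proof -
    have "(\<lambda>n. \<integral>\<^sup>+\<omega>. sq_int T (?V n) \<omega> \<partial>M) \<longlonglongrightarrow> (\<integral>\<^sup>+\<omega>. 0 \<partial>M)"
    proof (rule nn_integral_dominated_convergence[where w="\<lambda>\<omega>. 2 * sq_int T H \<omega> + 2 * ennreal (C\<^sup>2 * T)"])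
      show "sq_int T (?V n) \<in> borel_measurable M" for n by (rule joint_measurable_sq_int[OF V])
      show wM: "(\<lambda>\<omega>. 2 * sq_int T H \<omega> + 2 * ennreal (C\<^sup>2 * T)) \<in> borel_measurable M"
        using joint_measurable_sq_int[OF H] by simp
      show "(\<integral>\<^sup>+\<omega>. 2 * sq_int T H \<omega> + 2 * ennreal (C\<^sup>2 * T) \<partial>M) < \<infinity>"
        using joint_measurable_sq_int[OF H] H2
        by (simp add: nn_integral_add nn_integral_cmult emeasure_space_1 ennreal_mult_less_top less_top)
      show "AE \<omega> in M. sq_int T (?V n) \<omega> \<le> 2 * sq_int T H \<omega> + 2 * ennreal (C\<^sup>2 * T)" for n
      proof (rule AE_I2)
        fix \<omega> assume w: "\<omega> \<in> space M"
        let ?Z = "\<lambda>u \<omega>'. \<Sum>i<Suc n. (\<theta> n i \<omega>' * (\<theta> n i \<omega>' * H (p n i) \<omega>')) * indicator {p n i<..p n (Suc i)} u"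
        let ?Y = "\<lambda>u \<omega>'. \<Sum>i<Suc n. \<theta> n i \<omega>' * H u \<omega>' * indicator {p n i<..p n (Suc i)} u"
        have Z: "joint_measurable M T ?Z" "joint_measurable M T ?Y"
          by (intro joint_measurable_sum joint_measurable_mult H joint_measurable_snd joint_measurable_fst; simp)+
        have "joint_measurable M T (\<lambda>u \<omega>. 0 - ?Z u \<omega>)"
          by (intro joint_measurable_diff Z joint_measurable_snd) simp
        then have "sq_int T (?V n) \<omega> \<le> 2 * sq_int T ?Y \<omega> + 2 * sq_int T (\<lambda>u \<omega>. 0 - ?Z u \<omega>) \<omega>"
          by (rule sq_int_add_le[OF Z(2) _ w]) (simp add: algebra_simps sum_subtractf)
        also have "sq_int T (\<lambda>u \<omega>. 0 - ?Z u \<omega>) \<omega> \<le> ennreal (C\<^sup>2 * T)"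
        proof (rule sq_int_le_const)
          fix u
          have "(\<exists>i<Suc n. ?Z u \<omega> = \<theta> n i \<omega> * (\<theta> n i \<omega> * H (p n i) \<omega>)) \<or> ?Z u \<omega> = 0"
            using SC[of n u "\<lambda>i. \<theta> n i \<omega> * (\<theta> n i \<omega> * H (p n i) \<omega>)"] by blast
          then show "\<bar>0 - ?Z u \<omega>\<bar> \<le> C"
          proof (elim disjE exE conjE)
            fix i assume z: "?Z u \<omega> = \<theta> n i \<omega> * (\<theta> n i \<omega> * H (p n i) \<omega>)"
            show ?thesis unfolding z using \<theta>(3)[OF w] by (simp only: \<theta>1(2)) simp
          next
            assume z: "?Z u \<omega> = 0"
            show ?thesis unfolding z using C0 by simp
          qed
        qed (use T C0 in auto)
        also have "sq_int T ?Y \<omega> \<le> ennreal (1\<^sup>2) * sq_int T H \<omega>"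
        proof (rule sq_int_cmult_le[OF H w])
          fix u
          have "(\<exists>i<Suc n. ?Y u \<omega> = \<theta> n i \<omega> * H u \<omega>) \<or> ?Y u \<omega> = 0"
            using SC[of n u "\<lambda>i. \<theta> n i \<omega> * H u \<omega>"] by blast
          then show "\<bar>?Y u \<omega>\<bar> \<le> 1 * \<bar>H u \<omega>\<bar>"
          proof (elim disjE exE conjE)
            fix i assume z: "?Y u \<omega> = \<theta> n i \<omega> * H u \<omega>"
            show ?thesis unfolding z abs_mult by (rule mult_right_mono[OF \<theta>1(1)]) simp
          next
            assume z: "?Y u \<omega> = 0"
            show ?thesis unfolding z by simp
          qed
        qed
        finally show "sq_int T (?V n) \<omega> \<le> 2 * sq_int T H \<omega> + 2 * ennreal (C\<^sup>2 * T)"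
          by (simp add: mult_left_mono add_mono)
      qed
      show "AE \<omega> in M. (\<lambda>n. sq_int T (?V n) \<omega>) \<longlonglongrightarrow> 0"
      proof (rule AE_I2, rule ennreal_tendsto_0I)
        fix \<omega> and d :: real assume w: "\<omega> \<in> space M" and d: "0 < d"
        define \<epsilon> where "\<epsilon> = sqrt (d / T)"
        have \<epsilon>: "0 < \<epsilon>" "\<epsilon>\<^sup>2 * T = d" using d T by (auto simp: \<epsilon>_def)
        obtain \<delta> where \<delta>: "0 < \<delta>" "\<And>u v. u \<in> {0..T} \<Longrightarrow> v \<in> {0..T} \<Longrightarrow> \<bar>v - u\<bar> < \<delta> \<Longrightarrow> \<bar>H v \<omega> - H u \<omega>\<bar> < \<epsilon>"
          using compact_uniformly_continuous[OF Hc[OF w]] \<epsilon>(1) unfolding uniformly_continuous_on_def dist_real_def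
          by (metis compact_Icc)
        have "(\<lambda>n. T / real (Suc n)) \<longlonglongrightarrow> 0"
          by (rule LIMSEQ_Suc[OF lim_const_over_n])
        then have "eventually (\<lambda>n. T / real (Suc n) < \<delta>) sequentially"
          using order_tendstoD(2) \<delta>(1) by blast
        then show "eventually (\<lambda>n. sq_int T (?V n) \<omega> \<le> ennreal d) sequentially"
        proof eventually_elim
          case (elim n)
          have "sq_int T (?V n) \<omega> \<le> ennreal (\<epsilon>\<^sup>2 * T)"
          proof (rule sq_int_le_const)
            fix u assume u: "u \<in> {0..T}"
            show "\<bar>?V n u \<omega>\<bar> \<le> \<epsilon>"
              using Vcases[of n u \<omega>]
            proof (elim disjE exE conjE)
              fix i assume i: "i < Suc n" "u \<in> {p n i<..p n (Suc i)}" "?V n u \<omega> = ?W n i u \<omega>"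
              have "p n (Suc i) = p n i + T / real (Suc n)" 
                by (simp add: p_def add_divide_distrib[symmetric] distrib_left del: of_nat_Suc) (simp add: algebra_simps)
              then have "\<bar>u - p n i\<bar> < \<delta>" using i(2) elim by auto
              moreover have "p n i \<in> {0..T}" using p0[of n i] pmono[of i "Suc n" n] pT i(1) by auto
              ultimately have "\<bar>H u \<omega> - H (p n i) \<omega>\<bar> < \<epsilon>" using \<delta>(2) u by blast
              then show ?thesis using \<theta>(2)[of n i \<omega>] \<epsilon>(1) unfolding i(3) by auto
            qed (use \<epsilon> in simp)
          qed (use T \<epsilon> in auto)
          then show ?case using \<epsilon> by simp
        qed
      qed
    qed auto
    then show ?thesis unfolding gap_def[abs_def] by simp
  qed
  have QF: "c n i \<omega> * \<theta> n i \<omega> * ?q n i \<omega> =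
    c n i \<omega> * (\<theta> n i \<omega> * Q n i \<omega>)" for n i \<omega>
    using \<theta>(2)[of n i \<omega>] by (auto simp: Q_def \<beta>_def)
  let ?X1 = "\<lambda>n \<omega>. ennreal ((\<Sum>i<Suc n. c n i \<omega> * (\<theta> n i \<omega> * Q n i \<omega>))\<^sup>2)"
  let ?X2 = "\<lambda>n \<omega>. ennreal (\<Sum>i<Suc n. (\<theta> n i \<omega> * Q n i \<omega>)\<^sup>2)"
  let ?X3 = "\<lambda>n \<omega>. ennreal ((\<Sum>i<Suc n. e n i \<omega> * ((\<beta> n i \<omega>)\<^sup>2 - T / real (Suc n)))\<^sup>2)"
  let ?X4 = "\<lambda>n \<omega>. ennreal ((\<Sum>i<Suc n. 1 * ((\<beta> n i \<omega>)\<^sup>2 - T / real (Suc n)))\<^sup>2)"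
  have A1: "tends_prob ?X1"
  proof (rule tends_prob_L2)
    fix n
    have "(\<integral>\<^sup>+\<omega>. ennreal ((\<Sum>i<Suc n. c n i \<omega> * \<theta> n i \<omega> * ?q n i \<omega>)\<^sup>2) \<partial>M) \<le>
      2 * (\<integral>\<^sup>+\<omega>. sq_int (p n (Suc n)) (?U n) \<omega> \<partial>M)"
    proof (rule ito_increment_L2[where C=C and D=C])
      show "\<bar>c n i \<omega> * \<theta> n i \<omega>\<bar> \<le> C" if "\<omega> \<in> space M" for i \<omega>
        using mult_mono[OF c(2)[OF that] \<theta>1(1)] C0 by (simp add: abs_mult)
    qed (use p0 I c\<theta>F \<xi>F \<theta>(3) in auto)
    also have "\<dots> \<le> 2 * (\<integral>\<^sup>+\<omega>. ennreal (C\<^sup>2) * sq_int T (?V n) \<omega> \<partial>M)"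
      unfolding pT
    proof (intro mult_left_mono nn_integral_mono sq_int_cmult_le[OF V])
      fix \<omega> u assume w: "\<omega> \<in> space M"
      show "\<bar>?U n u \<omega>\<bar> \<le> C * \<bar>?V n u \<omega>\<bar>"
      proof (rule step_cases[of "Suc n" "p n" u])
        fix i assume e: "\<And>g::nat \<Rightarrow> real. (\<Sum>j<Suc n. g j * indicator {p n j<..p n (Suc j)} u) = g i"
        show "\<bar>?U n u \<omega>\<bar> \<le> C * \<bar>?V n u \<omega>\<bar>"
          unfolding e unfolding mult.assoc abs_mult[of "c n i \<omega>"] using c(2)[OF w] by (intro mult_right_mono) auto
      next
        assume e: "\<And>g::nat \<Rightarrow> real. (\<Sum>j<Suc n. g j * indicator {p n j<..p n (Suc j)} u) = 0"
        show "\<bar>?U n u \<omega>\<bar> \<le> C * \<bar>?V n u \<omega>\<bar>"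
          unfolding e using C0 by simp
      qed (rule p0)
    qed auto
    also have "\<dots> = 2 * (ennreal (C\<^sup>2) * gap n)"
      unfolding gap_def by (subst nn_integral_cmult[OF joint_measurable_sq_int[OF V]]) (rule refl)
    finally show "(\<integral>\<^sup>+\<omega>. ?X1 n \<omega> \<partial>M) \<le> 2 * (ennreal (C\<^sup>2) * gap n)"
      unfolding QF .
  next
    have "(\<lambda>n. 2 * (ennreal (C\<^sup>2) * gap n)) \<longlonglongrightarrow> 2 * (ennreal (C\<^sup>2) * 0)"
      by (intro ennreal_tendsto_cmult gap0) auto
    then show "(\<lambda>n. 2 * (ennreal (C\<^sup>2) * gap n)) \<longlonglongrightarrow> 0" by simp
  qed
  have QM: "(\<lambda>\<omega>. \<theta> n i \<omega> * Q n i \<omega>) \<in> borel_measurable M" for n i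
    unfolding Q_def \<beta>_def by measurable
  have A2: "tends_prob ?X2"
  proof (rule tends_prob_L2)
    fix n
    \<comment> \<open>Each cell is treated as a partition with a single summand. Since the cells are
      disjoint, the bounds add up to \<open>2 * gap n\<close> again.\<close>
    have single: "(\<integral>\<^sup>+\<omega>. ennreal ((\<theta> n i \<omega> * Q n i \<omega>)\<^sup>2) \<partial>M) \<le> 2 * (\<integral>\<^sup>+\<omega>. sq_int T (?W1 n i) \<omega> \<partial>M)"
      if i: "i < Suc n" for i
    proof -
      have "(\<integral>\<^sup>+\<omega>. ennreal ((\<Sum>j<1. \<theta> n (i + j) \<omega> * (I (p n (i + Suc j)) \<omega> - I (p n (i + j)) \<omega> - \<theta> n (i + j) \<omega> * H (p n (i + j)) \<omega> * (B (p n (i + Suc j)) \<omega> - B (p n (i + j)) \<omega>)))\<^sup>2) \<partial>M) \<le>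
        2 * (\<integral>\<^sup>+\<omega>. sq_int (p n (i + 1)) (\<lambda>u \<omega>. \<Sum>j<1. \<theta> n (i + j) \<omega> * (H u \<omega> - \<theta> n (i + j) \<omega> * H (p n (i + j)) \<omega>) * indicator {p n (i + j)<..p n (i + Suc j)} u) \<omega> \<partial>M)"
        by (rule ito_increment_L2[where C=1 and D=C and p="\<lambda>j. p n (i + j)" and n="1" and I="\<lambda>j. I (p n (i + j))"])
          (use p0 I \<theta>(1) \<theta>1(1) \<xi>F \<theta>(3) in auto)
      moreover have "\<theta> n i \<omega> * ?q n i \<omega> =
         \<theta> n i \<omega> * Q n i \<omega>" for \<omega> using \<theta>(2)[of n i \<omega>] by (auto simp: Q_def \<beta>_def)
      ultimately have "(\<integral>\<^sup>+\<omega>. ennreal ((\<theta> n i \<omega> * Q n i \<omega>)\<^sup>2) \<partial>M) \<le> 2 * (\<integral>\<^sup>+\<omega>. sq_int (p n (Suc i)) (?W1 n i) \<omega> \<partial>M)"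
        by simp
      also have "\<dots> \<le> 2 * (\<integral>\<^sup>+\<omega>. sq_int T (?W1 n i) \<omega> \<partial>M)"
        using pmono[of "Suc i" "Suc n" n] pT[of n] i unfolding sq_int_def
        by (intro mult_left_mono nn_integral_mono) (auto split: split_indicator)
      finally show ?thesis .
    qed
    have jW: "joint_measurable M T (?W1 n i)" for i
      by (intro joint_measurable_mult[OF W] joint_measurable_fst) auto
    have "(\<integral>\<^sup>+\<omega>. ?X2 n \<omega> \<partial>M) = (\<integral>\<^sup>+\<omega>. (\<Sum>i<Suc n. ennreal ((\<theta> n i \<omega> * Q n i \<omega>)\<^sup>2)) \<partial>M)"
      by (intro nn_integral_cong sum_ennreal[symmetric]) simp
    also have "\<dots> = (\<Sum>i<Suc n. \<integral>\<^sup>+\<omega>. ennreal ((\<theta> n i \<omega> * Q n i \<omega>)\<^sup>2) \<partial>M)"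
      using QM by (intro nn_integral_sum) auto
    also have "\<dots> \<le> (\<Sum>i<Suc n. 2 * (\<integral>\<^sup>+\<omega>. sq_int T (?W1 n i) \<omega> \<partial>M))"
      by (intro sum_mono single) simp
    also have "\<dots> = 2 * (\<integral>\<^sup>+\<omega>. (\<Sum>i<Suc n. sq_int T (?W1 n i) \<omega>) \<partial>M)"
      unfolding sum_distrib_left[symmetric] by (subst nn_integral_sum[OF joint_measurable_sq_int[OF jW]]) (rule refl)
    also have "\<dots> = 2 * gap n"
      unfolding gap_def
      by (rule arg_cong[where f="\<lambda>x. 2 * x"], rule nn_integral_cong, rule sum_step_sq_int; (rule p0 W | assumption))
    finally show "(\<integral>\<^sup>+\<omega>. ?X2 n \<omega> \<partial>M) \<le> 2 * gap n" .
  next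
    show "(\<lambda>n. 2 * gap n) \<longlonglongrightarrow> 0" using ennreal_tendsto_cmult[OF _ gap0, of 2] by simp
  qed
  have lim: "(\<lambda>n. ennreal (2 * D\<^sup>2 * T\<^sup>2 / real (Suc n))) \<longlonglongrightarrow> 0" for D
    using tendsto_ennrealI[OF LIMSEQ_Suc[OF lim_const_over_n[of "2 * D\<^sup>2 * T\<^sup>2"]]] by simp
  have A3: "tends_prob ?X3"
    by (rule tends_prob_L2[OF _ lim[of C]])
      (use quadratic_variation_L2[OF T, of _ "e _" C] e in \<open>simp add: p_def \<beta>_def\<close>)
  have A4: "tends_prob ?X4"
    by (rule tends_prob_L2[OF _ lim[of 1]])
      (use quadratic_variation_L2[OF T, of _ "\<lambda>_ _. 1" 1] in \<open>simp add: p_def \<beta>_def\<close>)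
  have [measurable]: "?X1 n \<in> borel_measurable M" "?X2 n \<in> borel_measurable M" "?X3 n \<in> borel_measurable M" "?X4 n \<in> borel_measurable M" for n
    using QM unfolding \<beta>_def by measurable
  have XM: "(\<lambda>\<omega>. ?X1 n \<omega> + ?X2 n \<omega> + (?X3 n \<omega> + ?X4 n \<omega>)) \<in> borel_measurable M" for n
    by measurable
  \<comment> \<open>The four nonnegative quantities are added before a subsequence is extracted, so
    that the same subsequence serves all of them.\<close>
  have "tends_prob (\<lambda>n \<omega>. ?X1 n \<omega> + ?X2 n \<omega> + (?X3 n \<omega> + ?X4 n \<omega>))"
    by (intro tends_prob_add A1 A2 A3 A4) measurable
  then have "\<exists>r. strict_mono r \<and> (AE \<omega> in M. (\<lambda>k. ?X1 (r k) \<omega> + ?X2 (r k) \<omega> + (?X3 (r k) \<omega> + ?X4 (r k) \<omega>)) \<longlonglongrightarrow> 0)"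
    by (rule tends_prob_AE_subseq[rotated]) (rule XM)
  then obtain r where r: "strict_mono r" "AE \<omega> in M. (\<lambda>k. ?X1 (r k) \<omega> + ?X2 (r k) \<omega> + (?X3 (r k) \<omega> + ?X4 (r k) \<omega>)) \<longlonglongrightarrow> 0"
    by blast
  have part: "g \<longlonglongrightarrow> 0" if "s \<longlonglongrightarrow> 0" "\<And>k. g k \<le> s k" for g s :: "nat \<Rightarrow> ennreal"
    using tendsto_sandwich[OF _ _ tendsto_const that(1), of g] that(2) by simp
  have real0: "g \<longlonglongrightarrow> 0" if "(\<lambda>k. ennreal (g k)) \<longlonglongrightarrow> 0" "\<And>k. 0 \<le> g k" for g :: "nat \<Rightarrow> real"
    using tendsto_ennrealD[of g 0] that by simp
  have sq0: "g \<longlonglongrightarrow> 0" if "(\<lambda>k. ennreal ((g k)\<^sup>2)) \<longlonglongrightarrow> 0" for g :: "nat \<Rightarrow> real"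
    using tendsto_real_sqrt[OF real0[OF that]] by (simp add: tendsto_rabs_zero_iff)
  show ?thesis
  proof (intro exI[of _ r] conjI r(1), use r(2) in eventually_elim)
    case (elim \<omega>)
    have "(\<lambda>k. ?X1 (r k) \<omega>) \<longlonglongrightarrow> 0" "(\<lambda>k. ?X2 (r k) \<omega>) \<longlonglongrightarrow> 0" "(\<lambda>k. ?X3 (r k) \<omega>) \<longlonglongrightarrow> 0" "(\<lambda>k. ?X4 (r k) \<omega>) \<longlonglongrightarrow> 0"
      by (rule part[OF elim]; simp add: add_increasing add_increasing2)+
    then have 1: "(\<lambda>k. \<Sum>i<Suc (r k). c (r k) i \<omega> * (\<theta> (r k) i \<omega> * Q (r k) i \<omega>)) \<longlonglongrightarrow> 0"
      and 2: "(\<lambda>k. \<Sum>i<Suc (r k). (\<theta> (r k) i \<omega> * Q (r k) i \<omega>)\<^sup>2) \<longlonglongrightarrow> 0"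
      and 3: "(\<lambda>k. \<Sum>i<Suc (r k). e (r k) i \<omega> * ((\<beta> (r k) i \<omega>)\<^sup>2 - T / real (Suc (r k)))) \<longlonglongrightarrow> 0"
      and 4: "(\<lambda>k. \<Sum>i<Suc (r k). 1 * ((\<beta> (r k) i \<omega>)\<^sup>2 - T / real (Suc (r k)))) \<longlonglongrightarrow> 0"
      by - (rule sq0, assumption | rule real0, assumption, rule sum_nonneg, simp)+
    have "(\<Sum>i<Suc (r k). 1 * ((\<beta> (r k) i \<omega>)\<^sup>2 - T / real (Suc (r k)))) = (\<Sum>i<Suc (r k). (\<beta> (r k) i \<omega>)\<^sup>2) - T" for k
      by (simp only: mult_1 sum_subtractf sum_constant card_lessThan) (simp del: of_nat_Suc)
    then have "(\<lambda>k. \<Sum>i<Suc (r k). (\<beta> (r k) i \<omega>)\<^sup>2) \<longlonglongrightarrow> T"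
      using 4 by (simp only: LIM_zero_iff)
    with 1 2 3 show ?case by blast
  qed
qed

end

section \<open>Pathwise Ito formula\<close>

text \<open>The mean value inequality is used twice, for \<open>f1\<close> and then for
  \<open>f\<close>, each minus its Taylor polynomial at \<open>y\<close>. It needs derivatives
  within the segment only, which covers the boundary point 0, where they are one-sided. A factor 1/2
  is given away.\<close>

lemma taylor2_bound:
  fixes f :: "real \<Rightarrow> real"
  assumes "C1_on {0..} f f1" "C1_on {0..} f1 f2" and y: "0 \<le> y" "0 \<le> y'"
    and \<epsilon>: "\<And>z. z \<in> closed_segment y y' \<Longrightarrow> \<bar>f2 z - f2 y\<bar> \<le> \<epsilon>"
  shows "\<bar>f y' - f y - f1 y * (y' - y) - f2 y * (y' - y)\<^sup>2 / 2\<bar> \<le> \<epsilon> * (y' - y)\<^sup>2"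
proof -
  let ?S = "closed_segment y y'"
  have S: "?S \<subseteq> {0..}" using y by (auto simp: closed_segment_eq_real_ivl split: if_splits)
  have d: "(f has_real_derivative f1 z) (at z within ?S)" "(f1 has_real_derivative f2 z) (at z within ?S)"
    if "z \<in> ?S" for z
    using assms(1,2) S that unfolding C1_on_def by (auto intro: DERIV_subset)
  have 1: "\<bar>f1 z - f1 y - f2 y * (z - y)\<bar> \<le> \<epsilon> * \<bar>z - y\<bar>" if z: "z \<in> ?S" for z
  proof -
    have "norm ((f1 z - f2 y * (z - y)) - (f1 y - f2 y * (y - y))) \<le> \<epsilon> * norm (z - y)"
    proof (rule field_differentiable_bound[of ?S "\<lambda>z. f1 z - f2 y * (z - y)" "\<lambda>z. f2 z - f2 y"])
      show "((\<lambda>z. f1 z - f2 y * (z - y)) has_field_derivative f2 w - f2 y) (at w within ?S)" if "w \<in> ?S" for w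
        by (rule derivative_eq_intros d[OF that] refl | simp)+
    qed (use \<epsilon> z in auto)
    then show ?thesis by (simp add: algebra_simps)
  qed
  have e0: "0 \<le> \<epsilon>" using \<epsilon>[of y] by simp
  have "norm ((f y' - f1 y * (y' - y) - f2 y * (y' - y)\<^sup>2 / 2) - (f y - f1 y * (y - y) - f2 y * (y - y)\<^sup>2 / 2)) \<le> (\<epsilon> * \<bar>y' - y\<bar>) * norm (y' - y)"
  proof (rule field_differentiable_bound[of ?S "\<lambda>z. f z - f1 y * (z - y) - f2 y * (z - y)\<^sup>2 / 2" "\<lambda>z. f1 z - f1 y - f2 y * (z - y)"])
    show "((\<lambda>z. f z - f1 y * (z - y) - f2 y * (z - y)\<^sup>2 / 2) has_field_derivative f1 z - f1 y - f2 y * (z - y)) (at z within ?S)" if "z \<in> ?S" for z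
      by (rule derivative_eq_intros d[OF that] refl | simp)+
    fix z assume z: "z \<in> ?S"
    then have "\<bar>z - y\<bar> \<le> \<bar>y' - y\<bar>" by (auto simp: closed_segment_eq_real_ivl split: if_splits)
    then have "\<epsilon> * \<bar>z - y\<bar> \<le> \<epsilon> * \<bar>y' - y\<bar>" using e0 by (rule mult_left_mono)
    then show "norm (f1 z - f1 y - f2 y * (z - y)) \<le> \<epsilon> * \<bar>y' - y\<bar>" using 1[OF z] by simp
  qed auto
  moreover have "(\<epsilon> * \<bar>y' - y\<bar>) * norm (y' - y) = \<epsilon> * (y' - y)\<^sup>2" by (simp add: power2_eq_square abs_mult_self_eq mult.assoc)
  ultimately show ?thesis by (simp add: algebra_simps)
qed

text \<open>The range 3/2 is that of \<open>- \<beta> - h / 2\<close> when \<open>\<beta>\<close>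
  and \<open>h\<close> are at most 1 in absolute value. On it the exponential in the Lagrange
  remainder is at most \<open>exp 2 \<le> 9\<close>, and \<open>9 / 6 \<le> 2\<close>.\<close>

lemma exp_cubic_bound:
  fixes w :: real
  assumes "\<bar>w\<bar> \<le> 3/2"
  shows "\<bar>exp w - 1 - w - w\<^sup>2 / 2\<bar> \<le> 2 * \<bar>w\<bar> ^ 3"
proof -
  obtain t where t: "\<bar>t\<bar> \<le> \<bar>w\<bar>" "exp w = (\<Sum>m<3. w ^ m / fact m) + exp t / fact 3 * w ^ 3"
    using Maclaurin_exp_le[of w 3] by blast
  have "exp t \<le> exp 1 * exp 1" using t assms by (simp flip: exp_add)
  also have "\<dots> \<le> 3 * 3" using exp_le by (intro mult_mono) auto
  finally have e: "exp t / 6 * \<bar>w\<bar> ^ 3 \<le> 2 * \<bar>w\<bar> ^ 3" by (intro mult_right_mono) auto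
  have "exp w - 1 - w - w\<^sup>2 / 2 = exp t / 6 * w ^ 3"
    using t(2) by (simp add: eval_nat_numeral)
  then have "\<bar>exp w - 1 - w - w\<^sup>2 / 2\<bar> = exp t / 6 * \<bar>w\<bar> ^ 3" by (simp only:) (simp add: abs_mult power_abs)
  then show ?thesis using e by (simp only:)
qed

text \<open>One step of Ito's formula for \<open>exp (- b - t / 2) * f\<close> evaluated along a path \<open>y\<close>, where \<open>\<beta>\<close>, \<open>d\<close>, \<open>h\<close> are the
  increments of \<open>b\<close>, \<open>y\<close>, \<open>t\<close>, and \<open>d = s \<beta> + q + m\<close> splits off the martingale error \<open>q\<close> and the
  drift \<open>m\<close>. The two equations make the terms of first order in \<open>\<beta>\<close>, \<open>h\<close> cancel.\<close>

lemma ito_step: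
  fixes \<beta> h q m d s f0 f1 f2 f' \<mu> K \<epsilon> :: real
  assumes d: "d = s * \<beta> + q + m" and e1: "f1 * s = f0" and e2: "f2 * s\<^sup>2 / 2 + f1 * \<mu> = f0"
    and tay: "\<bar>f' - f0 - f1 * d - f2 * d\<^sup>2 / 2\<bar> \<le> \<epsilon> * d\<^sup>2"
    and K: "\<bar>f0\<bar> \<le> K" "\<bar>f1\<bar> \<le> K" "\<bar>f2\<bar> \<le> K" "\<bar>s\<bar> \<le> K" "1 \<le> K"
    and \<epsilon>: "\<bar>\<beta>\<bar> \<le> \<epsilon>" "\<bar>d\<bar> \<le> \<epsilon>" "0 \<le> h" "h \<le> \<epsilon>" "\<epsilon> \<le> 1"
  shows "\<bar>exp (- \<beta> - h / 2) * f' - f0 - (f1 * q + (f0 / 2 - f1 * \<mu>) * (\<beta>\<^sup>2 - h) + f1 * (m - \<mu> * h))\<bar> \<le>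
    100 * K\<^sup>2 * (\<epsilon> * (\<beta>\<^sup>2 + d\<^sup>2 + h) + \<bar>\<beta> * (q + m)\<bar> + (q + m)\<^sup>2)"
proof -
  \<comment> \<open>\<open>\<kappa>\<close> is the error of replacing \<open>exp w\<close> by
    \<open>1 - \<beta> + (\<beta>^2 - h) / 2\<close>: a cubic remainder, plus the part of
    \<open>w^2\<close> beyond \<open>\<beta>^2\<close>, which is of order
    \<open>\<epsilon> * h\<close>. \<open>\<tau>\<close> is the Taylor remainder of
    \<open>f\<close>, \<open>g\<close> collects everything in \<open>d\<close> beyond
    \<open>s * \<beta>\<close>, and \<open>N\<close> measures second order terms.\<close>
  define w E \<kappa> \<tau> g N where "w = - \<beta> - h / 2" and "E = exp w" and "\<kappa> = E - (1 - \<beta> + (\<beta>\<^sup>2 - h) / 2)"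
    and "\<tau> = f' - f0 - f1 * d - f2 * d\<^sup>2 / 2" and "g = q + m" and "N = \<beta>\<^sup>2 + h"
  have N0: "0 \<le> N" "\<beta>\<^sup>2 \<le> N" "h \<le> N" "0 \<le> \<epsilon>" using \<epsilon> by (auto simp: N_def)
  have "\<bar>\<beta>\<bar> * \<bar>\<beta>\<bar> \<le> \<epsilon> * \<epsilon>" "h * h \<le> \<epsilon> * h" "\<epsilon> * \<epsilon> \<le> \<epsilon> * 1"
    using \<epsilon> N0(4) by (intro mult_mono mult_left_mono; simp)+
  then have sq: "\<beta>\<^sup>2 \<le> \<epsilon>" "h\<^sup>2 \<le> \<epsilon> * h" by (auto simp: power2_eq_square abs_mult_self_eq)
  have N2: "N \<le> 2 * \<epsilon>" using sq \<epsilon> by (simp add: N_def)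
  have w1: "\<bar>w\<bar> \<le> 3/2 * \<epsilon>" unfolding w_def using \<epsilon> by linarith
  have "w\<^sup>2 = \<beta>\<^sup>2 + \<beta> * h + h\<^sup>2 / 4" by (simp add: w_def power2_eq_square algebra_simps)
  moreover have bh: "\<bar>\<beta> * h\<bar> \<le> \<epsilon> * h" using \<epsilon> by (simp add: abs_mult mult_right_mono)
  moreover have eh: "\<epsilon> * h \<le> h" using \<epsilon> by (simp add: mult_left_le_one_le N0)
  moreover have "0 \<le> \<epsilon> * h" using \<epsilon> N0 by simp
  moreover have "\<beta>\<^sup>2 = N - h" by (simp add: N_def)
  ultimately have w2: "\<bar>w\<^sup>2 - \<beta>\<^sup>2\<bar> \<le> 2 * (\<epsilon> * h)" "w\<^sup>2 \<le> 3 * N"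
    using sq \<epsilon>(3) N0(1,3) zero_le_power2[of h] by linarith+
  have "\<bar>w\<bar> ^ 3 = \<bar>w\<bar> * w\<^sup>2" by (simp add: power3_eq_cube power2_eq_square abs_mult_self_eq mult.assoc)
  also have "\<dots> \<le> (3/2 * \<epsilon>) * (3 * N)" using w1 w2 N0 by (intro mult_mono) auto
  finally have w3: "\<bar>w\<bar> ^ 3 \<le> 9/2 * (\<epsilon> * N)" by simp
  have "\<bar>E - 1 - w - w\<^sup>2 / 2\<bar> \<le> 2 * \<bar>w\<bar> ^ 3"
    unfolding E_def by (rule exp_cubic_bound) (use w1 \<epsilon> in simp)
  also have "\<dots> \<le> 9 * (\<epsilon> * N)" using w3 by simp
  finally have r: "\<bar>E - 1 - w - w\<^sup>2 / 2\<bar> \<le> 9 * (\<epsilon> * N)" .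
  have "\<bar>w\<^sup>2 - \<beta>\<^sup>2\<bar> \<le> 2 * (\<epsilon> * N)"
    by (rule order.trans[OF w2(1)]) (use N0 in \<open>simp add: mult_left_mono\<close>)
  then have r': "\<bar>(w\<^sup>2 - \<beta>\<^sup>2) / 2\<bar> \<le> \<epsilon> * N" by simp
  have "\<kappa> = (E - 1 - w - w\<^sup>2 / 2) + (w\<^sup>2 - \<beta>\<^sup>2) / 2" by (simp add: \<kappa>_def w_def diff_divide_distrib)
  then have "\<bar>\<kappa>\<bar> \<le> \<bar>E - 1 - w - w\<^sup>2 / 2\<bar> + \<bar>(w\<^sup>2 - \<beta>\<^sup>2) / 2\<bar>" by (simp only: abs_triangle_ineq)
  also have "\<dots> \<le> 9 * (\<epsilon> * N) + \<epsilon> * N" by (rule add_mono[OF r r'])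
  finally have k: "\<bar>\<kappa>\<bar> \<le> 10 * (\<epsilon> * N)" by (simp add: algebra_simps)
  have eN: "\<epsilon> * N \<le> N" using \<epsilon> N0 by (simp add: mult_left_le_one_le)
  have E1: "\<bar>E - 1 + \<beta>\<bar> \<le> 11 * N"
  proof -
    have "E - 1 + \<beta> = \<kappa> + (\<beta>\<^sup>2 - h) / 2" by (simp add: \<kappa>_def)
    moreover have "\<bar>(\<beta>\<^sup>2 - h) / 2\<bar> \<le> N" using \<epsilon> unfolding N_def by (auto simp: abs_le_iff)
    ultimately show ?thesis using k eN by linarith
  qed
  then have E2: "\<bar>E - 1\<bar> \<le> 23 * \<epsilon>" using N2 \<epsilon>(1) by linarith
  then have E3: "\<bar>E\<bar> \<le> 24" using \<epsilon> by linarith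
  have KK: "K \<le> K\<^sup>2" "1 \<le> K\<^sup>2" using K(5) by (auto simp: power2_eq_square intro: order.trans[of _ K] mult_left_mono[of 1 K K, simplified])
  have m: "\<bar>a * b\<bar> \<le> A * C" if "\<bar>a\<bar> \<le> A" "\<bar>b\<bar> \<le> C" for a b A C :: real
    using mult_mono[OF that] that by (simp add: abs_mult)
  \<comment> \<open>An exact identity. Multiplying the two expansions, \<open>- f0 * \<beta>\<close>
    cancels against \<open>f1 * s * \<beta>\<close> by \<open>e1\<close>. By \<open>e1\<close> and
    \<open>e2\<close> the coefficient of \<open>\<beta>^2\<close> is
    \<open>f0 / 2 - f0 + (f0 - f1 * \<mu>)\<close>, which is \<open>f0 / 2 - f1 * \<mu>\<close>, and
    the terms \<open>- f0 / 2 * h\<close> and \<open>f1 * \<mu> * h\<close> complete it to a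
    multiple of \<open>\<beta>^2 - h\<close>.\<close>
  have "E * f' - f0 - (f1 * q + (f0 / 2 - f1 * \<mu>) * (\<beta>\<^sup>2 - h) + f1 * (m - \<mu> * h)) =
    f0 * \<kappa> + f1 * (d * (E - 1 + \<beta>)) + f2 * (d\<^sup>2 / 2 * (E - 1)) + E * \<tau> - f1 * (\<beta> * g) + f2 * (s * (\<beta> * g)) + f2 * (g\<^sup>2 / 2)"
  proof -
    have f': "f' = f0 + f1 * d + f2 * d\<^sup>2 / 2 + \<tau>" by (simp add: \<tau>_def)
    have E: "E = 1 - \<beta> + (\<beta>\<^sup>2 - h) / 2 + \<kappa>" by (simp add: \<kappa>_def)
    have f0': "f0 * \<beta>\<^sup>2 = f2 * s\<^sup>2 / 2 * \<beta>\<^sup>2 + f1 * \<mu> * \<beta>\<^sup>2" using e2 by (metis distrib_right)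
    have dd: "d = s * \<beta> + g" by (simp add: d g_def)
    have d2: "f2 * (d\<^sup>2 / 2) = f0 * \<beta>\<^sup>2 - f1 * \<mu> * \<beta>\<^sup>2 + f2 * (s * (\<beta> * g)) + f2 * (g\<^sup>2 / 2)"
      unfolding dd f0' by (simp add: power2_eq_square field_simps)
    have d1: "f1 * d = f0 * \<beta> + f1 * g" unfolding dd e1[symmetric] by (simp add: algebra_simps)
    have d1b: "f1 * (d * \<beta>) = f0 * \<beta>\<^sup>2 + f1 * (\<beta> * g)" 
      using arg_cong[OF d1, of "\<lambda>x. x * \<beta>"] by (simp add: power2_eq_square algebra_simps)
    have fg: "f1 * g = f1 * q + f1 * m" by (simp add: g_def algebra_simps)
    have "E * f' = E * f0 + f1 * (d * (E - 1 + \<beta>)) + f1 * d - f1 * (d * \<beta>) + f2 * (d\<^sup>2 / 2 * (E - 1)) + f2 * (d\<^sup>2 / 2) + E * \<tau>"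
      unfolding f' by (simp add: field_simps)
    moreover have "E * f0 = f0 - f0 * \<beta> + f0 * \<beta>\<^sup>2 / 2 - f0 * h / 2 + f0 * \<kappa>"
      unfolding E by (simp add: field_simps)
    moreover have "(f0 / 2 - f1 * \<mu>) * (\<beta>\<^sup>2 - h) = f0 * \<beta>\<^sup>2 / 2 - f0 * h / 2 - f1 * \<mu> * \<beta>\<^sup>2 + f1 * \<mu> * h"
      by (simp add: field_simps)
    moreover have "f1 * (m - \<mu> * h) = f1 * m - f1 * \<mu> * h" by (simp add: algebra_simps)
    ultimately show ?thesis unfolding d2 d1 d1b fg by simp
  qed
  also have "\<bar>\<dots>\<bar> \<le> \<bar>f0 * \<kappa>\<bar> + \<bar>f1 * (d * (E - 1 + \<beta>))\<bar> + \<bar>f2 * (d\<^sup>2 / 2 * (E - 1))\<bar> + \<bar>E * \<tau>\<bar> + \<bar>f1 * (\<beta> * g)\<bar> +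
     \<bar>f2 * (s * (\<beta> * g))\<bar> + \<bar>f2 * (g\<^sup>2 / 2)\<bar>"
    by (intro order.trans[OF abs_triangle_ineq] order.trans[OF abs_triangle_ineq4] add_mono order.refl)
  also have "\<dots> \<le> K * (10 * (\<epsilon> * N)) + K * (\<epsilon> * (11 * N)) + K * (d\<^sup>2 / 2 * (23 * \<epsilon>)) + 24 * (\<epsilon> * d\<^sup>2) + K * \<bar>\<beta> * g\<bar> +
     K * (K * \<bar>\<beta> * g\<bar>) + K * (g\<^sup>2 / 2)"
  proof -
    have "\<bar>d\<^sup>2 / 2\<bar> \<le> d\<^sup>2 / 2" "\<bar>g\<^sup>2 / 2\<bar> \<le> g\<^sup>2 / 2" by auto
    from m[OF K(3) m[OF this(1) E2]] m[OF K(3) this(2)] m[OF K(1) k] m[OF K(2) m[OF \<epsilon>(2) E1]]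
      m[OF E3 tay[folded \<tau>_def]] m[OF K(2) order.refl, of "\<beta> * g"] m[OF K(3) m[OF K(4) order.refl], of "\<beta> * g"]
    show ?thesis by (intro add_mono)
  qed
  also have "\<dots> = K * (21 * (\<epsilon> * N) + 23/2 * (\<epsilon> * d\<^sup>2) + \<bar>\<beta> * g\<bar> + g\<^sup>2 / 2) + 24 * (\<epsilon> * d\<^sup>2) + K\<^sup>2 * \<bar>\<beta> * g\<bar>"
    by (simp add: algebra_simps power2_eq_square)
  also have "\<dots> \<le> K\<^sup>2 * (21 * (\<epsilon> * N) + 23/2 * (\<epsilon> * d\<^sup>2) + \<bar>\<beta> * g\<bar> + g\<^sup>2 / 2) + K\<^sup>2 * (24 * (\<epsilon> * d\<^sup>2)) + K\<^sup>2 * \<bar>\<beta> * g\<bar>"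
    using KK N0 mult_right_mono[OF KK(2), of "24 * (\<epsilon> * d\<^sup>2)"] by (intro add_mono mult_right_mono) auto
  also have "\<dots> = K\<^sup>2 * (21 * (\<epsilon> * N) + 71/2 * (\<epsilon> * d\<^sup>2) + 2 * \<bar>\<beta> * g\<bar> + g\<^sup>2 / 2)"
    by (simp add: field_simps)
  \<comment> \<open>The constant 100 is generous: the largest coefficient is
    \<open>71/2 = 23/2 + 24\<close>, where 24 is the bound for \<open>\<bar>E\<bar>\<close> in front
    of the Taylor remainder.\<close>
  also have "\<dots> \<le> K\<^sup>2 * (100 * (\<epsilon> * (\<beta>\<^sup>2 + d\<^sup>2 + h) + \<bar>\<beta> * g\<bar> + g\<^sup>2))"
  proof (rule mult_left_mono)
    have "\<epsilon> * (\<beta>\<^sup>2 + d\<^sup>2 + h) = \<epsilon> * N + \<epsilon> * d\<^sup>2" by (simp add: N_def algebra_simps)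
    moreover have "0 \<le> \<epsilon> * N" "0 \<le> \<epsilon> * d\<^sup>2" "0 \<le> \<bar>\<beta> * g\<bar>" "0 \<le> g\<^sup>2" using N0 by auto
    ultimately show "21 * (\<epsilon> * N) + 71/2 * (\<epsilon> * d\<^sup>2) + 2 * \<bar>\<beta> * g\<bar> + g\<^sup>2 / 2 \<le> 100 * (\<epsilon> * (\<beta>\<^sup>2 + d\<^sup>2 + h) + \<bar>\<beta> * g\<bar> + g\<^sup>2)"
      unfolding ring_distribs by linarith
  qed simp
  finally show ?thesis unfolding g_def E_def w_def by (simp add: mult_ac)
qed

text \<open>Along partitions the sums of \<open>\<beta>^2\<close> stay bounded and those of
  \<open>q^2\<close> tend to 0, so the mixed term \<open>\<beta> * g\<close> is split by Young's
  inequality into \<open>\<epsilon> * \<beta>^2\<close> and \<open>g^2 / \<epsilon>\<close>. For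
  fixed \<open>\<epsilon>\<close> the part with \<open>q\<close> then vanishes in the limit. The
  requirement \<open>h \<le> \<epsilon>^2\<close> makes \<open>m^2 / \<epsilon>\<close> of order
  \<open>\<epsilon> * h\<close>. The constant is \<open>100 * 11 + 100\<close>, the last term being
  the drift error.\<close>

lemma ito_step_young:
  fixes \<beta> h q m d s f0 f1 f2 f' \<mu> K \<epsilon> :: real
  assumes d: "d = s * \<beta> + q + m" and e1: "f1 * s = f0" and e2: "f2 * s\<^sup>2 / 2 + f1 * \<mu> = f0"
    and tay: "\<bar>f' - f0 - f1 * d - f2 * d\<^sup>2 / 2\<bar> \<le> \<epsilon> * d\<^sup>2"
    and K: "\<bar>f0\<bar> \<le> K" "\<bar>f1\<bar> \<le> K" "\<bar>f2\<bar> \<le> K" "\<bar>s\<bar> \<le> K" "1 \<le> K"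
    and \<epsilon>: "\<bar>\<beta>\<bar> \<le> \<epsilon>" "\<bar>d\<bar> \<le> \<epsilon>" "0 \<le> h" "h \<le> \<epsilon>\<^sup>2" "0 < \<epsilon>" "\<epsilon> \<le> 1"
    and m: "\<bar>m\<bar> \<le> K * h" "\<bar>m - \<mu> * h\<bar> \<le> \<epsilon> * h"
  shows "\<bar>exp (- \<beta> - h / 2) * f' - f0 - (f1 * q + (f0 / 2 - f1 * \<mu>) * (\<beta>\<^sup>2 - h))\<bar> \<le>
    1200 * K ^ 4 * (\<epsilon> * (\<beta>\<^sup>2 + h) + q\<^sup>2 / \<epsilon>)"
proof -
  define g where "g = q + m"
  define Y where "Y = \<epsilon> * (\<beta>\<^sup>2 + h) + q\<^sup>2 / \<epsilon>"
  let ?A = "exp (- \<beta> - h / 2) * f' - f0 - (f1 * q + (f0 / 2 - f1 * \<mu>) * (\<beta>\<^sup>2 - h) + f1 * (m - \<mu> * h))"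
  let ?Z = "exp (- \<beta> - h / 2) * f' - f0 - (f1 * q + (f0 / 2 - f1 * \<mu>) * (\<beta>\<^sup>2 - h))"
  let ?b = "f1 * (m - \<mu> * h)" and ?R = "\<epsilon> * (\<beta>\<^sup>2 + d\<^sup>2 + h) + \<bar>\<beta> * g\<bar> + g\<^sup>2"
  have Kp: "1 \<le> K\<^sup>2" "K\<^sup>2 \<le> K ^ 4" "K \<le> K ^ 4"
    using K(5) power_increasing[of 2 4 K] power_increasing[of 1 4 K] by (auto simp: one_le_power)
  have "\<epsilon>\<^sup>2 \<le> \<epsilon>" using \<epsilon> by (simp add: power2_eq_square mult_left_le_one_le)
  then have h1: "h \<le> \<epsilon>" using \<epsilon> by simp
  have *: "\<bar>?A\<bar> \<le>
    100 * K\<^sup>2 * ?R"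
    unfolding g_def by (rule ito_step[OF d e1 e2 tay K \<epsilon>(1,2,3) h1 \<epsilon>(6)])
  have "m\<^sup>2 \<le> (K * h)\<^sup>2" using power_mono[OF m(1), of 2] by simp
  also have "\<dots> = K\<^sup>2 * (h * h)" by (simp add: power2_eq_square mult_ac)
  also have "\<dots> \<le> K\<^sup>2 * (\<epsilon>\<^sup>2 * h)" using \<epsilon> by (intro mult_left_mono mult_right_mono) auto
  finally have m2: "m\<^sup>2 / \<epsilon> \<le> K\<^sup>2 * (\<epsilon> * h)"
    using \<epsilon>(5) by (simp add: divide_le_eq power2_eq_square mult_ac)
  have g2: "g\<^sup>2 \<le> 2 * q\<^sup>2 + 2 * m\<^sup>2"
    unfolding g_def using sum_squares_bound[of q m] by (simp add: power2_sum)
  have "g\<^sup>2 / \<epsilon> \<le> (2 * q\<^sup>2 + 2 * m\<^sup>2) / \<epsilon>" using g2 \<epsilon>(5) by (simp add: divide_right_mono)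
  then have g3: "g\<^sup>2 / \<epsilon> \<le> 2 * (q\<^sup>2 / \<epsilon>) + 2 * (K\<^sup>2 * (\<epsilon> * h))" using m2 by (simp add: add_divide_distrib)
  have g4: "g\<^sup>2 \<le> g\<^sup>2 / \<epsilon>" using \<epsilon>(5,6) by (simp add: le_divide_eq mult_left_le)
  have bg: "\<bar>\<beta> * g\<bar> \<le> \<epsilon> * \<beta>\<^sup>2 + g\<^sup>2 / \<epsilon>"
  proof -
    have "0 \<le> (\<epsilon> * \<bar>\<beta>\<bar> - \<bar>g\<bar>)\<^sup>2 / \<epsilon>" using \<epsilon> by simp
    also have "\<dots> = \<epsilon> * \<beta>\<^sup>2 + g\<^sup>2 / \<epsilon> - 2 * \<bar>\<beta> * g\<bar>"
      using \<epsilon>(5) by (simp add: power2_diff field_simps abs_mult) (simp add: power2_eq_square abs_mult_self_eq)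
    finally show ?thesis by linarith
  qed
  have "d\<^sup>2 \<le> 2 * (s * \<beta>)\<^sup>2 + 2 * g\<^sup>2"
    using sum_squares_bound[of "s * \<beta>" g] d by (simp add: g_def[symmetric] add.assoc power2_sum[of "s * \<beta>" g])
  also have "(s * \<beta>)\<^sup>2 \<le> K\<^sup>2 * \<beta>\<^sup>2"
    using power_mono[OF K(4), of 2] by (simp add: power_mult_distrib mult_right_mono)
  finally have "\<epsilon> * d\<^sup>2 \<le> \<epsilon> * (2 * (K\<^sup>2 * \<beta>\<^sup>2) + 2 * g\<^sup>2)" using \<epsilon>(5) by (simp add: mult_left_mono)
  moreover have "\<epsilon> * g\<^sup>2 \<le> g\<^sup>2" using \<epsilon>(5,6) by (simp add: mult_left_le_one_le)
  ultimately have ed: "\<epsilon> * d\<^sup>2 \<le> 2 * (K\<^sup>2 * (\<epsilon> * \<beta>\<^sup>2)) + 2 * g\<^sup>2" by (simp add: algebra_simps)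
  have nn: "0 \<le> \<epsilon> * \<beta>\<^sup>2" "0 \<le> \<epsilon> * h" "0 \<le> q\<^sup>2 / \<epsilon>" using \<epsilon> by auto
  have k1: "\<epsilon> * \<beta>\<^sup>2 \<le> K\<^sup>2 * (\<epsilon> * \<beta>\<^sup>2)" "\<epsilon> * h \<le> K\<^sup>2 * (\<epsilon> * h)" "q\<^sup>2 / \<epsilon> \<le> K\<^sup>2 * (q\<^sup>2 / \<epsilon>)"
    using mult_right_mono[OF Kp(1) nn(1)] mult_right_mono[OF Kp(1) nn(2)] mult_right_mono[OF Kp(1) nn(3)] by auto
  have KY: "K\<^sup>2 * Y = K\<^sup>2 * (\<epsilon> * \<beta>\<^sup>2) + K\<^sup>2 * (\<epsilon> * h) + K\<^sup>2 * (q\<^sup>2 / \<epsilon>)"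
    by (simp add: Y_def algebra_simps)
  have "?R \<le> 11 * (K\<^sup>2 * Y)"
    using ed bg g3 g4 k1 nn unfolding KY ring_distribs by linarith
  then have "100 * K\<^sup>2 * ?R \<le> 100 * K\<^sup>2 * (11 * (K\<^sup>2 * Y))"
    by (intro mult_left_mono) auto
  also have "\<dots> = 1100 * K ^ 4 * Y" by (simp add: power2_eq_square power4_eq_xxxx)
  finally have **: "100 * K\<^sup>2 * ?R \<le> 1100 * K ^ 4 * Y" .
  have "\<bar>?b\<bar> \<le> 100 * K ^ 4 * Y"
  proof -
    have "\<bar>?b\<bar> \<le> K * (\<epsilon> * h)"
      unfolding abs_mult by (rule mult_mono) (use K m in auto)
    also have "\<dots> \<le> (100 * K ^ 4) * Y"
      by (rule mult_mono) (use Kp K nn in \<open>auto simp: Y_def distrib_left\<close>)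
    finally show ?thesis .
  qed
  then have sum: "\<bar>?A\<bar> +
    \<bar>?b\<bar> \<le> 1100 * K ^ 4 * Y + 100 * K ^ 4 * Y"
    by (rule add_mono[OF order.trans[OF * **]])
  have eq: "?Z =
    ?A + ?b"
    by (simp only: diff_diff_add[symmetric] diff_add_cancel)
  have "\<bar>?Z\<bar> \<le>
    \<bar>?A\<bar> + \<bar>?b\<bar>"
    unfolding eq by (rule abs_triangle_ineq)
  also note sum
  also have "1100 * K ^ 4 * Y + 100 * K ^ 4 * Y = 1200 * K ^ 4 * Y" by simp
  finally show ?thesis unfolding Y_def .
qed

text \<open>A pathwise Ito formula in the style of Foellmer. Here \<open>q\<close> is the error in replacing the martingale
  increment of \<open>x\<close> by \<open>\<sigma>(x) \<beta>\<close>.\<close>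

lemma ito_pathwise:
  fixes x b f f1 f2 \<sigma> \<mu> :: "real \<Rightarrow> real" and N :: "nat \<Rightarrow> nat" and T :: real
  defines "p \<equiv> \<lambda>k i. T * real i / real (N k)"
  defines "\<beta> \<equiv> \<lambda>k i. b (p k (Suc i)) - b (p k i)"
  defines "m \<equiv> \<lambda>k i. integral {p k i..p k (Suc i)} (\<lambda>u. \<mu> (x u))"
  defines "q \<equiv> \<lambda>k i. x (p k (Suc i)) - x (p k i) - \<sigma> (x (p k i)) * \<beta> k i - m k i"
  defines "e \<equiv> \<lambda>u. exp (- b u - u / 2)"
  assumes T: "0 < T" and x: "continuous_on {0..T} x" "\<And>u. u \<in> {0..T} \<Longrightarrow> 0 \<le> x u" and b: "continuous_on {0..T} b"
    and f: "C1_on {0..} f f1" "C1_on {0..} f1 f2" and cont: "continuous_on {0..} \<sigma>" "continuous_on {0..} \<mu>"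
    and eq: "\<And>y. 0 \<le> y \<Longrightarrow> f1 y * \<sigma> y = f y" "\<And>y. 0 \<le> y \<Longrightarrow> f2 y * (\<sigma> y)\<^sup>2 / 2 + f1 y * \<mu> y = f y"
    and N: "\<And>k. 0 < N k" "filterlim N at_top sequentially"
    and A1: "(\<lambda>k. \<Sum>i<N k. e (p k i) * f1 (x (p k i)) * q k i) \<longlonglongrightarrow> 0"
    and A2: "(\<lambda>k. \<Sum>i<N k. (q k i)\<^sup>2) \<longlonglongrightarrow> 0"
    and A3: "(\<lambda>k. \<Sum>i<N k. e (p k i) * (f (x (p k i)) / 2 - f1 (x (p k i)) * \<mu> (x (p k i))) * ((\<beta> k i)\<^sup>2 - T / N k)) \<longlonglongrightarrow> 0"
    and A4: "(\<lambda>k. \<Sum>i<N k. (\<beta> k i)\<^sup>2) \<longlonglongrightarrow> T"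
  shows "e T * f (x T) = e 0 * f (x 0)"
proof -
  define h where "h k = T / real (N k)" for k
  have h0: "0 < h k" for k using T N(1) by (simp add: h_def)
  have hlim: "h \<longlonglongrightarrow> 0"
    unfolding h_def[abs_def] using filterlim_compose[OF filterlim_real_sequentially N(2)]
    by (intro tendsto_divide_0[OF tendsto_const] filterlim_at_top_imp_at_infinity)
  have pS: "p k (Suc i) = p k i + h k" for k i by (simp add: p_def h_def add_divide_distrib distrib_left)
  have p0: "p k 0 = 0" "p k (N k) = T" for k using N(1)[of k] by (auto simp: p_def)
  have pT: "p k i \<in> {0..T}" if "i \<le> N k" for k i
  proof -
    have "T * real i \<le> T * real (N k)" using T that by (intro mult_left_mono) auto
    then show ?thesis using T N(1)[of k] by (auto simp: p_def divide_le_eq)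
  qed
  have fc: "continuous_on {0..} f" "continuous_on {0..} f1" "continuous_on {0..} f2"
    using f unfolding C1_on_def by (auto intro: DERIV_continuous_on)
  obtain R where R: "\<And>u. u \<in> {0..T} \<Longrightarrow> x u \<le> R"
    using compact_continuous_image[OF x(1)] compact_imp_bounded[THEN bounded_imp_bdd_above] bdd_above_def
    by (metis (no_types, lifting) compact_Icc image_eqI)
  then have xR: "x u \<in> {0..R}" if "u \<in> {0..T}" for u using x(2) that by auto
  have bd: "\<exists>K. \<forall>y\<in>{0..R}. \<bar>g y\<bar> \<le> K" if "continuous_on {0..} g" for g :: "real \<Rightarrow> real"
    using compact_imp_bounded[OF compact_continuous_image[OF continuous_on_subset[OF that, of "{0..R}"]]]
    by (auto simp: bounded_iff)
  obtain K0 K1 K2 K3 K4 where "\<forall>y\<in>{0..R}. \<bar>f y\<bar> \<le> K0" "\<forall>y\<in>{0..R}. \<bar>f1 y\<bar> \<le> K1" "\<forall>y\<in>{0..R}. \<bar>f2 y\<bar> \<le> K2"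
     "\<forall>y\<in>{0..R}. \<bar>\<sigma> y\<bar> \<le> K3" "\<forall>y\<in>{0..R}. \<bar>\<mu> y\<bar> \<le> K4"
    using bd[OF fc(1)] bd[OF fc(2)] bd[OF fc(3)] bd[OF cont(1)] bd[OF cont(2)] by blast
  moreover define K where "K = Max {1, K0, K1, K2, K3, K4}"
  moreover have "z \<le> K" if "z \<in> {1, K0, K1, K2, K3, K4}" for z unfolding K_def using that by (intro Max_ge) auto
  ultimately have K: "1 \<le> K" "\<And>y. y \<in> {0..R} \<Longrightarrow> \<bar>f y\<bar> \<le> K" "\<And>y. y \<in> {0..R} \<Longrightarrow> \<bar>f1 y\<bar> \<le> K" 
    "\<And>y. y \<in> {0..R} \<Longrightarrow> \<bar>f2 y\<bar> \<le> K" "\<And>y. y \<in> {0..R} \<Longrightarrow> \<bar>\<sigma> y\<bar> \<le> K" "\<And>y. y \<in> {0..R} \<Longrightarrow> \<bar>\<mu> y\<bar> \<le> K"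
    by (meson insertI1 insertI2 order.trans)+
  have "continuous_on {0..T} e" unfolding e_def by (intro continuous_intros b) auto
  then obtain L where L: "\<And>u. u \<in> {0..T} \<Longrightarrow> e u \<le> L"
    using compact_continuous_image[of "{0..T}" e] compact_imp_bounded[THEN bounded_imp_bdd_above] bdd_above_def
    by (metis (no_types, lifting) compact_Icc image_eqI)
  have e0: "0 < e u" for u by (simp add: e_def)
  have L0: "0 \<le> L" using L[of 0] e0[of 0] T by simp
  have \<mu>c: "continuous_on {0..T} (\<lambda>u. \<mu> (x u))"
    by (rule continuous_on_compose2[OF cont(2) x(1)]) (use x(2) in auto)
  let ?\<Delta> = "e T * f (x T) - e 0 * f (x 0)"
  \<comment> \<open>In units of \<open>\<epsilon>\<close>: 2 pays for the sums of
    \<open>e f1 q\<close> and of the multiples of \<open>\<beta>^2 - h\<close>. In the factor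
    \<open>2 * T + 2\<close>, the part \<open>2 * T + 1\<close> bounds the sum of
    \<open>\<beta>^2 + h\<close>, and the remaining 1 bounds the sum of
    \<open>q^2 / \<epsilon>\<close> once the sum of \<open>q^2\<close> is below
    \<open>\<epsilon>^2\<close>.\<close>
  define C where "C = 2 + L * (1200 * K ^ 4) * (2 * T + 2)"
  have C0: "0 \<le> C" unfolding C_def using L0 T by (intro add_nonneg_nonneg mult_nonneg_nonneg) auto
  have key: "\<bar>?\<Delta>\<bar> \<le> C * \<epsilon>" if \<epsilon>: "0 < \<epsilon>" "\<epsilon> \<le> 1" for \<epsilon>
  proof -
    have "uniformly_continuous_on {0..R} f2"
      by (intro compact_uniformly_continuous continuous_on_subset[OF fc(3)]) auto
    then obtain \<eta> where \<eta>: "0 < \<eta>" "\<And>y z. y \<in> {0..R} \<Longrightarrow> z \<in> {0..R} \<Longrightarrow> \<bar>z - y\<bar> < \<eta> \<Longrightarrow> \<bar>f2 z - f2 y\<bar> < \<epsilon>"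
      unfolding uniformly_continuous_on_def dist_real_def using \<epsilon>(1) by metis
    have uc: "\<exists>\<delta>>0. \<forall>u\<in>{0..T}. \<forall>v\<in>{0..T}. \<bar>v - u\<bar> < \<delta> \<longrightarrow> \<bar>g v - g u\<bar> < \<epsilon>'" if "continuous_on {0..T} g" "0 < \<epsilon>'" for g :: "real \<Rightarrow> real" and \<epsilon>'
      using compact_uniformly_continuous[OF that(1)] that(2) unfolding uniformly_continuous_on_def dist_real_def by blast
    have "0 < min \<epsilon> \<eta>" using \<epsilon> \<eta> by simp
    obtain \<delta>1 where \<delta>1: "\<delta>1 > 0" "\<forall>u\<in>{0..T}. \<forall>v\<in>{0..T}. \<bar>v - u\<bar> < \<delta>1 \<longrightarrow> \<bar>x v - x u\<bar> < min \<epsilon> \<eta>"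
      using uc[OF x(1) \<open>0 < min \<epsilon> \<eta>\<close>] by blast
    obtain \<delta>2 where \<delta>2: "\<delta>2 > 0" "\<forall>u\<in>{0..T}. \<forall>v\<in>{0..T}. \<bar>v - u\<bar> < \<delta>2 \<longrightarrow> \<bar>b v - b u\<bar> < \<epsilon>"
      using uc[OF b \<epsilon>(1)] by blast
    obtain \<delta>3 where \<delta>3: "\<delta>3 > 0" "\<forall>u\<in>{0..T}. \<forall>v\<in>{0..T}. \<bar>v - u\<bar> < \<delta>3 \<longrightarrow> \<bar>\<mu> (x v) - \<mu> (x u)\<bar> < \<epsilon>"
      using uc[OF \<mu>c \<epsilon>(1)] by blast
    let ?A1 = "\<lambda>k. \<Sum>i<N k. e (p k i) * f1 (x (p k i)) * q k i"
    let ?A2 = "\<lambda>k. \<Sum>i<N k. (q k i)\<^sup>2"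
    let ?A3 = "\<lambda>k. \<Sum>i<N k. e (p k i) * (f (x (p k i)) / 2 - f1 (x (p k i)) * \<mu> (x (p k i))) * ((\<beta> k i)\<^sup>2 - h k)"
    let ?A4 = "\<lambda>k. \<Sum>i<N k. (\<beta> k i)\<^sup>2"
    have "eventually (\<lambda>k. h k < min (min \<delta>1 \<delta>2) (min \<delta>3 (\<epsilon>\<^sup>2))) sequentially"
      by (rule order_tendstoD(2)[OF hlim]) (use \<delta>1(1) \<delta>2(1) \<delta>3(1) \<epsilon>(1) in simp)
    moreover have "eventually (\<lambda>k. \<bar>?A1 k\<bar> < \<epsilon>) sequentially"
      using order_tendstoD(2)[OF tendsto_rabs_zero[OF A1] \<epsilon>(1)] .
    moreover have "eventually (\<lambda>k. ?A2 k < \<epsilon>\<^sup>2) sequentially"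
      using order_tendstoD(2)[OF A2] \<epsilon>(1) by simp
    moreover have "eventually (\<lambda>k. \<bar>?A3 k\<bar> < \<epsilon>) sequentially"
      using order_tendstoD(2)[OF tendsto_rabs_zero[OF A3] \<epsilon>(1)] unfolding h_def .
    moreover have "eventually (\<lambda>k. ?A4 k < T + 1) sequentially"
      using order_tendstoD(2)[OF A4, of "T + 1"] by simp
    ultimately have "eventually (\<lambda>k. \<bar>?\<Delta>\<bar> \<le> C * \<epsilon>) sequentially"
    proof eventually_elim
      case (elim k)
      let ?D = "\<lambda>i. e (p k (Suc i)) * f (x (p k (Suc i))) - e (p k i) * f (x (p k i))"
      let ?E1 = "\<lambda>i. e (p k i) * f1 (x (p k i)) * q k i"
      let ?E3 = "\<lambda>i. e (p k i) * (f (x (p k i)) / 2 - f1 (x (p k i)) * \<mu> (x (p k i))) * ((\<beta> k i)\<^sup>2 - h k)"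
      have step: "\<bar>?D i - ?E1 i - ?E3 i\<bar> \<le> L * (1200 * K ^ 4) * (\<epsilon> * ((\<beta> k i)\<^sup>2 + h k) + (q k i)\<^sup>2 / \<epsilon>)" if i: "i < N k" for i
      proof -
        let ?u = "p k i" and ?v = "p k (Suc i)"
        have uv: "?u \<in> {0..T}" "?v \<in> {0..T}" "?v = ?u + h k" using pT[of i k] pT[of "Suc i" k] i pS by auto
        have near: "\<bar>w - ?u\<bar> < \<delta>1" "\<bar>w - ?u\<bar> < \<delta>2" "\<bar>w - ?u\<bar> < \<delta>3" "w \<in> {0..T}" if "w \<in> {?u..?v}" for w
          using that elim(1) uv by auto
        have v: "?v \<in> {?u..?v}" using uv h0[of k] by auto
        have mm: "\<bar>m k i - \<mu> (x ?u) * h k\<bar> \<le> \<epsilon> * h k" and mK: "\<bar>m k i\<bar> \<le> K * h k"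
        proof -
          have int: "(\<lambda>u. \<mu> (x u)) integrable_on {?u..?v}"
            by (intro integrable_continuous_interval continuous_on_subset[OF \<mu>c]) (use near in auto)
          have sub: "{?u..?v} \<subseteq> {0..T}" using near(4) by blast
          have le: "?u \<le> ?v" using h0[of k] uv(3) by simp
          have "norm (\<mu> (x w) - \<mu> (x ?u)) \<le> \<epsilon>" if "w \<in> {?u..?v}" for w
            using \<delta>3(2) near[OF that] uv(1) by (simp add: less_imp_le)
          then have "\<bar>integral {?u..?v} (\<lambda>u. \<mu> (x u) - \<mu> (x ?u))\<bar> \<le> \<epsilon> * (?v - ?u)"
            using integral_bound[OF le, of "\<lambda>u. \<mu> (x u) - \<mu> (x ?u)" \<epsilon>]
            by (simp add: continuous_on_diff continuous_on_subset[OF \<mu>c sub])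
          then show "\<bar>m k i - \<mu> (x ?u) * h k\<bar> \<le> \<epsilon> * h k"
            using integral_diff[OF int integrable_const_ivl[of "\<mu> (x ?u)" ?u ?v]] uv(3) h0[of k]
            by (simp add: m_def mult.commute)
          have "norm (\<mu> (x w)) \<le> K" if "w \<in> {?u..?v}" for w
            using K(6)[OF xR[OF near(4)[OF that]]] by simp
          then have "\<bar>integral {?u..?v} (\<lambda>u. \<mu> (x u))\<bar> \<le> K * (?v - ?u)"
            using integral_bound[OF le, of "\<lambda>u. \<mu> (x u)" K] by (simp add: continuous_on_subset[OF \<mu>c sub])
          then show "\<bar>m k i\<bar> \<le> K * h k" using uv(3) by (simp add: m_def)
        qed
        have xd: "\<bar>x ?v - x ?u\<bar> < min \<epsilon> \<eta>" "\<bar>\<beta> k i\<bar> < \<epsilon>"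
          using \<delta>1(2) \<delta>2(2) uv near[OF v] unfolding \<beta>_def by auto
        have tay: "\<bar>f (x ?v) - f (x ?u) - f1 (x ?u) * (x ?v - x ?u) - f2 (x ?u) * (x ?v - x ?u)\<^sup>2 / 2\<bar> \<le> \<epsilon> * (x ?v - x ?u)\<^sup>2"
        proof (rule taylor2_bound[OF f x(2)[OF uv(1)] x(2)[OF uv(2)]])
          fix z assume "z \<in> closed_segment (x ?u) (x ?v)"
          then have "z \<in> {0..R}" "\<bar>z - x ?u\<bar> < \<eta>"
            using xd(1) xR[OF uv(1)] xR[OF uv(2)] by (auto simp: closed_segment_eq_real_ivl split: if_splits)
          then show "\<bar>f2 z - f2 (x ?u)\<bar> \<le> \<epsilon>" using \<eta>(2)[OF xR[OF uv(1)]] less_imp_le by blast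
        qed
        have Z: "\<bar>exp (- \<beta> k i - h k / 2) * f (x ?v) - f (x ?u) -
           (f1 (x ?u) * q k i + (f (x ?u) / 2 - f1 (x ?u) * \<mu> (x ?u)) * ((\<beta> k i)\<^sup>2 - h k))\<bar> \<le>
           1200 * K ^ 4 * (\<epsilon> * ((\<beta> k i)\<^sup>2 + h k) + (q k i)\<^sup>2 / \<epsilon>)" (is "\<bar>?Z\<bar> \<le> ?Y")
        proof (rule ito_step_young[OF _ eq[OF x(2)[OF uv(1)]] tay K(2-5)[OF xR[OF uv(1)]] K(1)])
          show "x ?v - x ?u = \<sigma> (x ?u) * \<beta> k i + q k i + m k i" by (simp add: q_def)
          show "\<bar>\<beta> k i\<bar> \<le> \<epsilon>" "\<bar>x ?v - x ?u\<bar> \<le> \<epsilon>" "0 \<le> h k" "h k \<le> \<epsilon>\<^sup>2"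
            using xd h0[of k] elim(1) by auto
        qed (fact \<epsilon> mK mm)+
        \<comment> \<open>The factor \<open>e\<close> is multiplicative in its increments, so
          \<open>e ?u\<close> can be pulled out of the whole step and bounded by
          \<open>L\<close>.\<close>
        have "e ?v = e ?u * exp (- \<beta> k i - h k / 2)"
          unfolding e_def \<beta>_def exp_add[symmetric] uv(3) by (simp add: field_simps)
        then have D: "?D i - ?E1 i - ?E3 i = e ?u * ?Z" by (simp add: field_simps)
        show ?thesis
          unfolding D abs_mult[of "e ?u"] mult.assoc[of L] using L[OF uv(1)] e0[of ?u] L0
          by (intro mult_mono Z) auto
      qed
      have "?\<Delta> = (\<Sum>i<N k. ?D i)"
        using sum_lessThan_telescope[of "\<lambda>i. e (p k i) * f (x (p k i))" "N k"] p0 by simp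
      also have "\<dots> = (\<Sum>i<N k. ?D i - ?E1 i - ?E3 i) + ?A1 k + ?A3 k"
        by (simp add: sum_subtractf)
      finally have "\<bar>?\<Delta>\<bar> \<le> \<bar>\<Sum>i<N k. ?D i - ?E1 i - ?E3 i\<bar> + \<epsilon> + \<epsilon>" using elim(2,4) by linarith
      also have "\<bar>\<Sum>i<N k. ?D i - ?E1 i - ?E3 i\<bar> \<le> (\<Sum>i<N k. L * (1200 * K ^ 4) * (\<epsilon> * ((\<beta> k i)\<^sup>2 + h k) + (q k i)\<^sup>2 / \<epsilon>))"
        by (rule order.trans[OF sum_abs sum_mono]) (use step in auto)
      also have "\<dots> = L * (1200 * K ^ 4) * (\<epsilon> * (?A4 k + T) + ?A2 k / \<epsilon>)"
        using N(1)[of k] by (simp add: sum_distrib_left[symmetric] sum.distrib sum_divide_distrib[symmetric] h_def)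
      also have "\<dots> \<le> L * (1200 * K ^ 4) * (\<epsilon> * (T + 1 + T) + \<epsilon>)"
      proof (rule mult_left_mono)
        have "?A2 k / \<epsilon> \<le> \<epsilon>" using elim(3) \<epsilon>(1) by (simp add: divide_le_eq power2_eq_square)
        moreover have "\<epsilon> * (?A4 k + T) \<le> \<epsilon> * (T + 1 + T)" using elim(5) \<epsilon>(1) by (intro mult_left_mono) auto
        ultimately show "\<epsilon> * (?A4 k + T) + ?A2 k / \<epsilon> \<le> \<epsilon> * (T + 1 + T) + \<epsilon>" by linarith
      qed (use L0 in auto)
      finally show ?case unfolding C_def by (simp add: algebra_simps)
    qed
    \<comment> \<open>The estimate no longer mentions \<open>k\<close>, so a single partition for
      which it holds is enough.\<close>
    then show ?thesis using eventually_happens[of _ sequentially] by auto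
  qed
  have "\<bar>?\<Delta>\<bar> \<le> 0"
  proof (rule field_le_epsilon)
    fix r :: real assume r: "0 < r"
    have "\<bar>?\<Delta>\<bar> \<le> C * min 1 (r / (C + 1))" using r C0 by (intro key) auto
    also have "\<dots> \<le> C * (r / (C + 1))" using C0 by (intro mult_left_mono) auto
    also have "\<dots> \<le> r" using C0 r by (simp add: divide_le_eq field_simps)
    finally show "\<bar>?\<Delta>\<bar> \<le> 0 + r" by simp
  qed
  then show ?thesis by simp
qed

section \<open>The exponential of a primitive\<close>

lemma C1_on_continuous: "C1_on D f f' \<Longrightarrow> continuous_on D f" "C1_on D f f' \<Longrightarrow> continuous_on D f'"
  unfolding C1_on_def by (auto intro: DERIV_continuous_on)

lemma eq_on_atLeast_0:
  fixes g h :: "real \<Rightarrow> real"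
  assumes "continuous_on {0..} g" "continuous_on {0..} h" "\<And>y. 0 < y \<Longrightarrow> g y = h y" "0 \<le> y"
  shows "g y = h y"
  using continuous_constant_on_closure[of "{0<..}" "\<lambda>y. g y - h y" 0 y] assms
  by (simp add: continuous_on_diff)

lemma C1_on_at:
  assumes "C1_on {0..} f f'" "0 < (y::real)"
  shows "(f has_real_derivative f' y) (at y)"
proof -
  have "(f has_real_derivative f' y) (at y within {0..})" using assms by (simp add: C1_on_def)
  then show ?thesis using assms(2) at_within_interior[of y "{0..}"] by simp
qed

lemma exp_primitive_has_derivative:
  fixes \<sigma> f :: "real \<Rightarrow> real"
  assumes ep: "exp_primitive a \<sigma> f" and \<sigma>: "continuous_on {0..} \<sigma>" "\<forall>y>0. \<bar>\<sigma> y\<bar> > 0" and y: "0 < y"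
  shows "(f has_real_derivative f y / \<sigma> y) (at y)"
proof -
  have a: "0 \<le> a" and int: "\<And>z. 0 < z \<Longrightarrow> interval_lebesgue_integrable lborel (ereal a) (ereal z) (\<lambda>z. inverse (\<sigma> z))"
    and f: "\<And>z. 0 < z \<Longrightarrow> f z = exp (LBINT z=ereal a..ereal z. inverse (\<sigma> z))"
    using ep unfolding exp_primitive_def by auto
  \<comment> \<open>For \<open>a = 0\<close> the function \<open>1 / \<sigma>\<close> may be
    singular at the base point. The fundamental theorem of calculus is therefore applied from an
    interior point \<open>c\<close>, and the integral from \<open>a\<close> to \<open>c\<close> is a
    constant that disappears on differentiation. The interval from \<open>l\<close> to
    \<open>r\<close> stays inside the positive half-line, where \<open>1 / \<sigma>\<close> is
    continuous.\<close>
  define l c where "l = (if a = 0 then y / 2 else min a y / 2)" and "c = (if a = 0 then y / 2 else a)"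
  define r where "r = a + y + 1"
  have lcr: "0 < l" "l \<le> c" "c \<le> r" "l < y" "y < r" using a y unfolding l_def c_def r_def by auto
  have cont: "continuous_on {l..r} (\<lambda>z. inverse (\<sigma> z))"
    using lcr \<sigma> by (intro continuous_on_inverse continuous_on_subset[OF \<sigma>(1)]) force+
  have split: "(LBINT z=ereal a..ereal z. inverse (\<sigma> z)) =
      (LBINT z=ereal a..ereal c. inverse (\<sigma> z)) + (LBINT z=ereal c..ereal z. inverse (\<sigma> z))" if z: "l < z" "z < r" for z
  proof (cases "a = 0")
    case True
    then have "interval_lebesgue_integrable lborel (min (ereal a) (min (ereal c) (ereal z))) (max (ereal a) (max (ereal c) (ereal z))) (\<lambda>z. inverse (\<sigma> z))"
      using z lcr int[of z] int[of c] by (simp add: min_def max_def)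
    then show ?thesis using interval_integral_sum by metis
  next
    case False
    then show ?thesis by (simp add: c_def)
  qed
  have "((\<lambda>u. LBINT z=ereal c..ereal u. inverse (\<sigma> z)) has_vector_derivative inverse (\<sigma> y)) (at y within {l..r})"
    by (rule interval_integral_FTC2[OF lcr(2,3) cont]) (use lcr in auto)
  then have D: "((\<lambda>u. LBINT z=ereal c..ereal u. inverse (\<sigma> z)) has_real_derivative inverse (\<sigma> y)) (at y)"
    using lcr at_within_interior[of y "{l..r}"] by (simp add: has_real_derivative_iff_has_vector_derivative)
  have "((\<lambda>u. exp ((LBINT z=ereal a..ereal c. inverse (\<sigma> z)) + (LBINT z=ereal c..ereal u. inverse (\<sigma> z)))) has_real_derivative f y / \<sigma> y) (at y)"
    by (rule derivative_eq_intros D refl)+ (use f[OF y] split[of y] lcr in \<open>simp add: divide_inverse\<close>)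
  then show ?thesis
    by (rule has_field_derivative_transform_within_open[where S="{l<..<r}"]) (use f split lcr in auto)
qed

text \<open>Differentiating \<open>f' \<sigma> = f\<close> gives
  \<open>f'' \<sigma> + f' \<sigma>' = f'\<close>. Multiplied by \<open>\<sigma> / 2\<close> and
  increased by \<open>f' \<sigma> / 2\<close>, this is the second equation, which is where the form
  \<open>\<mu> = \<sigma> (1 + \<sigma>') / 2\<close> comes from. At 0 the coefficient
  \<open>\<sigma>\<close> may vanish, so the equations are kept free of division and extended by
  continuity.\<close>

lemma exp_primitive_equations:
  fixes \<sigma> \<sigma>' \<mu> f f1 f2 :: "real \<Rightarrow> real"
  assumes ep: "exp_primitive a \<sigma> f" and \<sigma>: "C1_on {0..} \<sigma> \<sigma>'" "\<forall>y>0. \<bar>\<sigma> y\<bar> > 0"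
    and \<mu>: "\<forall>y\<ge>0. \<mu> y = \<sigma> y / 2 * (1 + \<sigma>' y)"
    and f: "C1_on {0..} f f1" "C1_on {0..} f1 f2" and y: "0 \<le> y"
  shows "f1 y * \<sigma> y = f y" "f2 y * (\<sigma> y)\<^sup>2 / 2 + f1 y * \<mu> y = f y"
proof -
  note c = C1_on_continuous[OF \<sigma>(1)] C1_on_continuous[OF f(1)] C1_on_continuous[OF f(2)]
  have 1: "f1 z * \<sigma> z = f z" if "0 < z" for z
  proof -
    have "f1 z = f z / \<sigma> z"
      using DERIV_unique[OF C1_on_at[OF f(1) that] exp_primitive_has_derivative[OF ep c(1) \<sigma>(2) that]] .
    then show ?thesis using \<sigma>(2) that by auto
  qed
  have 2: "f2 z * \<sigma> z + f1 z * \<sigma>' z = f1 z" if z: "0 < z" for z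
  proof -
    have "((\<lambda>z. f1 z * \<sigma> z) has_real_derivative f2 z * \<sigma> z + f1 z * \<sigma>' z) (at z)"
      using DERIV_mult[OF C1_on_at[OF f(2) z] C1_on_at[OF \<sigma>(1) z]] by (simp add: mult.commute add.commute)
    then have "(f has_real_derivative f2 z * \<sigma> z + f1 z * \<sigma>' z) (at z)"
      by (rule has_field_derivative_transform_within_open[where S="{0<..}"]) (use z 1 in auto)
    then show ?thesis using DERIV_unique C1_on_at[OF f(1) z] by blast
  qed
  show e1: "f1 y * \<sigma> y = f y"
    by (rule eq_on_atLeast_0[of "\<lambda>z. f1 z * \<sigma> z" f]) (use c 1 y in \<open>auto intro: continuous_intros\<close>)
  have e2: "f2 y * \<sigma> y + f1 y * \<sigma>' y = f1 y"
    by (rule eq_on_atLeast_0[of "\<lambda>z. f2 z * \<sigma> z + f1 z * \<sigma>' z" f1]) (use c 2 y in \<open>auto intro!: continuous_intros\<close>)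
  have "f2 y * (\<sigma> y)\<^sup>2 / 2 + f1 y * \<mu> y = \<sigma> y / 2 * (f2 y * \<sigma> y + f1 y * \<sigma>' y) + f1 y * \<sigma> y / 2"
    unfolding \<mu>[rule_format, OF y] by (simp add: power2_eq_square field_simps)
  also have "\<dots> = f y" unfolding e2 using e1 by (simp add: mult.commute)
  finally show "f2 y * (\<sigma> y)\<^sup>2 / 2 + f1 y * \<mu> y = f y" .
qed

text \<open>The right-hand side depends on \<open>t\<close> alone, which allows Brownian motions on
  spaces of different types to be compared. At time 0 the law is a point mass and has no
  density.\<close>

lemma (in brownian) distr_B:
  assumes "0 \<le> t"
  shows "distr M borel (B t) = (if t = 0 then return borel 0 else density lborel (\<lambda>y. ennreal (normal_density 0 (sqrt t) y)))"
proof -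
  have B0: "AE \<omega> in M. B 0 \<omega> = 0" using bm by (simp add: brownian_motion_def)
  have [measurable]: "B t \<in> borel_measurable M" "B 0 \<in> borel_measurable M" using assms by auto
  show ?thesis
  proof (cases "t = 0")
    case True
    have "distr M borel (B 0) = distr M borel (\<lambda>_. 0)"
      by (rule distr_cong_AE) (use B0 in auto)
    then show ?thesis using True by simp
  next
    case False
    then have t: "0 < t" using assms by simp
    have "distr M borel (B t) = distr M lborel (\<lambda>\<omega>. B t \<omega> - B 0 \<omega>)"
      by (rule distr_cong_AE) (use B0 in auto)
    also have "\<dots> = density lborel (\<lambda>y. ennreal (normal_density 0 (sqrt t) y))"
      using distributed_distr_eq_density[OF increment_distributed[of 0 t]] t by simp
    finally show ?thesis using False by simp
  qed
qed

lemma bounded_abs_on_Icc: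
  fixes g :: "real \<Rightarrow> real"
  assumes "continuous_on {a..b} g"
  obtains K where "\<And>y. y \<in> {a..b} \<Longrightarrow> \<bar>g y\<bar> \<le> K"
proof -
  obtain K where "\<forall>y\<in>{a..b}. \<bar>g y\<bar> \<le> K"
    using compact_imp_bounded[OF compact_continuous_image[OF assms compact_Icc]] by (auto simp: bounded_iff)
  then show thesis by (intro that[of K]) blast
qed

section \<open>The exponential formula for the diffusion\<close>

context brownian
begin

text \<open>The order of choices matters. For each level \<open>R\<close> there is a subsequence
  along which the sums stopped at \<open>R\<close> converge off a null set. The levels are natural
  numbers, so all of them share one null set. Only then is \<open>R\<close> chosen, depending on the
  path and so large that the path never leaves the bounded set before \<open>T\<close>: all
  \<open>\<theta>\<close> equal 1 and the stopped sums are the true ones.\<close>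

lemma ito_exp_formula:
  assumes ws: "weak_solution {0..} \<sigma> \<mu> x M F B X" and cont: "continuous_on {0..} \<sigma>" "continuous_on {0..} \<mu>"
    and f: "C1_on {0..} f f1" "C1_on {0..} f1 f2"
    and eq: "\<And>y. 0 \<le> y \<Longrightarrow> f1 y * \<sigma> y = f y" "\<And>y. 0 \<le> y \<Longrightarrow> f2 y * (\<sigma> y)\<^sup>2 / 2 + f1 y * \<mu> y = f y"
    and H2: "(\<integral>\<^sup>+\<omega>. (\<integral>\<^sup>+u\<in>{0..T}. ennreal ((\<sigma> (X u \<omega>))\<^sup>2) \<partial>lborel) \<partial>M) < \<infinity>"
    and T: "0 < T"
  shows "AE \<omega> in M. f (X T \<omega>) = f x * exp (B T \<omega> + T / 2)"
proof -
  have XF: "\<And>t. 0 \<le> t \<Longrightarrow> X t \<in> borel_measurable (F t)"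
    and Xc: "\<And>\<omega>. \<omega> \<in> space M \<Longrightarrow> continuous_on {0..} (\<lambda>t. X t \<omega>)"
    and X0: "\<And>t \<omega>. 0 \<le> t \<Longrightarrow> \<omega> \<in> space M \<Longrightarrow> 0 \<le> X t \<omega>"
    and Xx: "AE \<omega> in M. X 0 \<omega> = x"
    using ws unfolding weak_solution_def adapted_def continuous_paths_def by auto
  have Bc: "\<And>\<omega>. \<omega> \<in> space M \<Longrightarrow> continuous_on {0..} (\<lambda>t. B t \<omega>)" and B0: "AE \<omega> in M. B 0 \<omega> = 0"
    using bm unfolding brownian_motion_def continuous_paths_def by auto
  have "\<exists>I. \<forall>t. 0 \<le> t \<longrightarrow> ito_integral M F B t (\<lambda>u \<omega>. \<sigma> (X u \<omega>)) (I t) \<and>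
    (AE \<omega> in M. X t \<omega> = x + I t \<omega> + (LINT u:{0..t}|lborel. \<mu> (X u \<omega>)))"
    by (rule choice) (use ws in \<open>auto simp: weak_solution_def\<close>)
  then obtain I where I: "\<And>t. 0 \<le> t \<Longrightarrow> ito_integral M F B t (\<lambda>u \<omega>. \<sigma> (X u \<omega>)) (I t)"
    and XI: "\<And>t. 0 \<le> t \<Longrightarrow> AE \<omega> in M. X t \<omega> = x + I t \<omega> + (LINT u:{0..t}|lborel. \<mu> (X u \<omega>))"
    by blast
  have gF: "(\<lambda>\<omega>. g (X t \<omega>)) \<in> borel_measurable (F t)" if g: "continuous_on {0..} g" and t: "0 \<le> t" for g :: "real \<Rightarrow> real" and t
  proof -
    \<comment> \<open>Continuity of \<open>g\<close> is known on the half-line only. Composition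
      with \<open>max 0\<close> extends it to all reals without changing it on the range of
      \<open>X\<close>.\<close>
    have "(\<lambda>y. g (max 0 y)) \<in> borel_measurable borel"
      by (intro borel_measurable_continuous_onI continuous_on_compose2[OF g]) (auto intro!: continuous_intros)
    from measurable_compose[OF XF[OF t] this] show ?thesis
      by (rule measurable_cong[THEN iffD1, rotated]) (use X0 t in \<open>simp add: max_absorb2\<close>)
  qed
  have fc: "continuous_on {0..} f" "continuous_on {0..} f1" using C1_on_continuous f by blast+
  define p where "p n i = T * real i / real (Suc n)" for n i :: nat
  define e where "e u \<omega> = exp (- B u \<omega> - u / 2)" for u \<omega>
  define Q where "Q n i \<omega> = I (p n (Suc i)) \<omega> - I (p n i) \<omega> - \<sigma> (X (p n i) \<omega>) * (B (p n (Suc i)) \<omega> - B (p n i) \<omega>)" for n i \<omega>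
  have p0: "0 \<le> p n i" "p n i \<le> p n (Suc i)" for n i
    using T unfolding p_def by (auto intro!: divide_right_mono)
  have pmono: "p n i \<le> p n j" if "i \<le> j" for n i j
    using T that unfolding p_def by (intro divide_right_mono mult_left_mono) auto
  have pT: "p n i \<in> {0..T}" if "i \<le> Suc n" for n i
    using p0(1)[of n i] pmono[OF that, of n] by (simp add: p_def)
  have eF: "e t \<in> borel_measurable (F t)" if "0 \<le> t" for t
    unfolding e_def[abs_def] using B_measurable[OF that] by measurable
  \<comment> \<open>The test runs over the partition points up to and including
    \<open>p n i\<close>. It is therefore known at that time, and including the point itself is what
    bounds the coefficients evaluated there.\<close>
  define \<theta> where "\<theta> R n i \<omega> = (if \<forall>j\<in>{..i}. \<bar>X (p n j) \<omega>\<bar> \<le> real R \<and> \<bar>B (p n j) \<omega>\<bar> \<le> real R then 1 else 0 :: real)" for R n i \<omega>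
  define d1 where "d1 R n i \<omega> = \<theta> R n i \<omega> * (e (p n i) \<omega> * f1 (X (p n i) \<omega>))" for R n i \<omega>
  define d2 where "d2 R n i \<omega> = \<theta> R n i \<omega> * (e (p n i) \<omega> * (f (X (p n i) \<omega>) / 2 - f1 (X (p n i) \<omega>) * \<mu> (X (p n i) \<omega>)))" for R n i \<omega>
  have \<theta>F: "\<theta> R n i \<in> borel_measurable (F (p n i))" for R n i
  proof -
    have [measurable]: "X (p n j) \<in> borel_measurable (F (p n i))" "B (p n j) \<in> borel_measurable (F (p n i))" if "j \<in> {..i}" for j
      using measurable_F_mono[OF XF[OF p0(1)] pmono] measurable_F_mono[OF B_measurable[OF p0(1)] pmono] that by auto
    show ?thesis unfolding \<theta>_def[abs_def]
      by (intro measurable_If borel_measurable_const pred_intros_countable_bounded) measurable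
  qed
  define lims where "lims R s \<omega> \<longleftrightarrow>
    (\<lambda>k. \<Sum>i<Suc (s k). d1 R (s k) i \<omega> * (\<theta> R (s k) i \<omega> * Q (s k) i \<omega>)) \<longlonglongrightarrow> 0 \<and>
    (\<lambda>k. \<Sum>i<Suc (s k). (\<theta> R (s k) i \<omega> * Q (s k) i \<omega>)\<^sup>2) \<longlonglongrightarrow> 0 \<and>
    (\<lambda>k. \<Sum>i<Suc (s k). d2 R (s k) i \<omega> * ((B (p (s k) (Suc i)) \<omega> - B (p (s k) i) \<omega>)\<^sup>2 - T / real (Suc (s k)))) \<longlonglongrightarrow> 0 \<and>
    (\<lambda>k. \<Sum>i<Suc (s k). (B (p (s k) (Suc i)) \<omega> - B (p (s k) i) \<omega>)\<^sup>2) \<longlonglongrightarrow> T" for R and s :: "nat \<Rightarrow> nat" and \<omega>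
  have sums: "\<exists>r. strict_mono r \<and> (AE \<omega> in M. lims R r \<omega>)" for R :: nat
  proof -
    have sub: "{0..real R} \<subseteq> {0..}" by auto
    obtain K0 where K0: "\<And>y. y \<in> {0..real R} \<Longrightarrow> \<bar>f y\<bar> \<le> K0" using bounded_abs_on_Icc[OF continuous_on_subset[OF fc(1) sub]] by blast
    obtain K1 where K1: "\<And>y. y \<in> {0..real R} \<Longrightarrow> \<bar>f1 y\<bar> \<le> K1" using bounded_abs_on_Icc[OF continuous_on_subset[OF fc(2) sub]] by blast
    obtain K2 where K2: "\<And>y. y \<in> {0..real R} \<Longrightarrow> \<bar>\<sigma> y\<bar> \<le> K2" using bounded_abs_on_Icc[OF continuous_on_subset[OF cont(1) sub]] by blast
    obtain K3 where K3: "\<And>y. y \<in> {0..real R} \<Longrightarrow> \<bar>\<mu> y\<bar> \<le> K3" using bounded_abs_on_Icc[OF continuous_on_subset[OF cont(2) sub]] by blast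
    have "0 \<in> {0..real R}" by simp
    then have Kp: "0 \<le> K0" "0 \<le> K1" "0 \<le> K2" "0 \<le> K3"
      using K0 K1 K2 K3 abs_ge_zero order.trans by blast+
    \<comment> \<open>One constant above three bounds: for \<open>\<sigma>\<close>, for the weight
      \<open>e f1\<close> and for the weight \<open>e (f / 2 - f1 \<mu>)\<close>. On the surviving
      event \<open>- B - u / 2\<close> is at most \<open>R\<close>, hence the factor
      \<open>exp (real R)\<close>.\<close>
    define C where "C = K2 + exp (real R) * K1 + exp (real R) * (K0 / 2 + K1 * K3)"
    have C: "K2 \<le> C" "exp (real R) * K1 \<le> C" "exp (real R) * (K0 / 2 + K1 * K3) \<le> C" "0 \<le> C"
      unfolding C_def using Kp by auto
    have on: "X (p n i) \<omega> \<in> {0..real R} \<and> e (p n i) \<omega> \<le> exp (real R)" if "\<theta> R n i \<omega> \<noteq> 0" "\<omega> \<in> space M" for n i \<omega>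
    proof -
      have "\<forall>j\<in>{..i}. \<bar>X (p n j) \<omega>\<bar> \<le> real R \<and> \<bar>B (p n j) \<omega>\<bar> \<le> real R"
        using that(1) unfolding \<theta>_def by (simp split: if_splits)
      then have "\<bar>X (p n i) \<omega>\<bar> \<le> real R" "\<bar>B (p n i) \<omega>\<bar> \<le> real R" by auto
      then show ?thesis using X0[OF p0(1) that(2), of n i] p0(1)[of n i] unfolding e_def by auto
    qed
    have \<theta>01: "\<theta> R n i \<omega> = 0 \<or> \<theta> R n i \<omega> = 1" for n i \<omega> unfolding \<theta>_def by simp
    have e0: "0 \<le> e u \<omega>" for u \<omega> unfolding e_def by simp
    show ?thesis
      unfolding lims_def Q_def
    proof (rule ito_sums_converge[OF T, where H="\<lambda>u \<omega>. \<sigma> (X u \<omega>)" and \<theta>="\<theta> R" and c="d1 R" and e="d2 R" and C=C and I=I, folded p_def])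
      show "ito_integral M F B t (\<lambda>u \<omega>. \<sigma> (X u \<omega>)) (I t)" if "0 \<le> t" for t using I[OF that] .
      show "(\<lambda>\<omega>. \<sigma> (X t \<omega>)) \<in> borel_measurable (F t)" if "0 \<le> t" for t using gF[OF cont(1) that] .
      show "(\<integral>\<^sup>+\<omega>. sq_int T (\<lambda>u \<omega>. \<sigma> (X u \<omega>)) \<omega> \<partial>M) < \<infinity>" using H2 unfolding sq_int_def .
      show "continuous_on {0..T} (\<lambda>u. \<sigma> (X u \<omega>))" if "\<omega> \<in> space M" for \<omega>
        by (rule continuous_on_compose2[OF cont(1) continuous_on_subset[OF Xc[OF that]]]) (use X0 that in auto)
      show "\<theta> R n i \<in> borel_measurable (F (p n i))" for n i by (rule \<theta>F)
      show "\<theta> R n i \<omega> \<in> {0, 1}" for n i \<omega> using \<theta>01 by blast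
      show "d1 R n i \<in> borel_measurable (F (p n i))" "d2 R n i \<in> borel_measurable (F (p n i))" for n i
        unfolding d1_def[abs_def] d2_def[abs_def]
        using \<theta>F[of R n i] eF[OF p0(1)[of n i]] gF[OF fc(1) p0(1)[of n i]] gF[OF fc(2) p0(1)[of n i]] gF[OF cont(2) p0(1)[of n i]]
        by (auto intro!: borel_measurable_times borel_measurable_diff borel_measurable_divide)
      fix n i \<omega> assume w: "\<omega> \<in> space M"
      let ?y = "X (p n i) \<omega>"
      show "\<bar>\<theta> R n i \<omega> * \<sigma> ?y\<bar> \<le> C"
        using \<theta>01[of n i \<omega>] on[OF _ w, of n i] K2[of ?y] C by auto
      have "\<bar>e (p n i) \<omega> * f1 ?y\<bar> \<le> exp (real R) * K1" if "\<theta> R n i \<omega> \<noteq> 0"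
        unfolding abs_mult using on[OF that w] K1[of ?y] e0[of "p n i" \<omega>] by (intro mult_mono) auto
      then show "\<bar>d1 R n i \<omega>\<bar> \<le> C" unfolding d1_def using \<theta>01[of n i \<omega>] C by auto
      have "\<bar>e (p n i) \<omega> * (f ?y / 2 - f1 ?y * \<mu> ?y)\<bar> \<le> exp (real R) * (K0 / 2 + K1 * K3)" if "\<theta> R n i \<omega> \<noteq> 0"
      proof -
        have y: "?y \<in> {0..real R}" using on[OF that w] by blast
        have "\<bar>f1 ?y * \<mu> ?y\<bar> \<le> K1 * K3" unfolding abs_mult by (intro mult_mono K1 K3 y Kp) auto
        then have "\<bar>f ?y / 2 - f1 ?y * \<mu> ?y\<bar> \<le> K0 / 2 + K1 * K3" using K0[OF y] by linarith
        then show ?thesis unfolding abs_mult[of "e _ _"] using on[OF that w] e0[of "p n i" \<omega>] by (intro mult_mono) auto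
      qed
      then show "\<bar>d2 R n i \<omega>\<bar> \<le> C" unfolding d2_def using \<theta>01[of n i \<omega>] C by auto
    qed
  qed
  have "\<exists>r. \<forall>R. strict_mono (r R) \<and> (AE \<omega> in M. lims R (r R) \<omega>)"
    by (rule choice) (use sums in blast)
  then obtain r where r: "\<And>R. strict_mono (r R)" and AEr: "\<And>R. AE \<omega> in M. lims R (r R) \<omega>"
    by blast
  have AEX: "AE \<omega> in M. \<forall>n i. X (p n i) \<omega> = x + I (p n i) \<omega> + (LINT u:{0..p n i}|lborel. \<mu> (X u \<omega>))"
    unfolding AE_all_countable using XI[OF p0(1)] by blast
  have "AE \<omega> in M. \<forall>R. lims R (r R) \<omega>"
    unfolding AE_all_countable using AEr by blast
  then show ?thesis
    using AEX Xx B0 AE_space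
  proof eventually_elim
    case (elim \<omega>)
    have xc: "continuous_on {0..T} (\<lambda>u. X u \<omega>)" and bc: "continuous_on {0..T} (\<lambda>u. B u \<omega>)"
      using continuous_on_subset[OF Xc[OF elim(5)], of "{0..T}"] continuous_on_subset[OF Bc[OF elim(5)], of "{0..T}"] by auto
    obtain R1 R2 where R12: "\<And>u. u \<in> {0..T} \<Longrightarrow> \<bar>X u \<omega>\<bar> \<le> R1" "\<And>u. u \<in> {0..T} \<Longrightarrow> \<bar>B u \<omega>\<bar> \<le> R2"
      using bounded_abs_on_Icc[OF xc] bounded_abs_on_Icc[OF bc] by metis
    obtain R where "max R1 R2 \<le> real R" using real_arch_simple by blast
    then have R: "\<bar>X u \<omega>\<bar> \<le> real R" "\<bar>B u \<omega>\<bar> \<le> real R" if "u \<in> {0..T}" for u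
      using R12[OF that] by auto
    have \<theta>1: "\<theta> R n i \<omega> = 1" if "i < Suc n" for n i
      unfolding \<theta>_def using R pT[of _ n] that by auto
    have \<mu>c: "continuous_on {0..T} (\<lambda>u. \<mu> (X u \<omega>))"
      by (rule continuous_on_compose2[OF cont(2) xc]) (use X0 elim(5) in auto)
    define q where "q n i = X (p n (Suc i)) \<omega> - X (p n i) \<omega> - \<sigma> (X (p n i) \<omega>) * (B (p n (Suc i)) \<omega> - B (p n i) \<omega>) -
        integral {p n i..p n (Suc i)} (\<lambda>u. \<mu> (X u \<omega>))" for n i
    \<comment> \<open>The equation for \<open>X\<close> at both ends of the cell is subtracted. Its
      Lebesgue drift integral equals the Henstock-Kurzweil integral, since the integrand is
      continuous, and that integral is additive over adjacent intervals.\<close>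
    have Qq: "Q n i \<omega> = q n i" if i: "i < Suc n" for n i
    proof -
      have L: "(LINT u:{0..t}|lborel. \<mu> (X u \<omega>)) = integral {0..t} (\<lambda>u. \<mu> (X u \<omega>))" if "t \<in> {0..T}" for t
        by (rule set_borel_integral_eq_integral(2), rule borel_integrable_atLeastAtMost', rule continuous_on_subset[OF \<mu>c])
          (use that in auto)
      have "(\<lambda>u. \<mu> (X u \<omega>)) integrable_on {0..p n (Suc i)}"
        by (intro integrable_continuous_interval continuous_on_subset[OF \<mu>c]) (use pT[of "Suc i" n] i in auto)
      then have "integral {0..p n i} (\<lambda>u. \<mu> (X u \<omega>)) + integral {p n i..p n (Suc i)} (\<lambda>u. \<mu> (X u \<omega>)) = integral {0..p n (Suc i)} (\<lambda>u. \<mu> (X u \<omega>))"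
        using p0 by (intro Henstock_Kurzweil_Integration.integral_combine) auto
      then show ?thesis
        using elim(2)[rule_format, of n i] elim(2)[rule_format, of n "Suc i"] L[OF pT[of i n]] L[OF pT[of "Suc i" n]] i
        unfolding Q_def q_def by simp
    qed
    have lim: "lims R (r R) \<omega>" using elim(1) by blast
    have "e T \<omega> * f (X T \<omega>) = e 0 \<omega> * f (X 0 \<omega>)"
    proof (rule ito_pathwise[OF T xc _ bc f cont eq, where N="\<lambda>k. Suc (r R k)", folded p_def, folded e_def q_def])
      show "0 \<le> X u \<omega>" if "u \<in> {0..T}" for u using X0[of u \<omega>] elim(5) that by simp
      show "filterlim (\<lambda>k. Suc (r R k)) at_top sequentially"
        by (rule filterlim_compose[OF filterlim_Suc filterlim_subseq[OF r]])
      have "(\<Sum>i<Suc n. d1 R n i \<omega> * (\<theta> R n i \<omega> * Q n i \<omega>)) = (\<Sum>i<Suc n. e (p n i) \<omega> * f1 (X (p n i) \<omega>) * q n i)"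
        "(\<Sum>i<Suc n. (\<theta> R n i \<omega> * Q n i \<omega>)\<^sup>2) = (\<Sum>i<Suc n. (q n i)\<^sup>2)"
        "(\<Sum>i<Suc n. d2 R n i \<omega> * ((B (p n (Suc i)) \<omega> - B (p n i) \<omega>)\<^sup>2 - T / real (Suc n))) =
          (\<Sum>i<Suc n. e (p n i) \<omega> * (f (X (p n i) \<omega>) / 2 - f1 (X (p n i) \<omega>) * \<mu> (X (p n i) \<omega>)) *
            ((B (p n (Suc i)) \<omega> - B (p n i) \<omega>)\<^sup>2 - T / real (Suc n)))" for n
        by (rule sum.cong[OF refl], simp add: d1_def d2_def \<theta>1 Qq)+
      note lim[unfolded lims_def this]
      then show "(\<lambda>k. \<Sum>i<Suc (r R k). e (p (r R k) i) \<omega> * f1 (X (p (r R k) i) \<omega>) * q (r R k) i) \<longlonglongrightarrow> 0"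
        "(\<lambda>k. \<Sum>i<Suc (r R k). (q (r R k) i)\<^sup>2) \<longlonglongrightarrow> 0"
        "(\<lambda>k. \<Sum>i<Suc (r R k). e (p (r R k) i) \<omega> * (f (X (p (r R k) i) \<omega>) / 2 - f1 (X (p (r R k) i) \<omega>) * \<mu> (X (p (r R k) i) \<omega>)) *
          ((B (p (r R k) (Suc i)) \<omega> - B (p (r R k) i) \<omega>)\<^sup>2 - T / real (Suc (r R k)))) \<longlonglongrightarrow> 0"
        "(\<lambda>k. \<Sum>i<Suc (r R k). (B (p (r R k) (Suc i)) \<omega> - B (p (r R k) i) \<omega>)\<^sup>2) \<longlonglongrightarrow> T"
        by blast+
    qed auto
    then have "f (X T \<omega>) * exp (- B T \<omega> - T / 2) = f x" using elim(3,4) by (simp add: e_def mult.commute)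
    then have "f x * exp (B T \<omega> + T / 2) = f (X T \<omega>) * (exp (- B T \<omega> - T / 2) * exp (B T \<omega> + T / 2))" by simp
    also have "exp (- B T \<omega> - T / 2) * exp (B T \<omega> + T / 2) = 1" by (simp flip: exp_add)
    finally show ?case by simp
  qed
qed

end

text \<open>The identity obtained on the space of \<open>X\<close> involves the driving motion
  \<open>B\<close>, while \<open>W\<close> may live on another space. For each fixed time both sides
  are images of one normal law under the same map.\<close>

theorem proposition3p5:
  fixes \<sigma> \<sigma>' \<mu> f :: "real \<Rightarrow> real" and x a :: real
    and M :: "'a measure" and F :: "real \<Rightarrow> 'a measure" and B X :: "real \<Rightarrow> 'a \<Rightarrow> real"
    and N :: "'b measure" and G :: "real \<Rightarrow> 'b measure" and W :: "real \<Rightarrow> 'b \<Rightarrow> real"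
  assumes "0 \<le> x"
    and "weak_solution {0..} \<sigma> \<mu> x M F B X"
    and "weakly_unique TYPE('a) {0..} \<sigma> \<mu> x"
    and "\<forall>t\<ge>0. (\<integral>\<^sup>+\<omega>. (\<integral>\<^sup>+u\<in>{0..t}. ennreal ((\<sigma> (X u \<omega>))\<^sup>2) \<partial>lborel) \<partial>M) < \<infinity>"
    and "\<forall>t\<ge>0. (\<integral>\<^sup>+\<omega>. (\<integral>\<^sup>+u\<in>{0..t}. ennreal \<bar>\<mu> (X u \<omega>)\<bar> \<partial>lborel) \<partial>M) < \<infinity>"
    and "C1_on {0..} \<sigma> \<sigma>'"
    and "\<forall>y>0. \<bar>\<sigma> y\<bar> > 0"
    and "exp_primitive a \<sigma> f"
    and "\<forall>y\<ge>0. \<mu> y = \<sigma> y / 2 * (1 + \<sigma>' y)"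
    and "hypothesis_H {0..} \<sigma> \<mu> M X f"
    and "brownian_motion N G W"
  shows "associated M (\<lambda>t \<omega>. f (X t \<omega>)) N (\<lambda>t \<omega>. f x * exp (W t \<omega> + t / 2))"
  unfolding associated_def
proof (intro allI impI)
  fix t :: real assume t: "0 \<le> t"
  have ws: "weak_solution {0..} \<sigma> \<mu> x M F B X" by fact
  interpret X: brownian M F B using ws by unfold_locales (simp add: weak_solution_def)
  interpret W: brownian N G W by unfold_locales fact
  \<comment> \<open>Hypothesis H supplies the derivatives of \<open>f\<close>, continuous up to the
    boundary point 0; \<open>exp_primitive\<close> alone determines them on the open
    half-line.\<close>
  obtain f1 f2 where f: "C1_on {0..} f f1" "C1_on {0..} f1 f2"
    using \<open>hypothesis_H {0..} \<sigma> \<mu> M X f\<close> unfolding hypothesis_H_def by blast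
  note \<sigma>c = C1_on_continuous[OF \<open>C1_on {0..} \<sigma> \<sigma>'\<close>]
  have "continuous_on {0..} (\<lambda>y. \<sigma> y / 2 * (1 + \<sigma>' y))" using \<sigma>c by (intro continuous_intros) auto
  then have \<mu>c: "continuous_on {0..} \<mu>"
    by (rule continuous_on_eq) (use \<open>\<forall>y\<ge>0. \<mu> y = _\<close> in simp)
  note eq = exp_primitive_equations[OF \<open>exp_primitive a \<sigma> f\<close> \<open>C1_on {0..} \<sigma> \<sigma>'\<close> \<open>\<forall>y>0. \<bar>\<sigma> y\<bar> > 0\<close>
    \<open>\<forall>y\<ge>0. \<mu> y = _\<close> f]
  have X: "X t \<in> borel_measurable M" "\<And>\<omega>. \<omega> \<in> space M \<Longrightarrow> 0 \<le> X t \<omega>" "AE \<omega> in M. X 0 \<omega> = x"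
    using ws t X.measurable_F_M[of "X t" t] unfolding weak_solution_def adapted_def by auto
  have "(\<lambda>y. f (max 0 y)) \<in> borel_measurable borel"
    by (intro borel_measurable_continuous_onI continuous_on_compose2[OF C1_on_continuous(1)[OF f(1)]])
      (auto intro!: continuous_intros)
  from measurable_compose[OF X(1) this] have fX: "(\<lambda>\<omega>. f (X t \<omega>)) \<in> borel_measurable M"
    by (rule measurable_cong[THEN iffD1, rotated]) (use X(2) in \<open>simp add: max_absorb2\<close>)
  have [measurable]: "B t \<in> borel_measurable M" "W t \<in> borel_measurable N" using t by auto
  have "AE \<omega> in M. f (X t \<omega>) = f x * exp (B t \<omega> + t / 2)"
  \<comment> \<open>Partitions need an interval of positive length. At time 0 the identity is the
    initial condition together with \<open>B 0 = 0\<close>.\<close>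
  proof (cases "t = 0")
    case True
    have "AE \<omega> in M. B 0 \<omega> = 0" using X.bm by (simp add: brownian_motion_def)
    then show ?thesis using X(3) by eventually_elim (simp add: True)
  next
    case False
    then show ?thesis
      using X.ito_exp_formula[OF ws \<sigma>c(1) \<mu>c f eq] t assms(4) by simp
  qed
  then have "distr M borel (\<lambda>\<omega>. f (X t \<omega>)) = distr M borel (\<lambda>\<omega>. f x * exp (B t \<omega> + t / 2))"
    using fX by (intro distr_cong_AE) auto
  \<comment> \<open>Writing the law as an image of the law of \<open>B t\<close> isolates the only
    ingredient that depends on the probability space.\<close>
  also have "\<dots> = distr (distr M borel (B t)) borel (\<lambda>b. f x * exp (b + t / 2))"
    by (subst distr_distr) (auto simp: o_def)
  also have "distr M borel (B t) = distr N borel (W t)" by (simp only: X.distr_B[OF t] W.distr_B[OF t])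
  also have "distr (distr N borel (W t)) borel (\<lambda>b. f x * exp (b + t / 2)) = distr N borel (\<lambda>\<omega>. f x * exp (W t \<omega> + t / 2))"
    by (subst distr_distr) (auto simp: o_def)
  finally show "(\<lambda>\<omega>. f (X t \<omega>)) \<in> borel_measurable M \<and> (\<lambda>\<omega>. f x * exp (W t \<omega> + t / 2)) \<in> borel_measurable N \<and>
      distr M borel (\<lambda>\<omega>. f (X t \<omega>)) = distr N borel (\<lambda>\<omega>. f x * exp (W t \<omega> + t / 2))"
    using fX by simp
qed

end
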